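(* Assume GRH. Let $X$ be large and $x=\exp\big(4\sqrt{\log X\,\log_2X}\,\log_3X\big)$. Then, as $X\to\infty$, $$\max_{\substack{X<d\le 2X\\ d\in\mathcal F}}\ \sum_{n\le x}\chi_d(n)\ \ge\ \sqrt{x}\,\exp\bigg((1+o(1))\sqrt{\frac{\log X}{\log_2X}}\bigg).$$
   Context: $\mathcal F$ denotes the set of fundamental discriminants, and for $d\in\mathcal F$, $\chi_d(n)=\left(\frac{d}{n}\right)$ is the associated real primitive (Kronecker symbol) character. $\log_j$ denotes the $j$-fold iterated logarithm. GRH is the generalized Riemann hypothesis for Dirichlet $L$-functions. *)

theory Defs
  imports "HOL-Analysis.Analysis" "HOL-Number_Theory.Number_Theory" "HOL-Computational_Algebra.Squarefree"
begin

definition fundamental_discriminant :: "int \<Rightarrow> bool" where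
  "fundamental_discriminant d \<longleftrightarrow>
     d \<noteq> 1 \<and>
     ((d mod 4 = 1 \<and> squarefree d) \<or>
      (\<exists>m. d = 4 * m \<and> (m mod 4 = 2 \<or> m mod 4 = 3) \<and> squarefree m))"

definition kronecker_prime :: "int \<Rightarrow> nat \<Rightarrow> int" where
  "kronecker_prime d p =
     (if p = 2 then
        (if even d then 0 else if d mod 8 = 1 \<or> d mod 8 = 7 then 1 else -1)
      else Legendre d (int p))"

definition kronecker :: "int \<Rightarrow> nat \<Rightarrow> int" where
  "kronecker d n =
     (if n = 0 then 0 else
      (\<Prod>p\<in>prime_factors n. kronecker_prime d p ^ multiplicity p n))"

definition dirichlet_character :: "nat \<Rightarrow> (nat \<Rightarrow> complex) \<Rightarrow> bool" where
  "dirichlet_character q chi \<longleftrightarrow>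
     q \<ge> 1 \<and> chi 1 = 1 \<and>
     (\<forall>n. chi (n + q) = chi n) \<and>
     (\<forall>m n. chi (m * n) = chi m * chi n) \<and>
     (\<forall>n. chi n = 0 \<longleftrightarrow> \<not> coprime n q)"

text \<open>GRH for Dirichlet L-functions: the L-function L(s,chi) (the analytic continuation
  to C minus {1} of the Dirichlet series, unique by the identity theorem) has all its zeros
  in the critical strip 0 < Re s < 1 on the line Re s = 1/2.\<close>
definition GRH :: bool where
  "GRH \<longleftrightarrow>
     (\<forall>q chi. dirichlet_character q chi \<longrightarrow>
        (\<exists>L. L holomorphic_on (- {1}) \<and>
             (\<forall>s. Re s > 1 \<longrightarrow>
                  (\<lambda>n. chi (Suc n) / of_nat (Suc n) powr s) sums L s) \<and>
             (\<forall>s. s \<noteq> 1 \<and> 0 < Re s \<and> Re s < 1 \<and> L s = 0 \<longrightarrow> Re s = 1/2)))"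

end

theory Submission
  imports Defs "HOL-Real_Asymp.Real_Asymp"
begin

text \<open>The proof is a resonance argument, carried out over the subfamily of squarefree
  \<open>d \<equiv> 1 (mod 8)\<close> with \<open>X < d \<le> 2X\<close>. Put \<open>R(d) = \<Sum> r(m) \<chi>\<^sub>d(m)\<close> with \<open>r\<close> multiplicative, supported on
  squarefree \<open>m \<le> N = X\<^bsup>c/4\<^esup>\<close> composed of primes \<open>L\<^sup>2 < p \<le> L\<^bsup>2K\<^esup>\<close>, where \<open>r(p) = L / (\<surd>p log p)\<close> and
  \<open>L = (c/2) \<surd>(log X log\<^sub>2 X)\<close>. The maximum is at least the average of the character sum with weights
  \<open>R(d)\<^sup>2\<close>, and by orthogonality only the terms for which \<open>m\<^sub>1 m\<^sub>2 n\<close> is a square count: \<open>n = l\<^sup>2 m\<^sub>1 m\<^sub>2 / gcd(m\<^sub>1, m\<^sub>2)\<^sup>2\<close>.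
  It is enough to keep prime \<open>l\<close>, which gives \<open>\<surd>x\<close> up to a logarithm; the sum over \<open>m\<^sub>1, m\<^sub>2\<close>
  gives \<open>\<Prod> (1 + 2 r(p) / \<surd>p) = exp (2 L \<Sum> 1 / (p log p)) \<approx> exp (L / log L)\<close>, where Mertens' first theorem
  is precise enough, and Rankin's trick disposes of the truncations. Letting \<open>c\<close> tend to 1 yields the result.
  As \<open>N < X\<^bsup>1/4\<^esup>\<close> and \<open>x = X\<^bsup>o(1)\<^esup>\<close>, the off-diagonal terms are controlled by the mere periodicity of
  \<open>d \<mapsto> \<chi>\<^sub>d(k)\<close> together with Moebius inversion for the condition that \<open>d\<close> is squarefree.\<close>

section \<open>Chebyshev and Mertens estimates\<close>

text \<open>The exponents are forced by the off-diagonal terms. Such a term has modulus at most 8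
  N^2 x; splitting the square divisors at X^(1/4) leaves an error of about N^2 x X^(1/4) + X^(3/4).
  There are x values of n, and Cauchy-Schwarz costs another factor N, so N^3 X^(1/4) and N X^(3/4)
  must both stay below X, up to powers of x = X^o(1): both conditions read N < X^(1/4). The constant
  in L is then dictated by the truncation: under the weights r(m)^2 the expected log m is roughly
  L^2 \<Sum> 1/(p log p), about L^2/(2 log L), hence about (c^2/4) log X, and this is below log N =
  (c/4) log X because c < 1. As log L is about (log_2 X)/2, the gain exp (L/log L) is close to exp
  (c sqrt (log X/log_2 X)). Primes above L^2 keep r(p) small, and stopping at L^(2K) loses only a
  share 1/K of the sum of 1/(p log p). Finally m1 m2/gcd(m1, m2)^2 can be as large as exp (O(K L));
  the factor log_3 X in log x absorbs the constant K, however large, and leaves room for l.\<close>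

lemma card_multiples:
  fixes d n :: nat
  assumes "d > 0"
  shows "card {k \<in> {1..n}. d dvd k} = n div d"
proof -
  have "{k \<in> {1..n}. d dvd k} = (\<lambda>j. d * j) ` {1..n div d}"
  proof (intro equalityI subsetI)
    fix k assume "k \<in> {k \<in> {1..n}. d dvd k}"
    then obtain j where "k = d * j" "k \<le> n" "k \<ge> 1" by auto
    moreover from this have "j \<le> n div d"
      using assms by (simp add: less_eq_div_iff_mult_less_eq mult.commute)
    moreover from \<open>k = d * j\<close> \<open>k \<ge> 1\<close> have "j \<ge> 1" by (cases j) auto
    ultimately show "k \<in> (\<lambda>j. d * j) ` {1..n div d}" by auto
  next
    fix k assume "k \<in> (\<lambda>j. d * j) ` {1..n div d}"
    then obtain j where "k = d * j" "j \<in> {1..n div d}" by blast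
    then show "k \<in> {k \<in> {1..n}. d dvd k}"
      using assms by (auto simp: less_eq_div_iff_mult_less_eq mult.commute)
  qed
  then show ?thesis using assms by (simp add: card_image inj_on_def)
qed

text \<open>Writes \<open>ln k\<close> as a sum over the divisors of \<open>k\<close> and counts
  multiples. The range of \<open>d\<close> may exceed \<open>n\<close>, where \<open>n div d\<close>
  is 0; this lets the identities for \<open>n\<close> and \<open>2*n\<close> be subtracted term by
  term over one range.\<close>

lemma sum_ln_eq_sum_mangoldt:
  assumes "n \<le> m"
  shows "(\<Sum>k=1..n. ln (real k)) = (\<Sum>d=1..m. mangoldt d * real (n div d))"
proof -
  have "(\<Sum>k=1..n. ln (real k)) = (\<Sum>k=1..n. \<Sum>d=1..m. if d dvd k then mangoldt d else 0)"
  proof (rule sum.cong)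
    fix k assume k: "k \<in> {1..n}"
    then have "ln (real k) = (\<Sum>d | d dvd k. mangoldt d)"
      using mangoldt_sum[of k, where 'a = real] by simp
    also have "\<dots> = (\<Sum>d\<in>{d \<in> {1..m}. d dvd k}. mangoldt d)"
      using k assms by (intro sum.cong) (auto dest: dvd_imp_le simp: Suc_le_eq intro!: Nat.gr0I)
    also have "\<dots> = (\<Sum>d=1..m. if d dvd k then mangoldt d else 0)"
      by (rule sum.inter_filter) simp
    finally show "ln (real k) = (\<Sum>d=1..m. if d dvd k then mangoldt d else 0)" .
  qed simp
  also have "\<dots> = (\<Sum>d=1..m. \<Sum>k=1..n. if d dvd k then mangoldt d else 0)"
    by (rule sum.swap)
  also have "\<dots> = (\<Sum>d=1..m. mangoldt d * real (n div d))"
  proof (rule sum.cong)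
    fix d assume "d \<in> {1..m}"
    have "(\<Sum>k=1..n. if d dvd k then mangoldt d else (0::real)) =
            (\<Sum>k\<in>{k \<in> {1..n}. d dvd k}. mangoldt d)"
      by (rule sum.inter_filter [symmetric]) simp
    also have "\<dots> = mangoldt d * real (n div d)"
      using card_multiples[of d n] \<open>d \<in> {1..m}\<close> by simp
    finally show "(\<Sum>k=1..n. if d dvd k then mangoldt d else (0::real)) = mangoldt d * real (n div d)" .
  qed simp
  finally show ?thesis .
qed

lemma sum_ln_eq_ln_fact: "(\<Sum>k=1..n. ln (real k)) = ln (fact n :: real)"
  by (induction n) (simp_all add: ln_mult)

text \<open>The factor \<open>(2*n) div d - 2 * (n div d)\<close> is never negative and equals 1 for
  \<open>n < d \<le> 2*n\<close>, so the von Mangoldt mass of that range is at most the logarithm of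
  the central binomial coefficient.\<close>

lemma chebyshev_psi_double:
  "(\<Sum>d=1..2*n. mangoldt d) \<le> (\<Sum>d=1..n. mangoldt d) + 2 * real n * ln 2"
proof -
  have sub: "{n+1..2*n} \<subseteq> {1..2*n}" by auto
  have "(\<Sum>d=1..2*n. mangoldt d) - (\<Sum>d=1..n. mangoldt d) = (\<Sum>d=n+1..2*n. mangoldt d :: real)"
  proof -
    have "{1..2*n} = {1..n} \<union> {n+1..2*n}" by auto
    then have "(\<Sum>d=1..2*n. mangoldt d :: real) = (\<Sum>d=1..n. mangoldt d) + (\<Sum>d=n+1..2*n. mangoldt d)"
      by (simp add: sum.union_disjoint)
    then show ?thesis by simp
  qed
  also have "\<dots> \<le> (\<Sum>d=n+1..2*n. mangoldt d * (real ((2*n) div d) - 2 * real (n div d)))"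
  proof (rule sum_mono)
    fix d assume d: "d \<in> {n+1..2*n}"
    then have "(2*n) div d = 1" "n div d = 0" by (auto intro: div_nat_eqI)
    then show "(mangoldt d :: real) \<le> mangoldt d * (real ((2*n) div d) - 2 * real (n div d))" by simp
  qed
  also have "\<dots> \<le> (\<Sum>d=1..2*n. mangoldt d * (real ((2*n) div d) - 2 * real (n div d)))"
  proof (rule sum_mono2[OF _ sub])
    fix d
    have "2 * (n div d) \<le> (2*n) div d"
      by (cases "d = 0") (simp_all add: less_eq_div_iff_mult_less_eq)
    then have "real (2 * (n div d)) \<le> real ((2*n) div d)" by (rule of_nat_mono)
    then show "0 \<le> (mangoldt d :: real) * (real ((2*n) div d) - 2 * real (n div d))"
      by (intro mult_nonneg_nonneg mangoldt_nonneg) simp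
  qed simp
  also have "\<dots> = ln (fact (2*n)) - 2 * ln (fact n)"
    using sum_ln_eq_sum_mangoldt[of "2*n" "2*n"] sum_ln_eq_sum_mangoldt[of n "2*n"]
    unfolding sum_ln_eq_ln_fact
    by (simp add: right_diff_distrib sum_subtractf sum_distrib_left mult_ac)
  also have "\<dots> = ln (real ((2*n) choose n))"
  proof -
    have "fact n * fact n * ((2*n) choose n) = (fact (2*n) :: nat)"
      using binomial_fact_lemma[of n "2*n"] by simp
    then have "fact n * fact n * real ((2*n) choose n) = fact (2*n)"
      by (metis of_nat_fact of_nat_mult)
    moreover have "real ((2*n) choose n) > 0" by simp
    ultimately have "ln (fact (2*n)) = ln (fact n * fact n * real ((2*n) choose n))" by simp
    also have "\<dots> = 2 * ln (fact n) + ln (real ((2*n) choose n))"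
      by (subst ln_mult) (simp_all add: ln_mult)
    finally show ?thesis by simp
  qed
  also have "\<dots> \<le> ln (2 ^ (2*n))"
  proof -
    have "real ((2*n) choose n) \<le> real (2 ^ (2*n))"
      using binomial_le_pow2[of "2*n" n] of_nat_mono by blast
    then show ?thesis by (subst ln_le_cancel_iff) simp_all
  qed
  also have "\<dots> = 2 * real n * ln 2" by (simp add: ln_realpow)
  finally show ?thesis by simp
qed

text \<open>Halving \<open>n\<close>, rounded up to \<open>m\<close>, turns the doubling estimate
  into a recursion. The constant 6 closes it because
  \<open>6*m + 2*m*ln 2 \<le> 8*m \<le> 4*(n + 1) \<le> 6*n\<close> for
  \<open>n \<ge> 2\<close>.\<close>

lemma chebyshev_psi_bound: "(\<Sum>d=1..n. mangoldt d) \<le> 6 * real n"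
proof (induction n rule: less_induct)
  case (less n)
  show ?case
  proof (cases "n \<le> 1")
    case True
    then show ?thesis by (cases n) auto
  next
    case False
    define m where "m = (n + 1) div 2"
    have m: "m < n" "n \<le> 2 * m" "2 * m \<le> n + 1" using False by (auto simp: m_def)
    have "(\<Sum>d=1..n. mangoldt d :: real) \<le> (\<Sum>d=1..2*m. mangoldt d)"
      using m by (intro sum_mono2) (auto simp: mangoldt_nonneg)
    also have "\<dots> \<le> (\<Sum>d=1..m. mangoldt d) + 2 * real m * ln 2" by (rule chebyshev_psi_double)
    also have "\<dots> \<le> 6 * real m + 2 * real m * ln 2" using less.IH[OF m(1)] by simp
    also have "\<dots> \<le> 6 * real m + 2 * real m * 1"
      using ln_2_less_1 by (intro add_left_mono mult_left_mono) auto
    also have "\<dots> = 4 * real (2 * m)" by simp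
    also have "\<dots> \<le> 4 * real (n + 1)" using m(3) of_nat_mono by (metis mult_le_cancel_left_pos zero_less_numeral)
    also have "\<dots> \<le> 6 * real n" using False by simp
    finally show ?thesis .
  qed
qed

lemma ln_fact_lower: "n \<ge> 1 \<Longrightarrow> ln (fact n :: real) \<ge> real n * ln (real n) - real n"
proof (induction n rule: nat_induct_at_least)
  case (Suc n)
  have "real n * (ln (real n + 1) - ln (real n)) \<le> 1"
  proof -
    have "ln (real n + 1) - ln (real n) = ln ((real n + 1) / real n)"
      using Suc.hyps by (simp add: ln_div)
    also have "(real n + 1) / real n = 1 + 1 / real n"
      using Suc.hyps by (simp add: field_simps)
    also have "ln (1 + 1 / real n) \<le> 1 / real n" by (rule ln_add_one_self_le_self) simp
    finally show ?thesis using Suc.hyps by (simp add: field_simps)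
  qed
  moreover have "ln (fact (Suc n) :: real) = ln (real n + 1) + ln (fact n)"
    unfolding fact_Suc by (subst ln_mult) (simp_all add: add.commute)
  moreover have "real (Suc n) = real n + 1" by simp
  ultimately show ?case using Suc.IH by (simp add: algebra_simps del: fact_Suc)
qed simp

lemma ln_fact_upper: "n \<ge> 1 \<Longrightarrow> ln (fact n :: real) \<le> real n * ln (real n)"
proof -
  assume "n \<ge> 1"
  have "(fact n :: real) \<le> of_nat (n ^ n)" by (rule fact_le_power)
  then have "ln (fact n :: real) \<le> ln (real n ^ n)"
    using \<open>n \<ge> 1\<close> by (subst ln_le_cancel_iff) auto
  then show ?thesis using \<open>n \<ge> 1\<close> by (simp add: ln_realpow)
qed

text \<open>Compares \<open>ln (fact n)\<close>, the sum of \<open>mangoldt d * (n div d)\<close>,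
  with the same sum without rounding. The rounding costs at most \<open>mangoldt d\<close> per term,
  \<open>6*n\<close> in total by Chebyshev's bound; the crude bounds for the factorial do the
  rest.\<close>

lemma mertens_mangoldt:
  assumes "n \<ge> 1"
  shows "(\<Sum>d=1..n. mangoldt d / real d) \<ge> ln (real n) - 1"
    and "(\<Sum>d=1..n. mangoldt d / real d) \<le> ln (real n) + 6"
proof -
  define M :: real where "M = (\<Sum>d=1..n. mangoldt d / real d)"
  have eq: "ln (fact n :: real) = (\<Sum>d=1..n. mangoldt d * real (n div d))"
    using sum_ln_eq_sum_mangoldt[of n n] unfolding sum_ln_eq_ln_fact by simp
  have "ln (fact n :: real) \<le> (\<Sum>d=1..n. mangoldt d * (real n / real d))"
    unfolding eq by (intro sum_mono mult_left_mono mangoldt_nonneg of_nat_div_le_of_nat)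
  also have "\<dots> = real n * M" by (simp add: M_def sum_distrib_left mult_ac)
  finally have "real n * (ln (real n) - 1) \<le> real n * M"
    using ln_fact_lower[OF assms] by (simp add: algebra_simps)
  then show "M \<ge> ln (real n) - 1" using assms by simp
  have "real n * M - 6 * real n \<le> real n * M - (\<Sum>d=1..n. mangoldt d)"
    using chebyshev_psi_bound[of n] by simp
  also have "\<dots> = (\<Sum>d=1..n. mangoldt d * (real n / real d - 1))"
    by (simp add: M_def sum_distrib_left sum_subtractf algebra_simps)
  also have "\<dots> \<le> ln (fact n)"
    unfolding eq
  proof (intro sum_mono mult_left_mono mangoldt_nonneg)
    fix d assume "d \<in> {1..n}"
    then have "n < (n div d + 1) * d" using dividend_less_div_times[of d n] by (simp add: algebra_simps)
    then have "real n < real ((n div d + 1) * d)" by (rule of_nat_less_iff[THEN iffD2])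
    then show "real n / real d - 1 \<le> real (n div d)"
      using \<open>d \<in> {1..n}\<close> by (simp add: field_simps)
  qed
  also have "\<dots> \<le> real n * ln (real n)" by (rule ln_fact_upper[OF assms])
  finally have "real n * M \<le> real n * (ln (real n) + 6)" by (simp add: algebra_simps)
  then show "M \<le> ln (real n) + 6" using assms by simp
qed

lemma geometric_tail_bound:
  fixes q :: real
  assumes "0 \<le> q" "q < 1"
  shows "(\<Sum>i=2..n. q ^ i) \<le> q\<^sup>2 / (1 - q)"
proof -
  have "(\<Sum>i=2..n. q ^ i) * (1 - q) \<le> q\<^sup>2"
  proof (cases "n \<ge> 2")
    case True
    then have "(\<Sum>i=2..n. q ^ i) * (1 - q) = q\<^sup>2 - q ^ Suc n"
      using sum_gp_multiplied[of 2 n q] by (simp add: mult.commute)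
    then show ?thesis using assms by simp
  qed (use assms in simp)
  then show ?thesis using assms by (simp add: field_simps)
qed

text \<open>Only proper prime powers contribute. For each prime the exponents from 2 on form a
  geometric series, at most twice its first term since \<open>p \<ge> 2\<close>, and
  \<open>2 * ln k / k^2\<close> is summable even over all integers.\<close>

lemma mangoldt_nonprime_sum_bounded:
  "\<exists>C. \<forall>n. (\<Sum>d\<in>{d\<in>{1..n}. \<not> prime d}. mangoldt d / real d) \<le> C"
proof -
  define g where "g = (\<lambda>k::nat. 2 * ln (real k) / real k ^ 2)"
  have "summable g"
  proof (rule summable_comparison_test_bigo)
    show "summable (\<lambda>k. norm (real k powr (-3/2)))"
      using summable_real_powr_iff[of "-3/2"] by simp
    show "g \<in> O(\<lambda>k. real k powr (-3/2))" unfolding g_def by real_asymp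
  qed
  have g_nonneg: "g k \<ge> 0" for k unfolding g_def by (cases "k = 0") auto
  have "(\<Sum>d\<in>{d\<in>{1..n}. \<not> prime d}. mangoldt d / real d) \<le> suminf g" for n
  proof -
    define S where "S = {p\<in>{2..n}. prime p} \<times> {2..n}"
    let ?h = "\<lambda>(p, i). p ^ i :: nat"
    have sub: "{d\<in>{1..n}. \<not> prime d \<and> primepow d} \<subseteq> ?h ` S"
    proof
      fix d assume d: "d \<in> {d\<in>{1..n}. \<not> prime d \<and> primepow d}"
      then obtain p i where pi: "prime p" "i > 0" "d = p ^ i" by (auto simp: primepow_def)
      then have "i \<noteq> 1" using d by auto
      with pi have i: "i \<ge> 2" by simp
      have p: "p \<ge> 2" using pi(1) prime_ge_2_nat by blast
      have "p \<le> p ^ i" using p i by (simp add: self_le_power)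
      moreover have "i < p ^ i" using p by (simp add: power_gt_expt)
      moreover have "p ^ i \<le> n" using d pi(3) by simp
      ultimately have "(p, i) \<in> S" using pi(1) p i by (auto simp: S_def)
      then show "d \<in> ?h ` S" using pi(3) by (intro image_eqI[of _ _ "(p, i)"]) simp_all
    qed
    have "(\<Sum>d\<in>{d\<in>{1..n}. \<not> prime d}. mangoldt d / real d) =
            (\<Sum>d\<in>{d\<in>{1..n}. \<not> prime d \<and> primepow d}. mangoldt d / real d)"
      by (rule sum.mono_neutral_right) (auto simp: mangoldt_def)
    also have "\<dots> \<le> (\<Sum>d\<in>?h ` S. mangoldt d / real d)"
      by (rule sum_mono2[OF _ sub]) (auto simp: S_def mangoldt_nonneg)
    also have "\<dots> \<le> (\<Sum>x\<in>S. ((\<lambda>d. mangoldt d / real d) \<circ> ?h) x)"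
      by (rule sum_image_le) (auto simp: S_def mangoldt_nonneg)
    also have "\<dots> = (\<Sum>(p,i)\<in>S. ln (real p) * (1 / real p) ^ i)"
      by (rule sum.cong) (auto simp: S_def mangoldt_primepow power_one_over)
    also have "\<dots> = (\<Sum>p\<in>{p\<in>{2..n}. prime p}. ln (real p) * (\<Sum>i=2..n. (1 / real p) ^ i))"
      unfolding S_def by (subst sum.cartesian_product [symmetric]) (simp add: sum_distrib_left)
    also have "\<dots> \<le> (\<Sum>p\<in>{p\<in>{2..n}. prime p}. g p)"
    proof (rule sum_mono)
      fix p assume "p \<in> {p\<in>{2..n}. prime p}"
      then have p: "real p \<ge> 2" by auto
      have "(\<Sum>i=2..n. (1 / real p) ^ i) \<le> (1 / real p)\<^sup>2 / (1 - 1 / real p)"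
        by (rule geometric_tail_bound) (use p in auto)
      also have "\<dots> \<le> (1 / real p)\<^sup>2 / (1 / 2)"
        using p by (intro divide_left_mono) (auto simp: field_simps)
      finally have "ln (real p) * (\<Sum>i=2..n. (1 / real p) ^ i) \<le> ln (real p) * ((1 / real p)\<^sup>2 / (1 / 2))"
        using p by (intro mult_left_mono) auto
      then show "ln (real p) * (\<Sum>i=2..n. (1 / real p) ^ i) \<le> g p"
        by (simp add: g_def power_one_over mult.commute)
    qed
    also have "\<dots> \<le> suminf g"
      by (rule sum_le_suminf[OF \<open>summable g\<close>]) (auto simp: g_nonneg)
    finally show ?thesis .
  qed
  then show ?thesis by blast
qed

theorem mertens_first:
  "\<exists>E>0. \<forall>n\<ge>1. \<bar>(\<Sum>p\<in>{p\<in>{1..n}. prime p}. ln (real p) / real p) - ln (real n)\<bar> \<le> E"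
proof -
  obtain C where C: "\<And>n. (\<Sum>d\<in>{d\<in>{1..n}. \<not> prime d}. mangoldt d / real d) \<le> C"
    using mangoldt_nonprime_sum_bounded by blast
  have "\<bar>(\<Sum>p\<in>{p\<in>{1..n}. prime p}. ln (real p) / real p) - ln (real n)\<bar> \<le> \<bar>C\<bar> + 6"
    if "n \<ge> 1" for n :: nat
  proof -
    have "(\<Sum>d=1..n. mangoldt d / real d) = (\<Sum>p\<in>{p\<in>{1..n}. prime p} \<union> {p\<in>{1..n}. \<not> prime p}. mangoldt p / real p :: real)"
      by (rule sum.cong) auto
    also have "\<dots> = (\<Sum>p\<in>{p\<in>{1..n}. prime p}. mangoldt p / real p) +
        (\<Sum>p\<in>{p\<in>{1..n}. \<not> prime p}. mangoldt p / real p)"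
      by (rule sum.union_disjoint) auto
    finally have split: "(\<Sum>d=1..n. mangoldt d / real d) =
        (\<Sum>p\<in>{p\<in>{1..n}. prime p}. ln (real p) / real p) +
        (\<Sum>p\<in>{p\<in>{1..n}. \<not> prime p}. mangoldt p / real p)"
      by simp
    have "0 \<le> (\<Sum>p\<in>{p\<in>{1..n}. \<not> prime p}. mangoldt p / real p :: real)"
      by (intro sum_nonneg) (simp add: mangoldt_nonneg)
    then show ?thesis
      using mertens_mangoldt[OF that] C[of n] unfolding split by linarith
  qed
  then show ?thesis by (intro exI[of _ "\<bar>C\<bar> + 6"]) auto
qed

text \<open>Abel summation. The induction sets the boundary term \<open>e z * g z\<close> apart, so
  that each step adds only \<open>e z * (g z - g (Suc z))\<close>, and the decreases of
  \<open>g\<close> telescope.\<close>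

lemma sum_by_parts_error:
  fixes a e g :: "nat \<Rightarrow> real"
  assumes "m < z"
    and e: "\<And>n. n \<ge> m \<Longrightarrow> \<bar>e n\<bar> \<le> E"
    and g: "\<And>n. n > m \<Longrightarrow> g (Suc n) \<le> g n" "\<And>n. n > m \<Longrightarrow> g n \<ge> 0"
  shows "\<bar>\<Sum>n\<in>{m<..z}. (e n - e (n - 1)) * g n\<bar> \<le> 2 * E * g (Suc m)"
proof -
  have "\<bar>(\<Sum>n\<in>{m<..z}. (e n - e (n - 1)) * g n) - e z * g z\<bar> \<le> E * (2 * g (Suc m) - g z)"
    using Suc_leI[OF \<open>m < z\<close>]
  proof (induction z rule: nat_induct_at_least)
    case base
    have "{m<..Suc m} = {Suc m}" by auto
    moreover have "\<bar>e m * g (Suc m)\<bar> \<le> E * g (Suc m)"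
      using e[of m] g(2)[of "Suc m"] by (simp add: abs_mult mult_right_mono)
    ultimately show ?case by (simp add: algebra_simps)
  next
    case (Suc z)
    have "{m<..Suc z} = insert (Suc z) {m<..z}" using Suc.hyps by auto
    then have "(\<Sum>n\<in>{m<..Suc z}. (e n - e (n - 1)) * g n) - e (Suc z) * g (Suc z) =
        ((\<Sum>n\<in>{m<..z}. (e n - e (n - 1)) * g n) - e z * g z) + e z * (g z - g (Suc z))"
      by (simp add: algebra_simps)
    moreover have "\<bar>e z * (g z - g (Suc z))\<bar> \<le> E * (g z - g (Suc z))"
      using e[of z] g(1)[of z] Suc.hyps by (simp add: abs_mult mult_right_mono)
    ultimately show ?case using Suc.IH by (simp add: algebra_simps)
  qed
  moreover have "\<bar>e z * g z\<bar> \<le> E * g z"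
    using e[of z] g(2)[of z] \<open>m < z\<close> by (simp add: abs_mult mult_right_mono)
  ultimately show ?thesis by (simp add: algebra_simps)
qed

section \<open>Sums over primes in intervals\<close>

definition primes_between :: "nat \<Rightarrow> nat \<Rightarrow> nat set" where
  "primes_between m z = {p \<in> {m<..z}. prime p}"

lemma finite_primes_between [simp]: "finite (primes_between m z)"
  by (simp add: primes_between_def)

definition mertens_error :: "nat \<Rightarrow> real" where
  "mertens_error n = (\<Sum>p\<in>{p\<in>{1..n}. prime p}. ln (real p) / real p) - ln (real n)"

lemma mertens_error_diff:
  assumes "n \<ge> 1"
  shows "mertens_error n - mertens_error (n - 1) =
    (if prime n then ln (real n) / real n else 0) - (ln (real n) - ln (real (n - 1)))"
proof -
  have "{p\<in>{1..n}. prime p} = {p\<in>{1..n-1}. prime p} \<union> (if prime n then {n} else {})"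
    using assms by (auto simp: le_less)
  moreover have "n \<notin> {p\<in>{1..n-1}. prime p}" using assms by auto
  ultimately have "(\<Sum>p\<in>{p\<in>{1..n}. prime p}. ln (real p) / real p) =
      (\<Sum>p\<in>{p\<in>{1..n-1}. prime p}. ln (real p) / real p) + (if prime n then ln (real n) / real n else 0)"
    by (cases "prime n") (simp_all add: sum.insert_if)
  then show ?thesis unfolding mertens_error_def by linarith
qed

lemma sum_telescope_greaterThanAtMost:
  fixes h :: "nat \<Rightarrow> 'a :: ab_group_add"
  assumes "m \<le> z"
  shows "(\<Sum>n\<in>{m<..z}. h (n - 1) - h n) = h m - h z"
  using assms
proof (induction z rule: nat_induct_at_least)
  case (Suc z)
  then have "{m<..Suc z} = insert (Suc z) {m<..z}" by auto
  then show ?case using Suc by simp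
qed simp

lemma prime_ln_sum_between:
  assumes E: "\<And>n. n \<ge> 1 \<Longrightarrow> \<bar>mertens_error n\<bar> \<le> E" and m: "1 \<le> m" "m \<le> z"
  shows "\<bar>(\<Sum>p\<in>primes_between m z. ln (real p) / real p) - (ln (real z) - ln (real m))\<bar> \<le> 2 * E"
proof -
  have "{p\<in>{1..z}. prime p} = {p\<in>{1..m}. prime p} \<union> primes_between m z"
    using m by (auto simp: primes_between_def)
  moreover have "{p\<in>{1..m}. prime p} \<inter> primes_between m z = {}"
    by (auto simp: primes_between_def)
  ultimately have "mertens_error z - mertens_error m =
      (\<Sum>p\<in>primes_between m z. ln (real p) / real p) - (ln (real z) - ln (real m))"
    by (simp add: mertens_error_def sum.union_disjoint)
  then show ?thesis using E[of m] E[of z] m by linarith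
qed

text \<open>The weight is \<open>ln p / p\<close> times \<open>1 / (ln p)^2\<close>, and
  \<open>ln n / n\<close> on primes is the increment of \<open>mertens_error\<close> plus that of
  \<open>ln\<close>. This separates a remainder, open to partial summation, from a smooth sum that
  stands in for an integral.\<close>

lemma prime_weighted_sum_eq:
  assumes "1 \<le> m"
  shows "(\<Sum>p\<in>primes_between m z. 1 / (real p * ln (real p))) =
    (\<Sum>n\<in>{m<..z}. (mertens_error n - mertens_error (n - 1)) * (1 / (ln (real n))\<^sup>2)) +
    (\<Sum>n\<in>{m<..z}. (ln (real n) - ln (real (n - 1))) * (1 / (ln (real n))\<^sup>2))"
proof -
  have "(\<Sum>p\<in>primes_between m z. 1 / (real p * ln (real p))) =
      (\<Sum>n\<in>{m<..z}. if prime n then 1 / (real n * ln (real n)) else 0)"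
    unfolding primes_between_def by (rule sum.inter_filter) simp
  also have "\<dots> = (\<Sum>n\<in>{m<..z}. (mertens_error n - mertens_error (n - 1)) * (1 / (ln (real n))\<^sup>2) +
     (ln (real n) - ln (real (n - 1))) * (1 / (ln (real n))\<^sup>2))"
  proof (rule sum.cong)
    fix n assume n: "n \<in> {m<..z}"
    then have "mertens_error n - mertens_error (n - 1) + (ln (real n) - ln (real (n - 1))) =
        (if prime n then ln (real n) / real n else 0)"
      using mertens_error_diff[of n] by simp
    then have "(mertens_error n - mertens_error (n - 1)) * (1 / (ln (real n))\<^sup>2) +
     (ln (real n) - ln (real (n - 1))) * (1 / (ln (real n))\<^sup>2) =
       (if prime n then ln (real n) / real n else 0) * (1 / (ln (real n))\<^sup>2)"
      unfolding distrib_right [symmetric] by (rule arg_cong)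
    moreover have "ln (real n) > 0" using n assms by simp
    ultimately show "(if prime n then 1 / (real n * ln (real n)) else 0) =
       (mertens_error n - mertens_error (n - 1)) * (1 / (ln (real n))\<^sup>2) +
     (ln (real n) - ln (real (n - 1))) * (1 / (ln (real n))\<^sup>2)"
      by (auto simp: power2_eq_square)
  qed simp
  finally show ?thesis by (simp add: sum.distrib)
qed

lemma prime_weighted_sum_error:
  assumes E: "\<And>n. n \<ge> 1 \<Longrightarrow> \<bar>mertens_error n\<bar> \<le> E" and m: "1 \<le> m" "m < z"
  shows "\<bar>\<Sum>n\<in>{m<..z}. (mertens_error n - mertens_error (n - 1)) * (1 / (ln (real n))\<^sup>2)\<bar>
           \<le> 2 * E / (ln (real m + 1))\<^sup>2"
proof -
  have "\<bar>\<Sum>n\<in>{m<..z}. (mertens_error n - mertens_error (n - 1)) * (1 / (ln (real n))\<^sup>2)\<bar>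
           \<le> 2 * E * (1 / (ln (real (Suc m)))\<^sup>2)"
    using m(2)
  proof (rule sum_by_parts_error)
    fix n assume "n > m"
    then have "ln (real n) > 0" using m by simp
    moreover have "ln (real n) \<le> ln (real (Suc n))" using \<open>n > m\<close> by simp
    ultimately show "1 / (ln (real (Suc n)))\<^sup>2 \<le> 1 / (ln (real n))\<^sup>2"
      by (intro divide_left_mono power_mono mult_pos_pos zero_less_power) linarith+
  qed (use E m in auto)
  then show ?thesis by (simp add: add.commute)
qed

text \<open>Discrete form of the integral of 1/(t ln^2 t): with \<open>a = ln (n - 1)\<close> and
  \<open>b = ln n\<close> one has \<open>(b - a) / b^2 \<le> 1/a - 1/b\<close>, which
  telescopes.\<close>

lemma prime_weighted_sum_upper:
  assumes E: "\<And>n. n \<ge> 1 \<Longrightarrow> \<bar>mertens_error n\<bar> \<le> E" and m: "2 \<le> m" "m < z"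
  shows "(\<Sum>p\<in>primes_between m z. 1 / (real p * ln (real p)))
           \<le> 1 / ln (real m) + 2 * E / (ln (real m + 1))\<^sup>2"
proof -
  have "(\<Sum>n\<in>{m<..z}. (ln (real n) - ln (real (n - 1))) * (1 / (ln (real n))\<^sup>2)) \<le>
        (\<Sum>n\<in>{m<..z}. 1 / ln (real (n - 1)) - 1 / ln (real n))"
  proof (rule sum_mono)
    fix n assume n: "n \<in> {m<..z}"
    define a b where "a = ln (real (n - 1))" and "b = ln (real n)"
    have ab: "0 < a" "a \<le> b" using n m by (auto simp: a_def b_def)
    then have "(b - a) * (1 / b\<^sup>2) \<le> (b - a) * (1 / (a * b))"
      by (intro mult_left_mono divide_left_mono) (auto simp: power2_eq_square)
    also have "\<dots> = 1 / a - 1 / b" using ab by (simp add: field_simps)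
    finally show "(ln (real n) - ln (real (n - 1))) * (1 / (ln (real n))\<^sup>2) \<le>
        1 / ln (real (n - 1)) - 1 / ln (real n)" by (simp add: a_def b_def)
  qed
  also have "\<dots> = 1 / ln (real m) - 1 / ln (real z)"
    using sum_telescope_greaterThanAtMost[of m z "\<lambda>n. 1 / ln (real n)"] m by simp
  also have "\<dots> \<le> 1 / ln (real m)" using m by simp
  finally show ?thesis
    using prime_weighted_sum_eq[of m z] prime_weighted_sum_error[OF E, of m z] m by simp
qed

text \<open>The telescope of the upper bound points in the wrong direction, so it is shifted by one,
  to \<open>1 / ln n - 1 / ln (n + 1)\<close>. Concavity of the logarithm, in the form
  \<open>(n + 1) * (n - 1) \<le> n * n\<close>, bounds these terms by those of the sum.\<close>

lemma prime_weighted_sum_lower: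
  assumes E: "\<And>n. n \<ge> 1 \<Longrightarrow> \<bar>mertens_error n\<bar> \<le> E" and m: "2 \<le> m" "m < z"
  shows "(\<Sum>p\<in>primes_between m z. 1 / (real p * ln (real p)))
           \<ge> 1 / ln (real m + 1) - 1 / ln (real z + 1) - 2 * E / (ln (real m + 1))\<^sup>2"
proof -
  have "1 / ln (real m + 1) - 1 / ln (real z + 1) =
      (\<Sum>n\<in>{m<..z}. 1 / ln (real (n - 1) + 1) - 1 / ln (real n + 1))"
    using sum_telescope_greaterThanAtMost[of m z "\<lambda>n. 1 / ln (real n + 1)"] m by simp
  also have "\<dots> \<le> (\<Sum>n\<in>{m<..z}. (ln (real n) - ln (real (n - 1))) * (1 / (ln (real n))\<^sup>2))"
  proof (rule sum_mono)
    fix n assume n: "n \<in> {m<..z}"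
    define a b c where "a = ln (real n - 1)" and "b = ln (real n)" and "c = ln (real n + 1)"
    have ab: "0 < a" "a \<le> b" "b \<le> c" using n m by (auto simp: a_def b_def c_def)
    have "c + a = ln ((real n + 1) * (real n - 1))"
      unfolding a_def c_def using n m by (subst ln_mult) auto
    also have "\<dots> \<le> ln (real n * real n)"
    proof (subst ln_le_cancel_iff)
      have "(real n + 1) * (real n - 1) > 0" using n m by (intro mult_pos_pos) auto
      then show "(real n + 1) * (real n - 1) > 0" .
    qed (use n m in \<open>auto simp: algebra_simps\<close>)
    also have "\<dots> = 2 * b" unfolding b_def using n m by (subst ln_mult) auto
    finally have cb: "c - b \<le> b - a" by simp
    have "1 / b - 1 / c = (c - b) * (1 / (b * c))" using ab by (simp add: field_simps)
    also have "\<dots> \<le> (b - a) * (1 / b\<^sup>2)"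
      using ab cb by (intro mult_mono divide_left_mono) (auto simp: power2_eq_square)
    finally show "1 / ln (real (n - 1) + 1) - 1 / ln (real n + 1) \<le>
      (ln (real n) - ln (real (n - 1))) * (1 / (ln (real n))\<^sup>2)"
      using n m by (simp add: a_def b_def c_def of_nat_diff)
  qed
  finally show ?thesis
    using prime_weighted_sum_eq[of m z] prime_weighted_sum_error[OF E, of m z] m by simp
qed

lemma mertens_error_bounded: "\<exists>E>0. \<forall>n\<ge>1. \<bar>mertens_error n\<bar> \<le> E"
  using mertens_first by (simp add: mertens_error_def)

text \<open>The window from \<open>y/C\<close> to \<open>y\<close> is long enough for Mertens'
  estimate to put at least 1 into the sum of \<open>ln p / p\<close>, while no term exceeds
  \<open>C * ln y / y\<close>. The lower end matters when the primes \<open>l\<close> are counted,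
  as these must also be at least \<open>L^2\<close>.\<close>

lemma prime_count_lower:
  "\<exists>C>1. \<forall>y\<ge>C. card {p::nat. prime p \<and> y / C < real p \<and> real p \<le> y} \<ge> y / (C * ln y)"
proof -
  obtain E where E: "E > 0" "\<And>n. n \<ge> 1 \<Longrightarrow> \<bar>mertens_error n\<bar> \<le> E"
    using mertens_error_bounded by blast
  \<comment> \<open>On the logarithmic scale \<open>2 * E + 1\<close> beats the Mertens error
    \<open>2 * E\<close> by 1; the factor 2 covers the rounding of \<open>y\<close> down to
    \<open>z \<ge> y/2\<close>.\<close>
  define C where "C = 2 * exp (2 * E + 1)"
  have "exp (2 * E + 1) > 1" using E(1) by simp
  then have C: "C > 2" by (simp add: C_def)
  have "card {p::nat. prime p \<and> y / C < real p \<and> real p \<le> y} \<ge> y / (C * ln y)" if y: "y \<ge> C" for y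
  proof -
    define m z where "m = nat \<lfloor>y / C\<rfloor>" and "z = nat \<lfloor>y\<rfloor>"
    have m: "m \<ge> 1" using y C by (simp add: m_def le_nat_iff le_floor_iff field_simps)
    have z: "real z \<le> y" "y < real z + 1" using y C by (auto simp: z_def)
    have m': "real m \<le> y / C" "y / C < real m + 1" using y C by (auto simp: m_def)
    have "y / C \<le> y" using y C by (simp add: field_simps)
    then have mz: "m \<le> z" unfolding m_def z_def by (intro nat_mono floor_mono)
    have P: "primes_between m z = {p::nat. prime p \<and> y / C < real p \<and> real p \<le> y}"
      using y C by (auto simp: primes_between_def m_def z_def nat_less_iff le_nat_iff floor_less_iff le_floor_iff)
    have "y / 2 \<le> real z" using y C z by linarith
    then have "ln (y / 2) \<le> ln (real z)" using y C by (subst ln_le_cancel_iff) auto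
    moreover have "ln (real m) \<le> ln (y / C)" using m m' y C by (subst ln_le_cancel_iff) auto
    moreover have "ln (y / 2) - ln (y / C) = 2 * E + 1"
    proof -
      have "y > 0" using y C by linarith
      then show ?thesis by (simp add: ln_div C_def ln_mult)
    qed
    ultimately have "2 * E + 1 \<le> ln (real z) - ln (real m)" by linarith
    then have "1 \<le> (\<Sum>p\<in>primes_between m z. ln (real p) / real p)"
      using prime_ln_sum_between[OF E(2) m mz] by linarith
    also have "\<dots> \<le> (\<Sum>p\<in>primes_between m z. ln y / (y / C))"
    proof (rule sum_mono)
      fix p assume "p \<in> primes_between m z"
      then have p: "prime p" "y / C < real p" "real p \<le> y" unfolding P by auto
      have "real p \<ge> 2" using p(1) prime_ge_2_nat[of p] by linarith
      then show "ln (real p) / real p \<le> ln y / (y / C)"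
        using p y C by (intro frac_le) auto
    qed
    also have "\<dots> = card (primes_between m z) * (C * ln y / y)" by simp
    finally show ?thesis using y C unfolding P by (simp add: field_simps)
  qed
  then show ?thesis using C by (intro exI[of _ C]) auto
qed

text \<open>The weighted sum is about \<open>1 / (2 * ln L) - 1 / (2 * K * ln L)\<close>, and
  \<open>K > 1/\<eta>\<close> makes the second term harmless. \<open>K\<close> is chosen before
  \<open>L\<close>, so it stays fixed as \<open>L\<close> grows.\<close>

lemma prime_sums_range:
  assumes "\<eta> > 0"
  shows "\<exists>K\<ge>1. \<forall>\<^sub>F L :: real in at_top.
    (let P = primes_between (nat \<lfloor>L ^ 2\<rfloor>) (nat \<lfloor>L ^ (2 * K)\<rfloor>) in
      (\<Sum>p\<in>P. 1 / (real p * ln (real p))) \<le> (1 + \<eta>) / (2 * ln L) \<and>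
      (\<Sum>p\<in>P. 1 / (real p * ln (real p))) \<ge> (1 - \<eta>) / (2 * ln L) \<and>
      (\<Sum>p\<in>P. 1 / real p) \<le> real K + 1)"
proof -
  obtain E where E: "E > 0" "\<And>n. n \<ge> 1 \<Longrightarrow> \<bar>mertens_error n\<bar> \<le> E"
    using mertens_error_bounded by blast
  obtain K :: nat where K: "real K > max 2 (1 / \<eta>)" using reals_Archimedean2 by blast
  then have K2: "K > 2" by simp
  have K3: "1 / real K < \<eta>" using K assms by (simp add: field_simps)
  have lim1: "((\<lambda>L. (1 / ln (L^2 - 1) + 2 * E / (2 * ln L)^2) * (2 * ln L)) \<longlongrightarrow> 1) at_top"
    by real_asymp
  have lim2: "((\<lambda>L. (1 / ln (L^2 + 1) - 1 / (2 * real K * ln L) - 2 * E / (2 * ln L)^2) * (2 * ln L)) \<longlongrightarrow> 1 - 1 / real K) at_top"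
    using K2 unfolding inverse_eq_divide [symmetric] by real_asymp
  have ev1: "\<forall>\<^sub>F L in at_top. (1 / ln (L^2 - 1) + 2 * E / (2 * ln L)^2) * (2 * ln L) < 1 + \<eta>"
    using lim1 assms by (intro order_tendstoD) auto
  have ev2: "\<forall>\<^sub>F L in at_top. (1 / ln (L^2 + 1) - 1 / (2 * real K * ln L) - 2 * E / (2 * ln L)^2) * (2 * ln L) > 1 - \<eta>"
    using lim2 K3 by (intro order_tendstoD(1)[OF lim2]) auto
  have ev3: "\<forall>\<^sub>F L :: real in at_top. L > exp (max 2 (2 * E))" by (rule eventually_gt_at_top)
  have "\<forall>\<^sub>F L :: real in at_top.
    (let P = primes_between (nat \<lfloor>L ^ 2\<rfloor>) (nat \<lfloor>L ^ (2 * K)\<rfloor>) in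
      (\<Sum>p\<in>P. 1 / (real p * ln (real p))) \<le> (1 + \<eta>) / (2 * ln L) \<and>
      (\<Sum>p\<in>P. 1 / (real p * ln (real p))) \<ge> (1 - \<eta>) / (2 * ln L) \<and>
      (\<Sum>p\<in>P. 1 / real p) \<le> real K + 1)"
    using ev1 ev2 ev3
  proof eventually_elim
    case (elim L)
    define m z where "m = nat \<lfloor>L ^ 2\<rfloor>" and "z = nat \<lfloor>L ^ (2 * K)\<rfloor>"
    have "ln L > ln (exp (max 2 (2 * E)))"
      using elim(3) by (subst ln_less_cancel_iff) (auto intro: less_trans[OF exp_gt_zero])
    then have lnL: "ln L > 2" "ln L > 2 * E" by auto
    have "exp (max 2 (2 * E)) \<ge> 1 + max 2 (2 * E)" by (rule exp_ge_add_one_self)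
    then have L: "L > 3" using elim(3) by linarith
    have "L ^ 2 > 3 * 3" unfolding power2_eq_square using L by (intro mult_strict_mono) auto
    then have L2: "L ^ 2 > 9" by simp
    have m: "real m \<le> L ^ 2" "L ^ 2 < real m + 1" using L by (auto simp: m_def)
    have z: "real z \<le> L ^ (2 * K)" "L ^ (2 * K) < real z + 1" using L by (auto simp: z_def)
    have "L ^ 2 * L ^ 2 \<le> L ^ (2 * K)"
      unfolding power_add[symmetric] using L K2 by (intro power_increasing) auto
    moreover have "9 * L ^ 2 \<le> L ^ 2 * L ^ 2" using L2 by (intro mult_right_mono) auto
    ultimately have "real m < real z" using m z L2 by linarith
    then have mz: "m < z" by simp
    have m2: "m \<ge> 2" using m L2 by linarith
    have lm: "2 * ln L \<le> ln (real m + 1)"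
    proof -
      have "ln (L ^ 2) \<le> ln (real m + 1)" using L m by (subst ln_le_cancel_iff) auto
      then show ?thesis using L by (simp add: ln_realpow)
    qed
    have lm': "ln (L ^ 2 - 1) \<le> ln (real m)" using L2 m m2 by (subst ln_le_cancel_iff) auto
    have lm'': "ln (real m + 1) \<le> ln (L ^ 2 + 1)" using L2 m m2 by (subst ln_le_cancel_iff) auto
    have lz: "2 * real K * ln L \<le> ln (real z + 1)"
    proof -
      have "ln (L ^ (2 * K)) \<le> ln (real z + 1)" using L z by (subst ln_le_cancel_iff) auto
      then show ?thesis using L by (simp add: ln_realpow)
    qed
    have lz': "ln (real z) \<le> 2 * real K * ln L"
    proof -
      have "ln (real z) \<le> ln (L ^ (2 * K))" using L z mz by (subst ln_le_cancel_iff) auto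
      then show ?thesis using L by (simp add: ln_realpow)
    qed
    have pos: "0 < ln (L ^ 2 - 1)" using L2 by simp
    have err: "2 * E / (ln (real m + 1))\<^sup>2 \<le> 2 * E / (2 * ln L)^2"
      using lm lnL E(1) by (intro divide_left_mono power_mono mult_pos_pos zero_less_power) linarith+
    let ?P = "primes_between m z"
    have "(\<Sum>p\<in>?P. 1 / (real p * ln (real p))) \<le> 1 / ln (real m) + 2 * E / (ln (real m + 1))\<^sup>2"
      by (rule prime_weighted_sum_upper[OF E(2) m2 mz])
    also have "\<dots> \<le> 1 / ln (L^2 - 1) + 2 * E / (2 * ln L)^2"
      using pos lm' by (intro add_mono err divide_left_mono) auto
    also have "\<dots> \<le> (1 + \<eta>) / (2 * ln L)"
      using elim(1) lnL by (subst pos_le_divide_eq) auto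
    finally have 1: "(\<Sum>p\<in>?P. 1 / (real p * ln (real p))) \<le> (1 + \<eta>) / (2 * ln L)" .
    have a: "1 / ln (L^2 + 1) \<le> 1 / ln (real m + 1)"
      using lm lm'' lnL by (intro divide_left_mono mult_pos_pos) linarith+
    have "0 < 2 * real K * ln L" using lnL K2 by simp
    then have b: "1 / ln (real z + 1) \<le> 1 / (2 * real K * ln L)"
      using lz by (intro frac_le) auto
    have "(1 - \<eta>) / (2 * ln L) \<le> 1 / ln (L^2 + 1) - 1 / (2 * real K * ln L) - 2 * E / (2 * ln L)^2"
      using elim(2) lnL by (subst pos_divide_le_eq) auto
    also have "\<dots> \<le> 1 / ln (real m + 1) - 1 / ln (real z + 1) - 2 * E / (ln (real m + 1))\<^sup>2"
      using a b err by linarith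
    also have "\<dots> \<le> (\<Sum>p\<in>?P. 1 / (real p * ln (real p)))"
      by (rule prime_weighted_sum_lower[OF E(2) m2 mz])
    finally have 2: "(1 - \<eta>) / (2 * ln L) \<le> (\<Sum>p\<in>?P. 1 / (real p * ln (real p)))" .
    \<comment> \<open>All primes here have \<open>ln p \<ge> 2 * ln L\<close>, so Mertens' first
      theorem already yields a bound linear in \<open>K\<close>; the threshold on \<open>L\<close>
      makes \<open>E / ln L\<close> less than 1.\<close>
    have "(\<Sum>p\<in>?P. 1 / real p) \<le> (\<Sum>p\<in>?P. ln (real p) / real p / (2 * ln L))"
    proof (rule sum_mono)
      fix p assume "p \<in> ?P"
      then have "real m + 1 \<le> real p" by (auto simp: primes_between_def)
      then have "ln (real m + 1) \<le> ln (real p)" by (subst ln_le_cancel_iff) auto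
      then have "2 * ln L \<le> ln (real p)" using lm by linarith
      then have "1 \<le> ln (real p) / (2 * ln L)" using lnL by (subst pos_le_divide_eq) auto
      then have "1 / real p \<le> (ln (real p) / (2 * ln L)) / real p" by (rule divide_right_mono) simp
      then show "1 / real p \<le> ln (real p) / real p / (2 * ln L)" by (simp add: mult.commute)
    qed
    also have "\<dots> = (\<Sum>p\<in>?P. ln (real p) / real p) / (2 * ln L)" by (simp add: sum_divide_distrib)
    also have "\<dots> \<le> (2 * real K * ln L + 2 * E) / (2 * ln L)"
    proof (rule divide_right_mono)
      have "ln (real m) \<ge> 0" using m2 by simp
      then show "(\<Sum>p\<in>?P. ln (real p) / real p) \<le> 2 * real K * ln L + 2 * E"
        using prime_ln_sum_between[OF E(2), of m z] m2 mz lz' by linarith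
    qed (use lnL in auto)
    also have "\<dots> \<le> real K + 1" using lnL by (simp add: field_simps)
    finally show ?case using 1 2 by (simp add: m_def z_def Let_def)
  qed
  then show ?thesis using K2 by (intro exI[of _ K]) auto
qed

section \<open>The Kronecker symbol\<close>

lemma kronecker_prime_range: "kronecker_prime d p \<in> {-1, 0, 1}"
  by (auto simp: kronecker_prime_def Legendre_def)

lemma kronecker_eq_prod:
  assumes "n > 0" "finite S" "prime_factors n \<subseteq> S" "\<And>p. p \<in> S \<Longrightarrow> prime p"
  shows "kronecker d n = (\<Prod>p\<in>S. kronecker_prime d p ^ multiplicity p n)"
proof -
  have "(\<Prod>p\<in>prime_factors n. kronecker_prime d p ^ multiplicity p n) =
        (\<Prod>p\<in>S. kronecker_prime d p ^ multiplicity p n)"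
    using assms by (intro prod.mono_neutral_left) (auto simp: prime_factors_multiplicity)
  then show ?thesis using assms(1) by (simp add: kronecker_def)
qed

lemma kronecker_mult:
  assumes "m > 0" "n > 0"
  shows "kronecker d (m * n) = kronecker d m * kronecker d n"
proof -
  define S where "S = prime_factors m \<union> prime_factors n"
  have S: "finite S" "\<And>p. p \<in> S \<Longrightarrow> prime p" by (auto simp: S_def in_prime_factors_iff)
  have "kronecker d (m * n) = (\<Prod>p\<in>S. kronecker_prime d p ^ multiplicity p (m * n))"
    using assms S by (intro kronecker_eq_prod) (auto simp: S_def prime_factors_product)
  also have "\<dots> = (\<Prod>p\<in>S. kronecker_prime d p ^ multiplicity p m * kronecker_prime d p ^ multiplicity p n)"
    using assms S(2)
    by (intro prod.cong) (simp_all add: prime_elem_multiplicity_mult_distrib power_add)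
  also have "\<dots> = kronecker d m * kronecker d n"
  proof -
    have "kronecker d m = (\<Prod>p\<in>S. kronecker_prime d p ^ multiplicity p m)"
      "kronecker d n = (\<Prod>p\<in>S. kronecker_prime d p ^ multiplicity p n)"
      using assms S by (intro kronecker_eq_prod; simp add: S_def)+
    then show ?thesis by (simp add: prod.distrib)
  qed
  finally show ?thesis .
qed

lemma abs_kronecker_le: "\<bar>kronecker d n\<bar> \<le> 1"
proof (cases "n = 0")
  case False
  have "\<bar>\<Prod>p\<in>prime_factors n. kronecker_prime d p ^ multiplicity p n\<bar> =
      (\<Prod>p\<in>prime_factors n. \<bar>kronecker_prime d p\<bar> ^ multiplicity p n)"
    by (simp add: abs_prod power_abs)
  also have "\<dots> \<le> (\<Prod>p\<in>prime_factors n. 1)"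
    by (intro prod_mono conjI power_le_one) (auto simp: kronecker_prime_def Legendre_def)
  finally show ?thesis using False by (simp add: kronecker_def)
qed (simp add: kronecker_def)

lemma kronecker_prime_zero_iff:
  assumes "prime p"
  shows "kronecker_prime d p = 0 \<longleftrightarrow> int p dvd d"
  by (auto simp: kronecker_prime_def Legendre_def cong_0_iff)

lemma kronecker_square:
  assumes "n > 0" "coprime d (int n)"
  shows "kronecker d (n * n) = 1"
proof -
  have "kronecker_prime d p ^ multiplicity p n * kronecker_prime d p ^ multiplicity p n = 1"
    if "p \<in> prime_factors n" for p
  proof -
    have p: "prime p" "p dvd n" using that by auto
    have "\<not> int p dvd d"
    proof
      assume "int p dvd d"
      moreover have "int p dvd int n" using p by simp
      ultimately have "int p dvd 1" using assms(2) coprime_common_divisor by blast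
      then show False using p(1) by auto
    qed
    then have "kronecker_prime d p \<noteq> 0" using kronecker_prime_zero_iff[OF p(1)] by simp
    then have "kronecker_prime d p * kronecker_prime d p = 1"
      using kronecker_prime_range[of d p] by auto
    then show ?thesis by (simp add: power_mult_distrib [symmetric])
  qed
  then have "kronecker d n * kronecker d n = 1"
    using assms(1) by (simp add: kronecker_def prod.distrib [symmetric])
  then show ?thesis using assms(1) by (simp add: kronecker_mult)
qed

section \<open>Periodicity of the symbol in its upper argument, and cancellation over a
  period\<close>

lemma Legendre_cong:
  assumes "[a = b] (mod p)"
  shows "Legendre a p = Legendre b p"
proof -
  have "[a = 0] (mod p) \<longleftrightarrow> [b = 0] (mod p)"
    using assms cong_trans cong_sym by blast
  moreover have "QuadRes p a \<longleftrightarrow> QuadRes p b"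
    unfolding QuadRes_def using assms cong_trans cong_sym by blast
  ultimately show ?thesis by (simp add: Legendre_def)
qed

text \<open>The modulus contains 8 because the symbol at 2 is read off from the residue mod 8; the
  Legendre symbol at an odd \<open>p\<close> has period \<open>p\<close>, which divides
  \<open>n\<close>.\<close>

lemma kronecker_cong:
  assumes "n > 0" "[a = b] (mod 8 * int n)"
  shows "kronecker a n = kronecker b n"
proof -
  have 8: "a mod 8 = b mod 8"
    using assms(2) by (metis cong_def cong_modulus_mult)
  have "even a \<longleftrightarrow> even b" using 8 by presburger
  have "kronecker_prime a p = kronecker_prime b p" if "p \<in> prime_factors n" for p
  proof -
    have "int p dvd 8 * int n" using that by auto
    then have "[a = b] (mod int p)" using assms(2) cong_dvd_modulus by blast
    then show ?thesis
      using 8 \<open>even a \<longleftrightarrow> even b\<close> Legendre_cong by (simp add: kronecker_prime_def)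
  qed
  then show ?thesis by (simp add: kronecker_def)
qed

text \<open>Euler's criterion gives the identity mod \<open>p\<close>; the two sides differ by at
  most 2, which is less than \<open>p\<close>, so they are equal.\<close>

lemma Legendre_mult:
  assumes "prime p" "2 < p"
  shows "Legendre (a * b) (int p) = Legendre a (int p) * Legendre b (int p)"
proof -
  have "[Legendre (a * b) (int p) = (a * b) ^ ((p - 1) div 2)] (mod int p)"
    by (rule euler_criterion[OF assms])
  moreover have "[Legendre a (int p) * Legendre b (int p) = a ^ ((p - 1) div 2) * b ^ ((p - 1) div 2)] (mod int p)"
    by (intro cong_mult euler_criterion assms)
  ultimately have "[Legendre (a * b) (int p) = Legendre a (int p) * Legendre b (int p)] (mod int p)"
    by (metis cong_sym cong_trans power_mult_distrib)
  then have dvd: "int p dvd Legendre (a * b) (int p) - Legendre a (int p) * Legendre b (int p)"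
    by (simp add: cong_iff_dvd_diff)
  have "\<bar>Legendre (a * b) (int p) - Legendre a (int p) * Legendre b (int p)\<bar> \<le> 2"
    by (auto simp: Legendre_def)
  then show ?thesis
    using dvd dvd_imp_le_int[OF _ dvd] assms(2) by (cases "Legendre (a * b) (int p) - Legendre a (int p) * Legendre b (int p) = 0") auto
qed

text \<open>Squaring on the residues mod \<open>p\<close> identifies 1 and \<open>p - 1\<close>, so
  it is not injective, hence not surjective on a finite set.\<close>

lemma exists_nonresidue:
  assumes "prime p" "2 < p"
  shows "\<exists>a. Legendre a (int p) = -1"
proof -
  define f where "f = (\<lambda>x. x\<^sup>2 mod int p)"
  let ?A = "{0..<int p}"
  have "f ` ?A \<subseteq> ?A" using assms by (auto simp: f_def)
  have "f 1 = f (int p - 1)"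
  proof -
    have "(int p - 1)\<^sup>2 = 1 + int p * (int p - 2)" by (simp add: power2_eq_square algebra_simps)
    then have "f (int p - 1) = (1 + int p * (int p - 2)) mod int p" by (simp add: f_def)
    then show ?thesis by (simp add: f_def)
  qed
  then have "\<not> inj_on f ?A"
    using assms unfolding inj_on_def by (intro notI) (drule bspec[of _ _ 1], simp, drule bspec[of _ _ "int p - 1"], auto)
  then have "f ` ?A \<noteq> ?A"
    using finite_surj_inj[of ?A f] by auto
  then obtain a where a: "a \<in> ?A" "a \<notin> f ` ?A" using \<open>f ` ?A \<subseteq> ?A\<close> by blast
  have "\<not> QuadRes (int p) a"
  proof
    assume "QuadRes (int p) a"
    then obtain y where "[y\<^sup>2 = a] (mod int p)" by (auto simp: QuadRes_def)
    then have "f (y mod int p) = a" using a(1) by (simp add: f_def cong_def power_mod)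
    moreover have "y mod int p \<in> ?A" using assms by simp
    ultimately show False using a(2) by blast
  qed
  moreover have "\<not> [a = 0] (mod int p)"
  proof
    assume "[a = 0] (mod int p)"
    then have "[0\<^sup>2 = a] (mod int p)" by (simp add: cong_sym)
    then show False using \<open>\<not> QuadRes (int p) a\<close> unfolding QuadRes_def by blast
  qed
  ultimately show ?thesis by (auto simp: Legendre_def)
qed

text \<open>Extended by zero outside the residue class 1 mod 8, the character becomes a function on all
  integers of period dividing \<open>8k\<close>, which spares a separate treatment of the residue class.\<close>
definition kronecker8 :: "nat \<Rightarrow> int \<Rightarrow> int" where
  "kronecker8 k e = (if e mod 8 = 1 then kronecker e k else 0)"

lemma abs_kronecker8_le: "\<bar>kronecker8 k e\<bar> \<le> 1"
  by (simp add: kronecker8_def abs_kronecker_le)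

lemma kronecker8_cong:
  assumes "k > 0" "[a = b] (mod 8 * int k)"
  shows "kronecker8 k a = kronecker8 k b"
proof -
  have "a mod 8 = b mod 8" using assms(2) by (metis cong_def cong_modulus_mult)
  then show ?thesis using kronecker_cong[OF assms] by (simp add: kronecker8_def)
qed

text \<open>Only the prime 2 may occur to an odd power, and its symbol is 1 in the class 1 mod 8.
  Sums over \<open>d\<close> of such terms can therefore be discarded in a lower bound.\<close>

lemma kronecker8_nonneg:
  assumes "\<And>p. prime p \<Longrightarrow> p \<noteq> 2 \<Longrightarrow> even (multiplicity p k)"
  shows "kronecker8 k e \<ge> 0"
proof (cases "e mod 8 = 1 \<and> k > 0")
  case True
  have "odd e" using True by presburger
  have "kronecker_prime e p ^ multiplicity p k \<ge> 0" if "p \<in> prime_factors k" for p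
  proof (cases "p = 2")
    case True
    then show ?thesis using \<open>e mod 8 = 1 \<and> k > 0\<close> \<open>odd e\<close> by (simp add: kronecker_prime_def)
  next
    case False
    then show ?thesis using assms[of p] that by (intro zero_le_even_power) auto
  qed
  then show ?thesis using True by (simp add: kronecker8_def kronecker_def prod_nonneg)
qed (auto simp: kronecker8_def kronecker_def)

text \<open>The Chinese remainder theorem supplies \<open>e0\<close>, a nonresidue mod
  \<open>p\<close> and 1 mod \<open>8 * r\<close>, where \<open>r\<close> is the part of
  \<open>k\<close> prime to \<open>p\<close>. The odd power of the symbol at \<open>p\<close>
  changes sign and every other factor stays: the character is nonprincipal in its upper
  argument.\<close>

lemma kronecker8_twist:
  assumes k: "k > 0" and p: "prime p" "p \<noteq> 2" "odd (multiplicity p k)"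
  shows "\<exists>e0. coprime e0 (8 * int k) \<and> (\<forall>e. kronecker8 k (e * e0) = - kronecker8 k e)"
proof -
  have p3: "p > 2" using p prime_ge_2_nat[of p] by linarith
  define r where "r = k div p ^ multiplicity p k"
  have kr: "k = p ^ multiplicity p k * r" by (simp add: r_def multiplicity_dvd)
  have r: "r > 0" using k kr by (cases "r = 0") auto
  have "\<not> p dvd r"
    unfolding r_def using k p by (intro multiplicity_decompose) (auto dest: prime_gt_1_nat)
  have "coprime p 8"
  proof -
    have "coprime p 2" using p by (metis primes_coprime two_is_prime_nat)
    then have "coprime p (2 ^ 3)" by (rule coprime_power_right_iff[THEN iffD2, OF disjI1])
    then show ?thesis by simp
  qed
  then have "coprime p (8 * r)" using p \<open>\<not> p dvd r\<close> by (simp add: prime_imp_coprime)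
  then have cop: "coprime (int p) (int (8 * r))" by (simp only: coprime_int_iff)
  obtain a where a: "Legendre a (int p) = -1" using exists_nonresidue[OF p(1) p3] by blast
  obtain e0 where e0: "[e0 = a] (mod int p)" "[e0 = 1] (mod int (8 * r))"
    using binary_chinese_remainder_int[OF cop] by blast
  have Lp: "Legendre e0 (int p) = -1" using a e0(1) Legendre_cong by simp
  have e08: "[e0 = 1] (mod 8)" using e0(2) by (metis cong_modulus_mult of_nat_mult of_nat_numeral)
  have e0r: "[e0 = 1] (mod int r)"
    using e0(2) by (metis cong_modulus_mult of_nat_mult mult.commute)
  have "\<not> int p dvd e0" using Lp by (auto simp: Legendre_def cong_0_iff split: if_splits)
  then have "coprime e0 (int p)" using p(1) prime_imp_coprime[of "int p" e0] by (simp add: coprime_commute)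
  moreover have "coprime e0 8" "coprime e0 (int r)"
    using e08 e0r cong_imp_coprime[OF cong_sym[OF e08]] cong_imp_coprime[OF cong_sym[OF e0r]] by auto
  ultimately have c: "coprime e0 (8 * int k)"
    by (subst kr) simp
  have tw: "kronecker8 k (e * e0) = - kronecker8 k e" for e
  proof (cases "e mod 8 = 1")
    case False
    have "(e * e0) mod 8 = (e * 1) mod 8" using e08 unfolding cong_def by (metis mod_mult_right_eq)
    then show ?thesis using False by (simp add: kronecker8_def)
  next
    case True
    have m8: "(e * e0) mod 8 = 1" using e08 True unfolding cong_def by (metis mod_mult_right_eq mult.right_neutral)
    have "odd e" using True by presburger
    moreover have "odd (e * e0)"
    proof -
      define t where "t = e * e0"
      have "t mod 8 = 1" using m8 by (simp add: t_def)
      then have "odd t" by presburger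
      then show ?thesis unfolding t_def .
    qed
    ultimately have "odd e" "odd (e * e0)" .
    define g where "g = (\<lambda>d q. kronecker_prime d q ^ multiplicity q k)"
    have pk: "p \<in> prime_factors k"
      using p k by (auto simp: prime_factors_multiplicity intro: Nat.gr0I)
    have gp: "g (e * e0) p = - g e p"
      using p by (simp add: g_def kronecker_prime_def Legendre_mult[OF p(1) p3] Lp)
    have gq: "g (e * e0) q = g e q" if q: "q \<in> prime_factors k - {p}" for q
    proof (cases "q = 2")
      case True
      then show ?thesis using m8 \<open>e mod 8 = 1\<close> \<open>odd e\<close> \<open>odd (e * e0)\<close>
        by (simp add: g_def kronecker_prime_def)
    next
      case False
      have "prime q" "q dvd k" "q \<noteq> p" using q by auto
      then have "q dvd r"
        using kr p(1) by (metis prime_dvd_mult_iff prime_dvd_power primes_dvd_imp_eq)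
      then have "[e0 = 1] (mod int q)" using e0r cong_dvd_modulus int_dvd_int_iff by blast
      then have "[e * e0 = e * 1] (mod int q)" by (rule cong_scalar_left)
      then show ?thesis using False Legendre_cong by (simp add: g_def kronecker_prime_def)
    qed
    have "kronecker (e * e0) k = g (e * e0) p * (\<Prod>q\<in>prime_factors k - {p}. g (e * e0) q)"
      using k pk by (simp add: kronecker_def g_def prod.remove[OF _ pk])
    also have "\<dots> = - (g e p * (\<Prod>q\<in>prime_factors k - {p}. g e q))"
      using gp gq by simp
    also have "g e p * (\<Prod>q\<in>prime_factors k - {p}. g e q) = kronecker e k"
      using k pk by (simp add: kronecker_def g_def prod.remove[OF _ pk])
    finally show ?thesis using True m8 by (simp add: kronecker8_def)
  qed
  show ?thesis using c tw by blast
qed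

text \<open>Multiplication by the unit \<open>e0\<close> permutes the residues mod \<open>m\<close>
  and reverses the sign of \<open>h\<close>, so complete sums vanish. Full periods are stripped off,
  and the rest has at most \<open>m\<close> terms.\<close>

lemma twisted_periodic_sum_bound:
  fixes h :: "int \<Rightarrow> int" and m e0 u v :: int
  assumes m: "m > 0" and per: "\<And>a b. [a = b] (mod m) \<Longrightarrow> h a = h b"
    and tw: "\<And>a. h (a * e0) = - h a" and cop: "coprime e0 m" and bd: "\<And>a. \<bar>h a\<bar> \<le> 1"
  shows "\<bar>\<Sum>j\<in>{u<..v}. h j\<bar> \<le> m"
proof -
  have full: "(\<Sum>j\<in>{0..<m}. h j) = 0"
  proof -
    have inj: "inj_on (\<lambda>j. (j * e0) mod m) {0..<m}"
    proof (rule inj_onI)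
      fix x y assume xy: "x \<in> {0..<m}" "y \<in> {0..<m}" "(x * e0) mod m = (y * e0) mod m"
      then have "[x * e0 = y * e0] (mod m)" by (simp add: cong_def)
      then have "[x = y] (mod m)" using cop cong_mult_rcancel by blast
      then show "x = y" using xy by (simp add: cong_def)
    qed
    have "(\<lambda>j. (j * e0) mod m) ` {0..<m} = {0..<m}"
      using m by (intro endo_inj_surj inj) auto
    then have "(\<Sum>j\<in>{0..<m}. h j) = (\<Sum>j\<in>{0..<m}. h ((j * e0) mod m))"
      using sum.reindex[OF inj, of h] by simp
    also have "\<dots> = (\<Sum>j\<in>{0..<m}. - h j)"
      by (intro sum.cong refl) (metis cong_mod_left cong_refl per tw)
    also have "\<dots> = - (\<Sum>j\<in>{0..<m}. h j)" by (simp add: sum_negf)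
    finally show ?thesis by simp
  qed
  have blk: "(\<Sum>j\<in>{u<..u + m}. h j) = 0" for u
  proof -
    have inj: "inj_on (\<lambda>j. j mod m) {u<..u + m}"
    proof (rule inj_onI)
      fix x y assume xy: "x \<in> {u<..u + m}" "y \<in> {u<..u + m}" "x mod m = y mod m"
      then have "m dvd x - y" by (simp add: mod_eq_dvd_iff)
      moreover have "\<bar>x - y\<bar> < m" using xy by auto
      ultimately show "x = y" using dvd_imp_le_int[of "x - y" m] m by fastforce
    qed
    have "(\<lambda>j. j mod m) ` {u<..u + m} = {0..<m}"
    proof (rule card_subset_eq)
      show "(\<lambda>j. j mod m) ` {u<..u + m} \<subseteq> {0..<m}" using m by auto
      show "card ((\<lambda>j. j mod m) ` {u<..u + m}) = card {0..<m}"
        using m by (simp add: card_image[OF inj])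
    qed simp
    then have "(\<Sum>j\<in>{0..<m}. h j) = (\<Sum>j\<in>{u<..u + m}. h (j mod m))"
      using sum.reindex[OF inj, of h] by simp
    also have "\<dots> = (\<Sum>j\<in>{u<..u + m}. h j)"
      by (intro sum.cong refl per) (simp add: cong_def)
    finally show ?thesis using full by simp
  qed
  have "\<bar>\<Sum>j\<in>{u<..v}. h j\<bar> \<le> m" for u
  proof (induction "nat (v - u)" arbitrary: u rule: less_induct)
    case less
    show ?case
    proof (cases "v \<le> u + m")
      case True
      have "\<bar>\<Sum>j\<in>{u<..v}. h j\<bar> \<le> (\<Sum>j\<in>{u<..v}. 1)"
        by (rule order_trans[OF sum_abs sum_mono]) (rule bd)
      also have "\<dots> \<le> m" using True m by simp
      finally show ?thesis .
    next
      case False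
      have "{u<..v} = {u<..u + m} \<union> {u + m<..v}" using False m by auto
      then have "(\<Sum>j\<in>{u<..v}. h j) = (\<Sum>j\<in>{u<..u + m}. h j) + (\<Sum>j\<in>{u + m<..v}. h j)"
        by (simp add: sum.union_disjoint)
      then have "(\<Sum>j\<in>{u<..v}. h j) = (\<Sum>j\<in>{u + m<..v}. h j)" using blk by simp
      moreover have "nat (v - (u + m)) < nat (v - u)" using False m by simp
      ultimately show ?thesis using less.hyps[of "u + m"] by simp
    qed
  qed
  then show ?thesis .
qed

section \<open>Sums over discriminants\<close>

lemma int_div_less_iff:
  fixes c j u :: int
  assumes "c > 0"
  shows "u div c < j \<longleftrightarrow> u < c * j"
proof
  assume "u div c < j"
  then have "c * (u div c + 1) \<le> c * j" using assms by (intro mult_left_mono) auto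
  moreover have "u < c * (u div c) + c"
    using mult_div_mod_eq[of c u] pos_mod_bound[OF assms, of u] by linarith
  ultimately show "u < c * j" by (simp add: algebra_simps)
next
  assume "u < c * j"
  moreover have "c * (u div c) \<le> u"
    using mult_div_mod_eq[of c u] pos_mod_sign[OF assms, of u] by linarith
  ultimately have "c * (u div c) < c * j" by linarith
  then show "u div c < j" using assms by simp
qed

lemma multiples_in_interval:
  fixes c u v :: int
  assumes "c > 0"
  shows "{d \<in> {u<..v}. c dvd d} = (\<lambda>j. c * j) ` {u div c<..v div c}"
proof -
  have "u < c * j \<and> c * j \<le> v \<longleftrightarrow> u div c < j \<and> j \<le> v div c" for j
    using int_div_less_iff[OF assms] by (metis not_le)
  then show ?thesis unfolding dvd_def by fastforce
qed

lemma coprime_mult_dvd_iff: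
  fixes a b d :: int
  assumes "coprime a b"
  shows "a * b dvd d \<longleftrightarrow> a dvd d \<and> b dvd d"
  using assms dvd_mult_left[of a b d] dvd_mult_right[of a b d] divides_mult[of a d b] by blast

lemma card_multiples_le:
  fixes c v :: int
  assumes "c > 0" "v \<ge> 0" "u \<ge> 0"
  shows "real (card {d \<in> {u<..v}. c dvd d}) \<le> real_of_int v / real_of_int c"
proof -
  have "card {d \<in> {u<..v}. c dvd d} = card {u div c<..v div c}"
    unfolding multiples_in_interval[OF assms(1)] using assms(1)
    by (intro card_image) (simp add: inj_on_def)
  also have "\<dots> \<le> card {0<..v div c}"
    using assms(1,3) pos_imp_zdiv_nonneg_iff[of c u] by (intro card_mono) auto
  also have "\<dots> = nat (v div c)" by simp
  finally have "real (card {d \<in> {u<..v}. c dvd d}) \<le> real (nat (v div c))" by (rule of_nat_mono)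
  also have "\<dots> = real_of_int (v div c)"
    using assms by (simp add: pos_imp_zdiv_nonneg_iff)
  also have "\<dots> \<le> real_of_int v / real_of_int c" by (rule real_of_int_div4)
  finally show ?thesis .
qed

lemma int_prod_primes_square_dvd:
  assumes "finite B" "\<And>p. p \<in> B \<Longrightarrow> prime p"
  shows "(int (\<Prod>B))\<^sup>2 dvd d \<longleftrightarrow> (\<forall>p\<in>B. (int p)\<^sup>2 dvd d)"
  using assms
proof (induction B rule: finite_induct)
  case (insert p B)
  have "coprime p (\<Prod>B)"
    using insert by (intro prod_coprime_right) (metis insertCI primes_coprime)
  then have "coprime (int p) (int (\<Prod>B))" by (simp only: coprime_int_iff)
  then have cop: "coprime ((int p)\<^sup>2) ((int (\<Prod>B))\<^sup>2)" by simp
  have "(int (\<Prod>(insert p B)))\<^sup>2 = (int p)\<^sup>2 * (int (\<Prod>B))\<^sup>2"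
    using insert.hyps by (simp add: power_mult_distrib)
  then have "(int (\<Prod>(insert p B)))\<^sup>2 dvd d \<longleftrightarrow> (int p)\<^sup>2 dvd d \<and> (int (\<Prod>B))\<^sup>2 dvd d"
    using coprime_mult_dvd_iff[OF cop] by (simp only:)
  moreover have "(int (\<Prod>B))\<^sup>2 dvd d \<longleftrightarrow> (\<forall>p\<in>B. (int p)\<^sup>2 dvd d)"
    using insert.IH insert.prems by blast
  ultimately show ?case by blast
qed simp

text \<open>Unique factorisation, with \<open>prime_factors\<close> as left inverse. Squarefree
  numbers are encoded throughout as finite sets of primes, both in the Moebius inversion and in the
  resonator; this lemma passes between the two views.\<close>

lemma inj_on_prod_primes:
  assumes "\<And>B p. B \<in> \<B> \<Longrightarrow> p \<in> B \<Longrightarrow> prime (p::nat)" "\<And>B. B \<in> \<B> \<Longrightarrow> finite B"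
  shows "inj_on (\<lambda>B. \<Prod>B) \<B>"
proof (rule inj_on_inverseI[where g = prime_factors])
  fix B assume B: "B \<in> \<B>"
  have "0 \<notin> (\<lambda>p. p) ` B" using assms(1)[OF B, of 0] by auto
  then have "prime_factors (\<Prod>B) = \<Union>((prime_factors \<circ> (\<lambda>p. p)) ` B)"
    by (rule prime_factors_prod[OF assms(2)[OF B]])
  also have "\<dots> = (\<Union>p\<in>B. {p})"
    unfolding comp_def using assms(1)[OF B] by (intro SUP_cong refl) (rule prime_prime_factors)
  also have "\<dots> = B" by simp
  finally show "prime_factors (\<Prod>B) = B" .
qed

text \<open>Moebius inversion: \<open>B\<close> stands for the squarefree number
  \<open>a = \<Prod>B\<close>, and \<open>(-1) ^ card B\<close> is \<mu>(a). The sum factors into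
  the product over primes of 1 minus the indicator of \<open>p^2 dvd d\<close>; primes up to
  \<open>R\<close> suffice, since \<open>p^2 dvd d\<close> forces \<open>p \<le> d\<close>.\<close>

lemma squarefree_indicator:
  fixes d :: int
  assumes "0 < d" "d \<le> int R"
  shows "(\<Sum>B\<in>Pow {p\<in>{1..R}. prime p}. (-1) ^ card B * (if (int (\<Prod>B))\<^sup>2 dvd d then 1 else 0)) =
           (if squarefree d then 1 else 0 :: int)"
proof -
  define Q where "Q = {p\<in>{1..R}. prime p}"
  have Q: "finite Q" "\<And>p. p \<in> Q \<Longrightarrow> prime p" by (auto simp: Q_def)
  have "(\<Sum>B\<in>Pow Q. (-1) ^ card B * (if (int (\<Prod>B))\<^sup>2 dvd d then 1 else 0)) =
     (\<Sum>B\<in>Pow Q. (\<Prod>p\<in>B. - (if (int p)\<^sup>2 dvd d then 1 else 0)) * (\<Prod>p\<in>Q-B. 1) :: int)"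
  proof (rule sum.cong)
    fix B assume "B \<in> Pow Q"
    then have B: "finite B" "\<And>p. p \<in> B \<Longrightarrow> prime p" using Q finite_subset by auto
    have "(\<Prod>p\<in>B. if (int p)\<^sup>2 dvd d then 1 else 0) = (if \<forall>p\<in>B. (int p)\<^sup>2 dvd d then 1 else 0 :: int)"
      using B(1) by (induction B rule: finite_induct) auto
    then have "(\<Prod>p\<in>B. - (if (int p)\<^sup>2 dvd d then 1 else 0 :: int)) =
       (-1) ^ card B * (if \<forall>p\<in>B. (int p)\<^sup>2 dvd d then 1 else 0)"
      by (subst prod_uminus) simp
    then show "(-1) ^ card B * (if (int (\<Prod>B))\<^sup>2 dvd d then 1 else 0) =
      (\<Prod>p\<in>B. - (if (int p)\<^sup>2 dvd d then 1 else 0 :: int)) * (\<Prod>p\<in>Q-B. 1)"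
      using int_prod_primes_square_dvd[OF B] by simp
  qed simp
  also have "\<dots> = (\<Prod>p\<in>Q. - (if (int p)\<^sup>2 dvd d then 1 else 0) + 1)"
    by (rule prod_add [OF Q(1), symmetric])
  also have "\<dots> = (if squarefree d then 1 else 0)"
  proof (cases "squarefree d")
    case True
    have "\<not> (int p)\<^sup>2 dvd d" if "p \<in> Q" for p
      using True Q(2)[OF that] squarefreeD[OF True, of "int p"] by auto
    then have "(\<Prod>p\<in>Q. - (if (int p)\<^sup>2 dvd d then 1 else 0) + 1 :: int) = 1"
      by (intro prod.neutral) auto
    then show ?thesis using True by simp
  next
    case False
    then obtain q :: int where q: "prime q" "q\<^sup>2 dvd d"
      using squarefree_factorial_semiring[of d] assms by auto
    define p where "p = nat q"
    have qp: "q = int p" using q(1) prime_gt_0_int[of q] by (simp add: p_def)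
    have "prime p" using q(1) by (simp add: qp)
    have "q * 1 \<le> q * q" using prime_gt_0_int[OF q(1)] by (intro mult_left_mono) auto
    also have "\<dots> \<le> d" using q(2) assms zdvd_imp_le by (auto simp: power2_eq_square)
    finally have "p \<le> R" using assms(2) by (simp add: qp)
    then have "p \<in> Q" using \<open>prime p\<close> prime_ge_1_nat by (auto simp: Q_def)
    then have "(\<Prod>p\<in>Q. - (if (int p)\<^sup>2 dvd d then 1 else 0) + 1 :: int) = 0"
      using Q(1) q(2) qp by (intro prod_zero) auto
    then show ?thesis using False by simp
  qed
  finally show ?thesis unfolding Q_def .
qed

text \<open>In the class 1 mod 8 the symbol at 2 is 1, and squarefree \<open>d \<noteq> 1\<close>
  are fundamental; the lower end of the range excludes 1 as soon as
  \<open>X \<ge> 1\<close>.\<close>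

definition discs :: "real \<Rightarrow> int set" where
  "discs X = {d. X < real_of_int d \<and> real_of_int d \<le> 2 * X \<and> d mod 8 = 1 \<and> squarefree d}"

definition disc_sum :: "real \<Rightarrow> nat \<Rightarrow> int" where
  "disc_sum X k = (\<Sum>d\<in>discs X. kronecker d k)"

lemma discs_eq: "discs X = {d \<in> {\<lfloor>X\<rfloor><..\<lfloor>2 * X\<rfloor>}. d mod 8 = 1 \<and> squarefree d}"
  by (auto simp: discs_def floor_less_iff le_floor_iff)

lemma finite_discs [simp]: "finite (discs X)"
  by (rule finite_subset[of _ "{\<lfloor>X\<rfloor><..\<lfloor>2 * X\<rfloor>}"]) (auto simp: discs_eq)

lemma disc_sum_eq: "disc_sum X k = (\<Sum>d\<in>{\<lfloor>X\<rfloor><..\<lfloor>2 * X\<rfloor>}. if squarefree d then kronecker8 k d else 0)"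
proof -
  have "disc_sum X k = (\<Sum>d\<in>{\<lfloor>X\<rfloor><..\<lfloor>2 * X\<rfloor>}. if d mod 8 = 1 \<and> squarefree d then kronecker d k else 0)"
    unfolding disc_sum_def discs_eq by (rule sum.inter_filter) simp
  also have "\<dots> = (\<Sum>d\<in>{\<lfloor>X\<rfloor><..\<lfloor>2 * X\<rfloor>}. if squarefree d then kronecker8 k d else 0)"
    by (intro sum.cong) (auto simp: kronecker8_def)
  finally show ?thesis .
qed

lemma disc_sum_nonneg:
  assumes "\<And>p. prime p \<Longrightarrow> p \<noteq> 2 \<Longrightarrow> even (multiplicity p k)"
  shows "disc_sum X k \<ge> 0"
  unfolding disc_sum_eq using kronecker8_nonneg[OF assms] by (intro sum_nonneg) simp

lemma sum_inverse_squares_le: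
  assumes "A \<ge> 1" "A \<le> M"
  shows "(\<Sum>a\<in>{A<..M}. 1 / (real a)\<^sup>2) \<le> 1 / real A"
proof -
  have "(\<Sum>a\<in>{A<..M}. 1 / (real a)\<^sup>2) \<le> (\<Sum>a\<in>{A<..M}. 1 / real (a - 1) - 1 / real a)"
  proof (rule sum_mono)
    fix a assume a: "a \<in> {A<..M}"
    then have "1 / real (a - 1) - 1 / real a = 1 / (real (a - 1) * real a)"
      using assms by (simp add: field_simps of_nat_diff)
    moreover have "1 / (real a)\<^sup>2 \<le> 1 / (real (a - 1) * real a)"
      using a assms by (intro divide_left_mono) (auto simp: power2_eq_square intro!: mult_right_mono)
    ultimately show "1 / (real a)\<^sup>2 \<le> 1 / real (a - 1) - 1 / real a" by simp
  qed
  also have "\<dots> = 1 / real A - 1 / real M"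
    by (rule sum_telescope_greaterThanAtMost[OF assms(2), of "\<lambda>n. 1 / real n"])
  finally show ?thesis using assms by (smt (verit) divide_nonneg_nonneg of_nat_0_le_iff)
qed

text \<open>Expanding the condition that \<open>d\<close> is squarefree over square divisors \<open>a\<^sup>2\<close>, the terms with \<open>a \<le> A\<close>
  are bounded by one period of the character and those with \<open>a > A\<close> by the number of multiples of \<open>a\<^sup>2\<close>.\<close>
lemma disc_sum_bound:
  assumes X: "X \<ge> 1" and k: "k > 0" and p: "prime p" "p \<noteq> 2" "odd (multiplicity p k)" and A: "A \<ge> 1"
  shows "\<bar>real_of_int (disc_sum X k)\<bar> \<le> 8 * real k * real A + 2 * X / real A"
proof -
  define u v where "u = \<lfloor>X\<rfloor>" and "v = \<lfloor>2 * X\<rfloor>"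
  have uv: "u \<ge> 0" "v \<ge> 0" "real_of_int v \<le> 2 * X" using X by (auto simp: u_def v_def)
  define R where "R = nat v"
  define Q where "Q = {p\<in>{1..R}. prime p}"
  define W where "W = (\<lambda>a::nat. \<Sum>d\<in>{u<..v}. if (int a)\<^sup>2 dvd d then kronecker8 k d else 0)"
  have Q: "finite Q" "\<And>p. p \<in> Q \<Longrightarrow> prime p" by (auto simp: Q_def)
  have "disc_sum X k = (\<Sum>d\<in>{u<..v}. (if squarefree d then 1 else 0) * kronecker8 k d)"
    unfolding disc_sum_eq u_def v_def by (intro sum.cong) auto
  also have "\<dots> = (\<Sum>d\<in>{u<..v}. (\<Sum>B\<in>Pow Q. (-1) ^ card B * (if (int (\<Prod>B))\<^sup>2 dvd d then 1 else 0)) * kronecker8 k d)"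
  proof (rule sum.cong)
    fix d assume "d \<in> {u<..v}"
    then have "0 < d" "d \<le> int R" using uv by (auto simp: R_def)
    then show "(if squarefree d then 1 else 0) * kronecker8 k d =
      (\<Sum>B\<in>Pow Q. (-1) ^ card B * (if (int (\<Prod>B))\<^sup>2 dvd d then 1 else 0)) * kronecker8 k d"
      unfolding Q_def by (subst squarefree_indicator) simp_all
  qed simp
  also have "\<dots> = (\<Sum>d\<in>{u<..v}. \<Sum>B\<in>Pow Q. (-1) ^ card B * (if (int (\<Prod>B))\<^sup>2 dvd d then kronecker8 k d else 0))"
    unfolding sum_distrib_right by (intro sum.cong) auto
  also have "\<dots> = (\<Sum>B\<in>Pow Q. \<Sum>d\<in>{u<..v}. (-1) ^ card B * (if (int (\<Prod>B))\<^sup>2 dvd d then kronecker8 k d else 0))"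
    by (rule sum.swap)
  also have "\<dots> = (\<Sum>B\<in>Pow Q. (-1) ^ card B * W (\<Prod>B))"
    by (simp add: W_def sum_distrib_left)
  finally have "\<bar>disc_sum X k\<bar> \<le> (\<Sum>B\<in>Pow Q. \<bar>W (\<Prod>B)\<bar>)"
    by (simp add: order_trans[OF sum_abs] abs_mult power_abs)
  also have "(\<Sum>B\<in>Pow Q. \<bar>W (\<Prod>B)\<bar>) = (\<Sum>a\<in>(\<lambda>B. \<Prod>B) ` Pow Q. \<bar>W a\<bar>)"
  proof -
    have "inj_on (\<lambda>B. \<Prod>B) (Pow Q)"
      using Q finite_subset by (intro inj_on_prod_primes) auto
    then show ?thesis by (simp add: sum.reindex)
  qed
  finally have *: "\<bar>disc_sum X k\<bar> \<le> (\<Sum>a\<in>(\<lambda>B. \<Prod>B) ` Pow Q. \<bar>W a\<bar>)" .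
  have pos: "\<Prod>B \<ge> 1" if "B \<in> Pow Q" for B
  proof -
    have "\<Prod>B > 0" using that Q(2) by (intro prod_pos) (meson PowD prime_gt_0_nat subsetD)
    then show ?thesis by simp
  qed
  \<comment> \<open>Any finite bound that is at least \<open>A\<close> and covers all products of
    primes in \<open>Q\<close>. The additional \<open>a\<close> only enlarge the sum, and the tail
    of the inverse squares is bounded uniformly in \<open>M\<close>.\<close>
  define M where "M = max A (Max ((\<lambda>B. \<Prod>B) ` Pow Q))"
  have "(\<lambda>B. \<Prod>B) ` Pow Q \<subseteq> {1..M}"
    using pos Q(1) by (auto simp: M_def intro!: max.coboundedI2 Max_ge)
  with * have "\<bar>disc_sum X k\<bar> \<le> (\<Sum>a\<in>{1..M}. \<bar>W a\<bar>)"
    using sum_mono2[of "{1..M}" "(\<lambda>B. \<Prod>B) ` Pow Q" "\<lambda>a. \<bar>W a\<bar>"] by fastforce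
  also have "{1..M} = {1..A} \<union> {A<..M}" using A by (auto simp: M_def)
  also have "(\<Sum>a\<in>{1..A} \<union> {A<..M}. \<bar>W a\<bar>) = (\<Sum>a\<in>{1..A}. \<bar>W a\<bar>) + (\<Sum>a\<in>{A<..M}. \<bar>W a\<bar>)"
    by (rule sum.union_disjoint) auto
  finally have "real_of_int \<bar>disc_sum X k\<bar> \<le> real_of_int ((\<Sum>a\<in>{1..A}. \<bar>W a\<bar>) + (\<Sum>a\<in>{A<..M}. \<bar>W a\<bar>))"
    by (rule of_int_le_iff[THEN iffD2])
  also have "\<dots> = (\<Sum>a\<in>{1..A}. real_of_int \<bar>W a\<bar>) + (\<Sum>a\<in>{A<..M}. real_of_int \<bar>W a\<bar>)" by simp
  also have "\<dots> \<le> (\<Sum>a\<in>{1..A}. 8 * real k) + (\<Sum>a\<in>{A<..M}. 2 * X * (1 / (real a)\<^sup>2))"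
  proof (intro add_mono sum_mono)
    fix a assume a: "a \<in> {1..A}"
    obtain e0 where e0: "coprime e0 (8 * int k)" "\<And>e. kronecker8 k (e * e0) = - kronecker8 k e"
      using kronecker8_twist[OF k p] by blast
    have c: "(int a)\<^sup>2 > 0" using a by simp
    have "W a = (\<Sum>d\<in>{d \<in> {u<..v}. (int a)\<^sup>2 dvd d}. kronecker8 k d)"
      unfolding W_def by (rule sum.inter_filter [symmetric]) simp
    also have "\<dots> = (\<Sum>j\<in>{u div (int a)\<^sup>2<..v div (int a)\<^sup>2}. kronecker8 k ((int a)\<^sup>2 * j))"
      unfolding multiples_in_interval[OF c] using c
      by (subst sum.reindex) (auto simp: inj_on_def)
    \<comment> \<open>Multiplying the argument by \<open>a^2\<close> preserves both the period
      \<open>8 * k\<close> and the sign change under \<open>e0\<close>, so one twist serves every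
      \<open>a\<close>, including those that share factors with \<open>k\<close>.\<close>
    also have "\<bar>\<dots>\<bar> \<le> 8 * int k"
    proof (rule twisted_periodic_sum_bound)
      show "kronecker8 k ((int a)\<^sup>2 * x) = kronecker8 k ((int a)\<^sup>2 * y)" if "[x = y] (mod 8 * int k)" for x y
        using k that by (intro kronecker8_cong cong_scalar_left)
      show "kronecker8 k ((int a)\<^sup>2 * (x * e0)) = - kronecker8 k ((int a)\<^sup>2 * x)" for x
        using e0(2)[of "(int a)\<^sup>2 * x"] by (simp add: mult.assoc)
    qed (use k e0 abs_kronecker8_le in auto)
    finally have "real_of_int \<bar>W a\<bar> \<le> real_of_int (8 * int k)" by (rule of_int_le_iff[THEN iffD2])
    then show "real_of_int \<bar>W a\<bar> \<le> 8 * real k" by simp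
  next
    fix a assume a: "a \<in> {A<..M}"
    have c: "(int a)\<^sup>2 > 0" using a by simp
    have "\<bar>W a\<bar> \<le> (\<Sum>d\<in>{u<..v}. if (int a)\<^sup>2 dvd d then 1 else 0)"
      unfolding W_def by (rule order_trans[OF sum_abs sum_mono]) (use abs_kronecker8_le in auto)
    also have "\<dots> = int (card {d \<in> {u<..v}. (int a)\<^sup>2 dvd d})"
      by (simp add: sum.inter_filter [symmetric])
    finally have "real_of_int \<bar>W a\<bar> \<le> real_of_int (int (card {d \<in> {u<..v}. (int a)\<^sup>2 dvd d}))"
      by (rule of_int_le_iff[THEN iffD2])
    also have "\<dots> \<le> real_of_int v / real_of_int ((int a)\<^sup>2)"
      using card_multiples_le[OF c uv(2,1)] by simp
    also have "\<dots> \<le> 2 * X / real_of_int ((int a)\<^sup>2)"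
      using uv(3) by (intro divide_right_mono) auto
    finally show "real_of_int \<bar>W a\<bar> \<le> 2 * X * (1 / (real a)\<^sup>2)" by simp
  qed
  also have "\<dots> = 8 * real k * real A + 2 * X * (\<Sum>a\<in>{A<..M}. 1 / (real a)\<^sup>2)"
    by (simp add: sum_distrib_left)
  also have "\<dots> \<le> 8 * real k * real A + 2 * X * (1 / real A)"
    using X A by (intro add_left_mono mult_left_mono sum_inverse_squares_le) (auto simp: M_def)
  finally show ?thesis by simp
qed

text \<open>The symbol at a square is 1 if \<open>d\<close> is coprime to \<open>j\<close> and never
  negative, so only the \<open>d\<close> sharing a prime with \<open>j\<close> are lost. Each prime
  accounts for at most \<open>2*X/y\<close> of them.\<close>

lemma disc_sum_square_ge:
  assumes X: "X \<ge> 1" and j: "j > 0" and y: "y > 0" "\<And>p. p \<in> prime_factors j \<Longrightarrow> real p \<ge> y"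
  shows "real_of_int (disc_sum X (j * j)) \<ge> card (discs X) - card (prime_factors j) * (2 * X / y)"
proof -
  define u v where "u = \<lfloor>X\<rfloor>" and "v = \<lfloor>2 * X\<rfloor>"
  have uv: "u \<ge> 0" "v \<ge> 0" "real_of_int v \<le> 2 * X" using X by (auto simp: u_def v_def)
  define G where "G = {d \<in> discs X. coprime d (int j)}"
  define Bd where "Bd = (\<lambda>p::nat. {d \<in> {u<..v}. int p dvd d})"
  have "discs X - G \<subseteq> (\<Union>p\<in>prime_factors j. Bd p)"
  proof
    fix d assume d: "d \<in> discs X - G"
    then have "\<not> coprime d (int j)" by (simp add: G_def)
    then have "\<not> is_unit (gcd d (int j))" "gcd d (int j) \<noteq> 0"
      using j by (auto simp: coprime_iff_gcd_eq_1)
    then obtain q :: int where "q dvd gcd d (int j)" "prime q"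
      using prime_divisor_exists by blast
    then have q: "prime q" "q dvd d" "q dvd int j" by auto
    define p where "p = nat q"
    have qp: "q = int p" using q(1) prime_gt_0_int[of q] by (simp add: p_def)
    have "p \<in> prime_factors j" using q j by (simp add: qp in_prime_factors_iff)
    moreover have "d \<in> Bd p" using d q by (simp add: Bd_def qp discs_eq u_def v_def)
    ultimately show "d \<in> (\<Union>p\<in>prime_factors j. Bd p)" by blast
  qed
  then have "card (discs X - G) \<le> card (\<Union>p\<in>prime_factors j. Bd p)"
    by (intro card_mono finite_UN_I finite_subset[of "Bd _" "{u<..v}"]) (auto simp: Bd_def)
  also have "\<dots> \<le> (\<Sum>p\<in>prime_factors j. card (Bd p))" by (rule card_UN_le) simp
  finally have "real (card (discs X - G)) \<le> real (\<Sum>p\<in>prime_factors j. card (Bd p))" by (rule of_nat_mono)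
  also have "\<dots> = (\<Sum>p\<in>prime_factors j. real (card (Bd p)))" by simp
  also have "\<dots> \<le> (\<Sum>p\<in>prime_factors j. 2 * X / y)"
  proof (rule sum_mono)
    fix p assume p: "p \<in> prime_factors j"
    then have "int p > 0" by (auto intro: prime_gt_0_nat)
    then have "real (card (Bd p)) \<le> real_of_int v / real_of_int (int p)"
      unfolding Bd_def by (rule card_multiples_le[OF _ uv(2,1)])
    also have "\<dots> \<le> 2 * X / y" using uv y(1) y(2)[OF p] X by (intro frac_le) auto
    finally show "real (card (Bd p)) \<le> 2 * X / y" .
  qed
  finally have 1: "real (card (discs X - G)) \<le> card (prime_factors j) * (2 * X / y)" by simp
  have "real (card (discs X)) = real (card G) + real (card (discs X - G))"
    using card_Diff_subset[of G "discs X"] card_mono[of "discs X" G] by (simp add: G_def of_nat_diff)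
  moreover have "int (card G) \<le> disc_sum X (j * j)"
  proof -
    have "int (card G) = (\<Sum>d\<in>G. kronecker d (j * j))"
      using kronecker_square[OF j] by (simp add: G_def)
    also have "\<dots> \<le> (\<Sum>d\<in>discs X. kronecker d (j * j))"
      using j by (intro sum_mono2) (auto simp: G_def kronecker_mult)
    finally show ?thesis by (simp add: disc_sum_def)
  qed
  ultimately show ?thesis using 1 by linarith
qed

lemma disc_sum_le_card: "disc_sum X k \<le> int (card (discs X))"
proof -
  have "disc_sum X k \<le> (\<Sum>d\<in>discs X. 1)"
    unfolding disc_sum_def using abs_kronecker_le[of _ k] by (intro sum_mono) (auto simp: abs_le_iff)
  then show ?thesis by simp
qed

section \<open>The number of discriminants in the subfamily\<close>

lemma card_mod_8_eq_1:
  fixes u v :: int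
  shows "real_of_int (v - u) / 8 - 1 \<le> card {d \<in> {u<..v}. d mod 8 = 1}"
    and "u \<le> v \<Longrightarrow> card {d \<in> {u<..v}. d mod 8 = 1} \<le> real_of_int (v - u) / 8 + 1"
proof -
  have "{d \<in> {u<..v}. d mod 8 = 1} = (\<lambda>i. 8 * i + 1) ` {(u - 1) div 8<..(v - 1) div 8}"
  proof (intro equalityI subsetI)
    fix d assume "d \<in> {d \<in> {u<..v}. d mod 8 = 1}"
    then have "d = 8 * (d div 8) + 1" "(u - 1) div 8 < d div 8" "d div 8 \<le> (v - 1) div 8"
      by auto presburger+
    then show "d \<in> (\<lambda>i. 8 * i + 1) ` {(u - 1) div 8<..(v - 1) div 8}" by auto
  next
    fix d assume "d \<in> (\<lambda>i. 8 * i + 1) ` {(u - 1) div 8<..(v - 1) div 8}"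
    then obtain i where "d = 8 * i + 1" "(u - 1) div 8 < i" "i \<le> (v - 1) div 8" by auto
    then show "d \<in> {d \<in> {u<..v}. d mod 8 = 1}" by auto
  qed
  then have c: "card {d \<in> {u<..v}. d mod 8 = 1} = nat ((v - 1) div 8 - (u - 1) div 8)"
    by (simp add: card_image inj_on_def)
  define z where "z = (v - 1) div 8 - (u - 1) div 8"
  have "v - u - 8 \<le> 8 * z" unfolding z_def by presburger
  then have 1: "real_of_int (v - u - 8) \<le> real_of_int (8 * z)" by (rule of_int_le_iff[THEN iffD2])
  have "8 * z \<le> v - u + 8" unfolding z_def by presburger
  then have 2: "real_of_int (8 * z) \<le> real_of_int (v - u + 8)" by (rule of_int_le_iff[THEN iffD2])
  have 3: "real_of_int z \<le> real (nat z)" by simp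
  show "real_of_int (v - u) / 8 - 1 \<le> card {d \<in> {u<..v}. d mod 8 = 1}"
    unfolding c z_def [symmetric] using 1 3 by (simp add: field_simps)
  assume "u \<le> v"
  then have "z \<ge> 0" unfolding z_def by presburger
  then have "real (nat z) = real_of_int z" by simp
  then show "card {d \<in> {u<..v}. d mod 8 = 1} \<le> real_of_int (v - u) / 8 + 1"
    unfolding c z_def [symmetric] using 2 by (simp add: field_simps)
qed

text \<open>A union bound over the odd squares:
  \<open>1 / (2*i + 1)^2 \<le> 1 / (4 * i * (i + 1))\<close> sums by telescoping to at most 1/4,
  which within the class 1 mod 8 removes at most \<open>X/32\<close> up to the rounding terms. Thus
  3/32 is 1/8 - 1/32.\<close>

lemma card_discs_ge:
  assumes X: "X \<ge> 1"
  shows "real (card (discs X)) \<ge> 3 / 32 * X - 2 * sqrt (2 * X) - 2"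
proof -
  define u v where "u = \<lfloor>X\<rfloor>" and "v = \<lfloor>2 * X\<rfloor>"
  have uv: "u \<ge> 0" "v \<ge> 0" "real_of_int v \<le> 2 * X" "2 * X < real_of_int v + 1"
    "real_of_int u \<le> X" "X < real_of_int u + 1" "u \<le> v"
    using X by (auto simp: u_def v_def intro: floor_mono)
  define D where "D = {d \<in> {u<..v}. d mod 8 = 1}"
  define I where "I = nat \<lfloor>sqrt (2 * X)\<rfloor>"
  define Bd where "Bd = (\<lambda>i::nat. {d \<in> D. (2 * int i + 1)\<^sup>2 dvd d})"
  have "D - discs X \<subseteq> (\<Union>i\<in>{1..I}. Bd i)"
  proof
    fix d assume d: "d \<in> D - discs X"
    then have d': "\<not> squarefree d" "u < d" "d mod 8 = 1" by (auto simp: D_def discs_eq u_def v_def)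
    have "d > 0" using d'(2) uv(1) by linarith
    have "odd d" using d'(3) by presburger
    then obtain q :: int where q: "prime q" "q\<^sup>2 dvd d"
      using squarefree_factorial_semiring[of d] d'(1) by auto
    have "odd q"
    proof
      assume "even q"
      then have "even (q\<^sup>2)" by simp
      then show False using q(2) \<open>odd d\<close> dvd_trans by blast
    qed
    then obtain i where i: "q = 2 * i + 1" by (elim oddE)
    have "q > 1" using q(1) prime_gt_1_int by blast
    then have "i \<ge> 1" using i by simp
    define n where "n = nat i"
    have n: "i = int n" "n \<ge> 1" using \<open>i \<ge> 1\<close> by (auto simp: n_def)
    have "q\<^sup>2 \<le> d" using q(2) \<open>d > 0\<close> zdvd_imp_le by blast
    also have "d \<le> v" using d by (simp add: D_def)
    finally have "real_of_int (q\<^sup>2) \<le> 2 * X" using uv(3) by linarith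
    then have "(real_of_int q)\<^sup>2 \<le> 2 * X" by simp
    then have "real_of_int q \<le> sqrt (2 * X)" by (rule real_le_rsqrt)
    then have "real n \<le> sqrt (2 * X)" using i n by simp
    then have "n \<le> I" by (simp add: I_def le_nat_floor)
    then have "n \<in> {1..I}" using n by simp
    moreover have "d \<in> Bd n" using d q i n by (simp add: Bd_def)
    ultimately show "d \<in> (\<Union>i\<in>{1..I}. Bd i)" by blast
  qed
  then have "card (D - discs X) \<le> card (\<Union>i\<in>{1..I}. Bd i)"
    by (intro card_mono finite_UN_I finite_subset[of "Bd _" "{u<..v}"]) (auto simp: Bd_def D_def)
  also have "\<dots> \<le> (\<Sum>i\<in>{1..I}. card (Bd i))" by (rule card_UN_le) simp
  finally have "real (card (D - discs X)) \<le> real (\<Sum>i\<in>{1..I}. card (Bd i))" by (rule of_nat_mono)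
  also have "\<dots> = (\<Sum>i\<in>{1..I}. real (card (Bd i)))" by simp
  also have "\<dots> \<le> (\<Sum>i\<in>{1..I}. X / 32 * (1 / real i - 1 / (real i + 1)) + 2)"
  proof (rule sum_mono)
    fix i assume i: "i \<in> {1..I}"
    define c where "c = (2 * int i + 1)\<^sup>2"
    have fin: "finite {j \<in> {a<..b::int}. j mod 8 = 1}" for a b
      by (rule finite_subset[of _ "{a<..b}"]) auto
    have c0: "c > 0" "c mod 8 = 1"
    proof -
      show "c > 0" unfolding c_def by (intro zero_less_power) simp
      have "c = 4 * (int i * (int i + 1)) + 1" by (simp add: c_def power2_eq_square algebra_simps)
      moreover have "even (int i * (int i + 1))" by simp
      then obtain t where "int i * (int i + 1) = 2 * t" by (elim evenE)
      ultimately show "c mod 8 = 1" by presburger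
    qed
    \<comment> \<open>Odd squares are 1 mod 8, so the cofactor \<open>j\<close> lies in the class 1
      mod 8 again. This saves a factor 8, without which the union bound would exceed the total
      \<open>X/8\<close>.\<close>
    have "Bd i \<subseteq> (\<lambda>j. c * j) ` {j \<in> {u div c<..v div c}. j mod 8 = 1}"
    proof
      fix d assume d: "d \<in> Bd i"
      then have "d \<in> {d \<in> {u<..v}. c dvd d}" by (simp add: Bd_def D_def c_def)
      then obtain j where j: "d = c * j" "j \<in> {u div c<..v div c}"
        using multiples_in_interval[OF c0(1)] by blast
      have "d mod 8 = 1" using d by (simp add: Bd_def D_def)
      then have "(c mod 8) * j mod 8 = 1" using j by (simp add: mod_mult_left_eq)
      then have "j mod 8 = 1" using c0 by simp
      then show "d \<in> (\<lambda>j. c * j) ` {j \<in> {u div c<..v div c}. j mod 8 = 1}" using j by blast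
    qed
    then have "card (Bd i) \<le> card ((\<lambda>j. c * j) ` {j \<in> {u div c<..v div c}. j mod 8 = 1})"
      by (intro card_mono finite_imageI fin)
    also have "\<dots> \<le> card {j \<in> {u div c<..v div c}. j mod 8 = 1}" by (rule card_image_le) (rule fin)
    finally have "real (card (Bd i)) \<le> real (card {j \<in> {u div c<..v div c}. j mod 8 = 1})" by (rule of_nat_mono)
    also have "\<dots> \<le> real_of_int (v div c - u div c) / 8 + 1"
      using uv c0 by (intro card_mod_8_eq_1(2) zdiv_mono1) auto
    also have "\<dots> \<le> (X / real_of_int c + 2) / 8 + 1"
    proof -
      have c1: "real_of_int c \<ge> 1" using c0(1) by simp
      have "real_of_int (v div c) \<le> real_of_int v / real_of_int c" by (rule real_of_int_div4)
      also have "\<dots> \<le> 2 * X / real_of_int c" using uv c1 by (intro divide_right_mono) auto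
      finally have 1: "real_of_int (v div c) \<le> 2 * X / real_of_int c" .
      have "u < c * (u div c + 1)" using int_div_less_iff[OF c0(1), of u "u div c + 1"] by simp
      then have "u + 1 \<le> c * (u div c + 1)" by simp
      then have "real_of_int (u + 1) \<le> real_of_int (c * (u div c + 1))" by (rule of_int_le_iff[THEN iffD2])
      then have "X \<le> real_of_int c * (real_of_int (u div c) + 1)" using uv(6) by simp
      then have "X / real_of_int c \<le> real_of_int (u div c) + 1" using c1 by (simp add: field_simps)
      then have "real_of_int (v div c - u div c) \<le> X / real_of_int c + 2" using 1 by simp
      then show ?thesis by (intro add_right_mono divide_right_mono) simp_all
    qed
    also have "\<dots> \<le> X / real_of_int c / 8 + 2" by simp
    also have "X / real_of_int c \<le> X / (4 * (real i * (real i + 1)))"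
      using X i by (intro divide_left_mono) (auto simp: c_def power2_eq_square algebra_simps intro!: mult_pos_pos add_pos_nonneg)
    also have "X / (4 * (real i * (real i + 1))) / 8 + 2 = X / 32 * (1 / real i - 1 / (real i + 1)) + 2"
      using i by (simp add: field_simps)
    finally show "real (card (Bd i)) \<le> X / 32 * (1 / real i - 1 / (real i + 1)) + 2" by simp
  qed
  also have "\<dots> = X / 32 * (\<Sum>i\<in>{1..I}. 1 / real i - 1 / (real i + 1)) + 2 * real I"
    by (simp add: sum.distrib sum_distrib_left)
  also have "(\<Sum>i\<in>{1..I}. 1 / real i - 1 / (real i + 1)) = 1 - 1 / (real I + 1)"
    by (induction I) (simp_all add: add_ac)
  also have "X / 32 * (1 - 1 / (real I + 1)) + 2 * real I \<le> X / 32 * 1 + 2 * sqrt (2 * X)"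
  proof (intro add_mono mult_left_mono)
    show "real I \<le> sqrt (2 * X)" using X by (simp add: I_def)
  qed (use X in auto)
  finally have 1: "real (card (D - discs X)) \<le> X / 32 + 2 * sqrt (2 * X)" by simp
  have "discs X \<subseteq> D" by (auto simp: discs_eq D_def u_def v_def)
  then have "card D = card (discs X) + card (D - discs X)"
    by (metis D_def card_Diff_subset card_mono finite_discs finite_greaterThanAtMost_int finite_Collect_conjI le_add_diff_inverse finite_subset mem_Collect_eq subsetI)
  then have 2: "real (card D) = real (card (discs X)) + real (card (D - discs X))" by simp
  have "real_of_int (v - u) / 8 - 1 \<le> card D" unfolding D_def by (rule card_mod_8_eq_1)
  moreover have "real_of_int (v - u) \<ge> X - 1" using uv by simp
  ultimately have "X / 8 - 2 \<le> card D" by (simp add: field_simps)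
  then show ?thesis using 1 2 by linarith
qed

section \<open>Resonator sums\<close>

text \<open>Each element of \<open>P\<close> lies in both sets, in one or in neither, independently
  of the others. The two booleans record which case holds, and summing over them gives the Euler
  product.\<close>

lemma sum_Pow_Pow_prod:
  fixes g :: "'a \<Rightarrow> bool \<Rightarrow> bool \<Rightarrow> real"
  assumes "finite P"
  shows "(\<Sum>A\<in>Pow P. \<Sum>B\<in>Pow P. \<Prod>p\<in>P. g p (p \<in> A) (p \<in> B)) =
         (\<Prod>p\<in>P. g p True True + g p True False + g p False True + g p False False)"
  using assms
proof (induction P rule: finite_induct)
  case (insert q P)
  define G where "G = (\<lambda>A B. \<Prod>p\<in>P. g p (p \<in> A) (p \<in> B))"
  have split: "(\<Sum>A\<in>Pow (insert q P). F A) = (\<Sum>A\<in>Pow P. F A + F (insert q A))"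
    for F :: "'a set \<Rightarrow> real"
  proof -
    have "inj_on (insert q) (Pow P)" using insert.hyps by (auto simp: inj_on_def)
    moreover have "Pow P \<inter> insert q ` Pow P = {}" using insert.hyps by auto
    ultimately show ?thesis
      using insert.hyps by (simp add: Pow_insert sum.union_disjoint sum.reindex sum.distrib)
  qed
  have *: "(\<Prod>p\<in>insert q P. g p (p \<in> A') (p \<in> B')) = g q (q \<in> A') (q \<in> B') * G A B"
    if "A' = A \<or> A' = insert q A" "B' = B \<or> B' = insert q B" for A A' B B'
  proof -
    have "(\<Prod>p\<in>P. g p (p \<in> A') (p \<in> B')) = G A B"
      unfolding G_def using insert.hyps(2) that by (intro prod.cong refl arg_cong2[where f = "g _"]) auto
    then show ?thesis using insert.hyps by simp
  qed
  have "(\<Sum>A\<in>Pow (insert q P). \<Sum>B\<in>Pow (insert q P). \<Prod>p\<in>insert q P. g p (p \<in> A) (p \<in> B)) =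
    (\<Sum>A\<in>Pow P. \<Sum>B\<in>Pow P. (g q True True + g q True False + g q False True + g q False False) * G A B)"
    unfolding split sum.distrib [symmetric]
  proof (intro sum.cong refl)
    fix A B assume "A \<in> Pow P" "B \<in> Pow P"
    then have "q \<notin> A" "q \<notin> B" using insert.hyps by auto
    then show "(\<Prod>p\<in>insert q P. g p (p \<in> A) (p \<in> B)) + (\<Prod>p\<in>insert q P. g p (p \<in> A) (p \<in> insert q B)) +
      ((\<Prod>p\<in>insert q P. g p (p \<in> insert q A) (p \<in> B)) + (\<Prod>p\<in>insert q P. g p (p \<in> insert q A) (p \<in> insert q B))) =
      (g q True True + g q True False + g q False True + g q False False) * G A B"
      by (subst (1 2 3 4) *[of _ A _ B]) (auto simp: algebra_simps)
  qed
  also have "\<dots> = (g q True True + g q True False + g q False True + g q False False) * (\<Sum>A\<in>Pow P. \<Sum>B\<in>Pow P. G A B)"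
    by (simp add: sum_distrib_left)
  finally show ?case using insert by (simp add: G_def)
qed simp

lemma prod_subset_eq_prod_if:
  assumes "finite P" "A \<subseteq> P"
  shows "(\<Prod>p\<in>A. h p) = (\<Prod>p\<in>P. if p \<in> A then h p else (1::real))"
  using assms by (intro prod.mono_neutral_cong_left) auto

text \<open>For sets of primes with products m1 and m2, \<open>\<Prod>(symdiff A B)\<close> is m1 m2
  / gcd(m1, m2)^2, the squarefree part of m1 m2.\<close>

definition symdiff :: "'a set \<Rightarrow> 'a set \<Rightarrow> 'a set" where
  "symdiff A B = (A - B) \<union> (B - A)"

lemma symdiff_subset: "A \<subseteq> P \<Longrightarrow> B \<subseteq> P \<Longrightarrow> symdiff A B \<subseteq> P"
  by (auto simp: symdiff_def)

text \<open>The shape in which the resonator sums occur: \<open>h\<^sub>1\<close> and \<open>h\<^sub>2\<close> are the local weights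
  of the two factors and \<open>h\<^sub>3\<close> that of the squarefree part of their product.\<close>
lemma sum_Pow_Pow_resonator:
  fixes h1 h2 h3 :: "'a \<Rightarrow> real"
  assumes "finite P"
  shows "(\<Sum>A\<in>Pow P. \<Sum>B\<in>Pow P. (\<Prod>p\<in>A. h1 p) * (\<Prod>p\<in>B. h2 p) * (\<Prod>p\<in>symdiff A B. h3 p)) =
         (\<Prod>p\<in>P. 1 + h1 p * h2 p + h1 p * h3 p + h2 p * h3 p)"
proof -
  define g where "g = (\<lambda>p a b. (if a then h1 p else 1) * (if b then h2 p else 1) * (if a \<noteq> b then h3 p else 1))"
  have "(\<Sum>A\<in>Pow P. \<Sum>B\<in>Pow P. (\<Prod>p\<in>A. h1 p) * (\<Prod>p\<in>B. h2 p) * (\<Prod>p\<in>symdiff A B. h3 p)) =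
     (\<Sum>A\<in>Pow P. \<Sum>B\<in>Pow P. \<Prod>p\<in>P. g p (p \<in> A) (p \<in> B))"
  proof (intro sum.cong refl)
    fix A B assume AB: "A \<in> Pow P" "B \<in> Pow P"
    have "(\<Prod>p\<in>A. h1 p) * (\<Prod>p\<in>B. h2 p) * (\<Prod>p\<in>symdiff A B. h3 p) =
      (\<Prod>p\<in>P. if p \<in> A then h1 p else 1) * (\<Prod>p\<in>P. if p \<in> B then h2 p else 1) *
      (\<Prod>p\<in>P. if p \<in> symdiff A B then h3 p else 1)"
      using AB symdiff_subset[of A P B]
      by (intro arg_cong2[where f = "(*)"] prod_subset_eq_prod_if assms) auto
    also have "\<dots> = (\<Prod>p\<in>P. g p (p \<in> A) (p \<in> B))"
      unfolding prod.distrib [symmetric] g_def by (intro prod.cong refl) (auto simp: symdiff_def)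
    finally show "(\<Prod>p\<in>A. h1 p) * (\<Prod>p\<in>B. h2 p) * (\<Prod>p\<in>symdiff A B. h3 p) = (\<Prod>p\<in>P. g p (p \<in> A) (p \<in> B))" .
  qed
  also have "\<dots> = (\<Prod>p\<in>P. 1 + h1 p * h2 p + h1 p * h3 p + h2 p * h3 p)"
    unfolding sum_Pow_Pow_prod[OF assms] by (intro prod.cong refl) (simp add: g_def algebra_simps)
  finally show ?thesis .
qed

section \<open>Truncated double sums over the resonator\<close>

lemma real_prod_nat_powr: "real (\<Prod>A) powr \<alpha> = (\<Prod>p\<in>A. real p powr \<alpha>)"
  by (induction A rule: infinite_finite_induct) (simp_all add: powr_mult prod_nonneg)

lemma sqrt_real_prod: "sqrt (real (\<Prod>A)) = (\<Prod>p\<in>A. sqrt (real p))"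
  by (induction A rule: infinite_finite_induct) (simp_all add: real_sqrt_mult)

text \<open>The weight of a pair in the main term. The square root comes from counting
  \<open>l\<close> with \<open>\<Prod>(symdiff A B) * l^2 \<le> x\<close>: their number is about
  \<open>sqrt x\<close> divided by this root, up to a logarithm.\<close>

definition pair_weight :: "(nat \<Rightarrow> real) \<Rightarrow> nat set \<Rightarrow> nat set \<Rightarrow> real" where
  "pair_weight f A B = (\<Prod>p\<in>A. f p) * (\<Prod>p\<in>B. f p) / sqrt (real (\<Prod>(symdiff A B)))"

lemma pair_weight_eq:
  "pair_weight f A B = (\<Prod>p\<in>A. f p) * (\<Prod>p\<in>B. f p) * (\<Prod>p\<in>symdiff A B. 1 / sqrt (real p))"
  unfolding pair_weight_def sqrt_real_prod by (simp add: prod_dividef)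

text \<open>Rankin's trick: a pair violating one of the three size conditions has
  \<open>1 \<le> (\<Prod>A / N)\<^sup>\<alpha> + (\<Prod>B / N)\<^sup>\<alpha> + (\<Prod>(symdiff A B) / Y)\<^sup>\<alpha>\<close>.\<close>
lemma truncated_pair_sum_ge:
  fixes f :: "nat \<Rightarrow> real"
  assumes P: "finite P" "\<And>p. p \<in> P \<Longrightarrow> prime p" and f: "\<And>p. p \<in> P \<Longrightarrow> f p \<ge> 0"
    and N: "N > 0" and Y: "Y > 0" and \<alpha>: "\<alpha> > 0"
  shows "(\<Sum>A\<in>{A\<in>Pow P. real (\<Prod>A) \<le> N}. \<Sum>B\<in>{A\<in>Pow P. real (\<Prod>A) \<le> N}.
            if real (\<Prod>(symdiff A B)) \<le> Y then pair_weight f A B else 0) \<ge>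
      (\<Prod>p\<in>P. 1 + (f p)\<^sup>2 + 2 * f p / sqrt p)
      - 2 * N powr - \<alpha> * (\<Prod>p\<in>P. 1 + (f p)\<^sup>2 * p powr \<alpha> + f p * p powr \<alpha> / sqrt p + f p / sqrt p)
      - Y powr - \<alpha> * (\<Prod>p\<in>P. 1 + (f p)\<^sup>2 + 2 * f p * p powr \<alpha> / sqrt p)"
proof -
  let ?m = "\<lambda>A. real (\<Prod>A)"
  let ?w = "pair_weight f"
  have fin: "finite A" if "A \<in> Pow P" for A using that P(1) finite_subset by auto
  have mpos: "?m A > 0" if "A \<in> Pow P" for A
  proof -
    have "\<Prod>A > 0" using that P(2) by (intro prod_pos) (meson PowD prime_gt_0_nat subsetD)
    then show ?thesis by linarith
  qed
  have w0: "?w A B \<ge> 0" if "A \<in> Pow P" "B \<in> Pow P" for A B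
    unfolding pair_weight_def
    by (intro divide_nonneg_nonneg mult_nonneg_nonneg real_sqrt_ge_zero of_nat_0_le_iff prod_nonneg)
      (use that f in auto)
  have symP: "symdiff A B \<in> Pow P" if "A \<in> Pow P" "B \<in> Pow P" for A B
    using that symdiff_subset[of A P B] by auto
  have mp: "?m A powr \<alpha> = (\<Prod>p\<in>A. real p powr \<alpha>)" if "A \<in> Pow P" for A
    by (rule real_prod_nat_powr)
  have Q0: "(\<Sum>A\<in>Pow P. \<Sum>B\<in>Pow P. ?w A B) = (\<Prod>p\<in>P. 1 + (f p)\<^sup>2 + 2 * f p / sqrt p)"
    unfolding pair_weight_eq sum_Pow_Pow_resonator[OF P(1)]
    by (intro prod.cong refl) (simp add: power2_eq_square)
  have T1: "(\<Sum>A\<in>Pow P. \<Sum>B\<in>Pow P. ?w A B * ?m A powr \<alpha>) =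
     (\<Prod>p\<in>P. 1 + (f p)\<^sup>2 * p powr \<alpha> + f p * p powr \<alpha> / sqrt p + f p / sqrt p)"
  proof -
    have "(\<Sum>A\<in>Pow P. \<Sum>B\<in>Pow P. ?w A B * ?m A powr \<alpha>) =
      (\<Sum>A\<in>Pow P. \<Sum>B\<in>Pow P. (\<Prod>p\<in>A. f p * p powr \<alpha>) * (\<Prod>p\<in>B. f p) * (\<Prod>p\<in>symdiff A B. 1 / sqrt (real p)))"
      unfolding pair_weight_eq by (intro sum.cong refl) (simp only: mp prod.distrib mult_ac)
    then show ?thesis unfolding sum_Pow_Pow_resonator[OF P(1)]
      by (simp add: power2_eq_square algebra_simps)
  qed
  have T1': "(\<Sum>A\<in>Pow P. \<Sum>B\<in>Pow P. ?w A B * ?m B powr \<alpha>) =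
     (\<Prod>p\<in>P. 1 + (f p)\<^sup>2 * p powr \<alpha> + f p * p powr \<alpha> / sqrt p + f p / sqrt p)"
  proof -
    have "(\<Sum>A\<in>Pow P. \<Sum>B\<in>Pow P. ?w A B * ?m B powr \<alpha>) =
      (\<Sum>A\<in>Pow P. \<Sum>B\<in>Pow P. (\<Prod>p\<in>A. f p) * (\<Prod>p\<in>B. f p * p powr \<alpha>) * (\<Prod>p\<in>symdiff A B. 1 / sqrt (real p)))"
      unfolding pair_weight_eq by (intro sum.cong refl) (simp only: mp prod.distrib mult_ac)
    then show ?thesis unfolding sum_Pow_Pow_resonator[OF P(1)]
      by (simp add: power2_eq_square algebra_simps)
  qed
  have T2: "(\<Sum>A\<in>Pow P. \<Sum>B\<in>Pow P. ?w A B * ?m (symdiff A B) powr \<alpha>) =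
     (\<Prod>p\<in>P. 1 + (f p)\<^sup>2 + 2 * f p * p powr \<alpha> / sqrt p)"
  proof -
    have "(\<Sum>A\<in>Pow P. \<Sum>B\<in>Pow P. ?w A B * ?m (symdiff A B) powr \<alpha>) =
      (\<Sum>A\<in>Pow P. \<Sum>B\<in>Pow P. (\<Prod>p\<in>A. f p) * (\<Prod>p\<in>B. f p) * (\<Prod>p\<in>symdiff A B. 1 / sqrt (real p) * p powr \<alpha>))"
      unfolding pair_weight_eq by (intro sum.cong refl) (simp only: mp symP prod.distrib mult_ac)
    then show ?thesis unfolding sum_Pow_Pow_resonator[OF P(1)]
      by (simp add: power2_eq_square algebra_simps)
  qed
  define S where "S = {A\<in>Pow P. ?m A \<le> N}"
  have big: "t powr \<alpha> * T powr - \<alpha> > 1" if "t > T" "T > 0" for t T :: real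
  proof -
    have "T powr \<alpha> < t powr \<alpha>" using that \<alpha> by (intro powr_less_mono2) auto
    then show ?thesis using that by (simp add: powr_minus field_simps)
  qed
  have "(\<Sum>A\<in>Pow P. \<Sum>B\<in>Pow P. ?w A B - N powr - \<alpha> * (?w A B * ?m A powr \<alpha>)
      - N powr - \<alpha> * (?w A B * ?m B powr \<alpha>) - Y powr - \<alpha> * (?w A B * ?m (symdiff A B) powr \<alpha>))
    \<le> (\<Sum>A\<in>Pow P. \<Sum>B\<in>Pow P. if A \<in> S \<and> B \<in> S \<and> ?m (symdiff A B) \<le> Y then ?w A B else 0)"
  proof (intro sum_mono)
    fix A B assume AB: "A \<in> Pow P" "B \<in> Pow P"
    define a b c where "a = ?m A powr \<alpha> * N powr - \<alpha>" and "b = ?m B powr \<alpha> * N powr - \<alpha>"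
      and "c = ?m (symdiff A B) powr \<alpha> * Y powr - \<alpha>"
    have nn: "a \<ge> 0" "b \<ge> 0" "c \<ge> 0" by (auto simp: a_def b_def c_def)
    have "1 - a - b - c \<le> (if A \<in> S \<and> B \<in> S \<and> ?m (symdiff A B) \<le> Y then 1 else 0)"
    proof (cases "A \<in> S \<and> B \<in> S \<and> ?m (symdiff A B) \<le> Y")
      case False
      then have "a > 1 \<or> b > 1 \<or> c > 1"
        using AB big[of N "?m A"] big[of N "?m B"] big[of Y "?m (symdiff A B)"] N Y
        by (auto simp: S_def a_def b_def c_def not_le)
      then show ?thesis using nn False by auto
    qed (use nn in auto)
    then have "?w A B * (1 - a - b - c) \<le> ?w A B * (if A \<in> S \<and> B \<in> S \<and> ?m (symdiff A B) \<le> Y then 1 else 0)"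
      by (rule mult_left_mono) (rule w0[OF AB])
    moreover have "?w A B * (if A \<in> S \<and> B \<in> S \<and> ?m (symdiff A B) \<le> Y then 1 else 0) =
      (if A \<in> S \<and> B \<in> S \<and> ?m (symdiff A B) \<le> Y then ?w A B else 0)" by simp
    moreover have "?w A B * (1 - a - b - c) = ?w A B - N powr - \<alpha> * (?w A B * ?m A powr \<alpha>)
      - N powr - \<alpha> * (?w A B * ?m B powr \<alpha>) - Y powr - \<alpha> * (?w A B * ?m (symdiff A B) powr \<alpha>)"
      unfolding a_def b_def c_def by (simp only: right_diff_distrib mult_1_right mult_ac)
    ultimately show "?w A B - N powr - \<alpha> * (?w A B * ?m A powr \<alpha>)
      - N powr - \<alpha> * (?w A B * ?m B powr \<alpha>) - Y powr - \<alpha> * (?w A B * ?m (symdiff A B) powr \<alpha>) \<le>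
      (if A \<in> S \<and> B \<in> S \<and> ?m (symdiff A B) \<le> Y then ?w A B else 0)"
      by (simp only:)
  qed
  also have "\<dots> = (\<Sum>A\<in>S. \<Sum>B\<in>S. if ?m (symdiff A B) \<le> Y then ?w A B else 0)"
  proof -
    have S: "S \<subseteq> Pow P" "finite (Pow P)" using P(1) by (auto simp: S_def)
    have "(\<Sum>A\<in>Pow P. \<Sum>B\<in>Pow P. if A \<in> S \<and> B \<in> S \<and> ?m (symdiff A B) \<le> Y then ?w A B else 0) =
      (\<Sum>A\<in>S. \<Sum>B\<in>Pow P. if A \<in> S \<and> B \<in> S \<and> ?m (symdiff A B) \<le> Y then ?w A B else 0)"
      using S by (intro sum.mono_neutral_right) auto
    also have "\<dots> = (\<Sum>A\<in>S. \<Sum>B\<in>S. if ?m (symdiff A B) \<le> Y then ?w A B else 0)"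
      using S by (intro sum.cong refl sum.mono_neutral_cong_right) auto
    finally show ?thesis .
  qed
  finally show ?thesis
    unfolding S_def sum_subtractf sum_distrib_left [symmetric] Q0 T1 T1' T2 by simp
qed

lemma resonator_norm_le:
  fixes f :: "nat \<Rightarrow> real"
  assumes "finite P"
  shows "(\<Sum>A\<in>{A\<in>Pow P. real (\<Prod>A) \<le> N}. (\<Prod>p\<in>A. f p)\<^sup>2) \<le> (\<Prod>p\<in>P. 1 + (f p)\<^sup>2)"
proof -
  have "(\<Sum>A\<in>{A\<in>Pow P. real (\<Prod>A) \<le> N}. (\<Prod>p\<in>A. f p)\<^sup>2) \<le> (\<Sum>A\<in>Pow P. (\<Prod>p\<in>A. f p)\<^sup>2)"
    using assms by (intro sum_mono2) auto
  also have "\<dots> = (\<Prod>p\<in>P. (f p)\<^sup>2 + 1)"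
    by (simp add: prod_add[OF assms] prod_power_distrib)
  finally show ?thesis by (simp add: add.commute)
qed

text \<open>Cauchy-Schwarz; by unique factorisation the admissible sets correspond to distinct
  integers in \<open>{1..N}\<close>, so there are at most \<open>N\<close> of them.\<close>

lemma resonator_sum_squared_le:
  fixes f :: "nat \<Rightarrow> real"
  assumes P: "finite P" "\<And>p. p \<in> P \<Longrightarrow> prime p" and N: "N \<ge> 0"
  shows "(\<Sum>A\<in>{A\<in>Pow P. real (\<Prod>A) \<le> N}. \<Prod>p\<in>A. f p)\<^sup>2 \<le>
     N * (\<Sum>A\<in>{A\<in>Pow P. real (\<Prod>A) \<le> N}. (\<Prod>p\<in>A. f p)\<^sup>2)"
proof -
  define S where "S = {A\<in>Pow P. real (\<Prod>A) \<le> N}"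
  have "inj_on (\<lambda>A. \<Prod>A) S"
    using P finite_subset by (intro inj_on_prod_primes) (auto simp: S_def)
  moreover have "(\<lambda>A. \<Prod>A) ` S \<subseteq> {1..nat \<lfloor>N\<rfloor>}"
  proof
    fix n assume "n \<in> (\<lambda>A. \<Prod>A) ` S"
    then obtain A where A: "A \<subseteq> P" "real (\<Prod>A) \<le> N" "n = \<Prod>A" by (auto simp: S_def)
    have "n > 0" unfolding A(3) using A(1) P(2) by (intro prod_pos) (meson prime_gt_0_nat subsetD)
    moreover have "n \<le> nat \<lfloor>N\<rfloor>" using A(2,3) by (simp add: le_nat_floor)
    ultimately show "n \<in> {1..nat \<lfloor>N\<rfloor>}" by simp
  qed
  ultimately have "card S \<le> card {1..nat \<lfloor>N\<rfloor>}" by (intro card_inj_on_le[of "\<lambda>A. \<Prod>A"]) auto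
  then have "real (card S) \<le> real (nat \<lfloor>N\<rfloor>)" by simp
  also have "\<dots> \<le> N" using N by simp
  finally have card: "real (card S) \<le> N" .
  have "(\<Sum>A\<in>S. \<Prod>p\<in>A. f p)\<^sup>2 \<le> (\<Sum>A\<in>S. (\<Prod>p\<in>A. f p)\<^sup>2) * card S"
    by (rule sum_squared_le_sum_of_squares)
  also have "\<dots> \<le> (\<Sum>A\<in>S. (\<Prod>p\<in>A. f p)\<^sup>2) * N"
    using card by (intro mult_left_mono sum_nonneg) auto
  finally show ?thesis by (simp add: S_def mult.commute)
qed

text \<open>With \<open>v = 2 * f p / sqrt p\<close> and \<open>u = (1 - \<eta>) * v\<close>, one
  factor \<open>1 - \<eta>\<close> pays for \<open>ln (1 + u) \<ge> u - u^2\<close>. The other pays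
  for the cross term \<open>(f p)^2 * v\<close>, because
  \<open>(1 + \<eta>) * (1 - \<eta>) \<le> 1\<close>.\<close>

lemma euler_product_ratio_ge:
  fixes f :: "nat \<Rightarrow> real"
  assumes \<eta>: "0 \<le> \<eta>" "\<eta> \<le> 1"
    and f: "\<And>p. p \<in> P \<Longrightarrow> f p \<ge> 0" "\<And>p. p \<in> P \<Longrightarrow> (f p)\<^sup>2 \<le> \<eta>" "\<And>p. p \<in> P \<Longrightarrow> 2 * f p / sqrt p \<le> \<eta>"
  shows "(\<Prod>p\<in>P. 1 + (f p)\<^sup>2 + 2 * f p / sqrt p) \<ge>
    (\<Prod>p\<in>P. 1 + (f p)\<^sup>2) * exp ((1 - \<eta>)\<^sup>2 * (\<Sum>p\<in>P. 2 * f p / sqrt p))"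
proof (cases "finite P")
  case True
  have "(\<Prod>p\<in>P. 1 + (f p)\<^sup>2) * exp ((1 - \<eta>)\<^sup>2 * (\<Sum>p\<in>P. 2 * f p / sqrt p)) =
    (\<Prod>p\<in>P. (1 + (f p)\<^sup>2) * exp ((1 - \<eta>)\<^sup>2 * (2 * f p / sqrt p)))"
    using True by (simp only: sum_distrib_left exp_sum prod.distrib)
  also have "\<dots> \<le> (\<Prod>p\<in>P. 1 + (f p)\<^sup>2 + 2 * f p / sqrt p)"
  proof (intro prod_mono conjI)
    fix p assume p: "p \<in> P"
    define v u where "v = 2 * f p / sqrt p" and "u = (1 - \<eta>) * v"
    have v: "0 \<le> v" "v \<le> \<eta>" using f p by (auto simp: v_def)
    have u: "0 \<le> u" "u \<le> v" "u \<le> \<eta>" "u \<le> 1"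
    proof -
      show "0 \<le> u" using v \<eta> by (simp add: u_def)
      show "u \<le> v" using v \<eta> by (simp add: u_def mult_left_le_one_le)
      then show "u \<le> \<eta>" "u \<le> 1" using v \<eta> by linarith+
    qed
    have "(1 - \<eta>)\<^sup>2 * v = u * (1 - \<eta>)" by (simp add: u_def power2_eq_square)
    also have "\<dots> \<le> u * (1 - u)" using u by (intro mult_left_mono) auto
    also have "\<dots> = u - u\<^sup>2" by (simp add: power2_eq_square algebra_simps)
    also have "\<dots> \<le> ln (1 + u)" using u by (intro ln_one_plus_pos_lower_bound)
    finally have "exp ((1 - \<eta>)\<^sup>2 * v) \<le> exp (ln (1 + u))" by simp
    also have "\<dots> = 1 + u" using u by simp
    finally have "(1 + (f p)\<^sup>2) * exp ((1 - \<eta>)\<^sup>2 * v) \<le> (1 + (f p)\<^sup>2) * (1 + u)"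
      by (intro mult_left_mono) auto
    also have "\<dots> = 1 + (f p)\<^sup>2 + (1 + (f p)\<^sup>2) * (1 - \<eta>) * v" by (simp add: u_def algebra_simps)
    also have "(1 + (f p)\<^sup>2) * (1 - \<eta>) \<le> (1 + \<eta>) * (1 - \<eta>)"
      using f(2)[OF p] \<eta> by (intro mult_right_mono) auto
    also have "(1 + \<eta>) * (1 - \<eta>) \<le> 1" by (simp add: algebra_simps)
    finally have "(1 + (f p)\<^sup>2) * exp ((1 - \<eta>)\<^sup>2 * v) \<le> 1 + (f p)\<^sup>2 + 1 * v"
      using v by (simp add: mult_right_mono)
    then show "(1 + (f p)\<^sup>2) * exp ((1 - \<eta>)\<^sup>2 * (2 * f p / sqrt p)) \<le> 1 + (f p)\<^sup>2 + 2 * f p / sqrt p"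
      by (simp add: v_def)
  qed (simp add: add_nonneg_nonneg)
  finally show ?thesis .
qed simp

text \<open>Factor by factor, \<open>a + b \<le> a * (1 + b) \<le> a * exp b\<close> because
  \<open>a \<ge> 1\<close>. It compares the Rankin tails with the full Euler product.\<close>

lemma prod_perturb_le:
  fixes a b :: "'a \<Rightarrow> real"
  assumes "\<And>p. p \<in> P \<Longrightarrow> a p \<ge> 1" "\<And>p. p \<in> P \<Longrightarrow> b p \<ge> 0"
  shows "(\<Prod>p\<in>P. a p + b p) \<le> (\<Prod>p\<in>P. a p) * exp (\<Sum>p\<in>P. b p)"
proof (cases "finite P")
  case True
  have "(\<Prod>p\<in>P. a p + b p) \<le> (\<Prod>p\<in>P. a p * exp (b p))"
  proof (intro prod_mono conjI)
    fix p assume p: "p \<in> P"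
    have "a p + b p \<le> a p + a p * b p" using assms[OF p] by (simp add: mult_right_mono[of 1 "a p" "b p", simplified])
    also have "\<dots> = a p * (1 + b p)" by (simp add: algebra_simps)
    also have "\<dots> \<le> a p * exp (b p)" using assms[OF p] by (intro mult_left_mono exp_ge_add_one_self) auto
    finally show "a p + b p \<le> a p * exp (b p)" .
    show "0 \<le> a p + b p" using assms[OF p] by simp
  qed
  then show ?thesis using True by (simp add: exp_sum prod.distrib)
qed simp

section \<open>The resonance inequality\<close>

lemma multiplicity_prod_primes:
  assumes "finite A" "\<And>q. q \<in> A \<Longrightarrow> prime q" "prime (p::nat)"
  shows "multiplicity p (\<Prod>A) = (if p \<in> A then 1 else 0)"
  using assms
proof (induction A rule: finite_induct)
  case (insert q A)
  have "multiplicity p (\<Prod>(insert q A)) = multiplicity p q + multiplicity p (\<Prod>A)"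
  proof -
    have "\<Prod>A \<noteq> 0" using insert by (metis insertCI not_prime_0 prod_zero_iff)
    moreover have "q \<noteq> 0" using insert by (metis insertCI not_prime_0)
    ultimately show ?thesis using insert.hyps insert.prems(2)
      by (simp add: prime_elem_multiplicity_mult_distrib)
  qed
  moreover have "multiplicity p q = (if p = q then 1 else 0)"
    using insert.prems by (simp add: prime_multiplicity_other)
  ultimately show ?case using insert by auto
qed simp

text \<open>The product of two squarefree numbers times its squarefree part is the square of their
  least common multiple.\<close>

lemma prod_mult_symdiff:
  fixes A B :: "nat set"
  assumes "finite A" "finite B"
  shows "\<Prod>A * \<Prod>B * \<Prod>(symdiff A B) = \<Prod>(A \<union> B) * \<Prod>(A \<union> B)"
proof -
  have "\<Prod>A = \<Prod>(A - B) * \<Prod>(A \<inter> B)" "\<Prod>B = \<Prod>(B - A) * \<Prod>(A \<inter> B)"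
    using assms prod.Int_Diff[of A "\<lambda>x. x" B] prod.Int_Diff[of B "\<lambda>x. x" A]
    by (simp_all add: mult.commute Int_commute)
  moreover have "\<Prod>(symdiff A B) = \<Prod>(A - B) * \<Prod>(B - A)"
    unfolding symdiff_def using assms by (intro prod.union_disjoint) auto
  moreover have "\<Prod>(A \<union> B) = \<Prod>(symdiff A B) * \<Prod>(A \<inter> B)"
  proof -
    have "A \<union> B = symdiff A B \<union> (A \<inter> B)" by (auto simp: symdiff_def)
    moreover have "\<Prod>(symdiff A B \<union> (A \<inter> B)) = \<Prod>(symdiff A B) * \<Prod>(A \<inter> B)"
      using assms by (intro prod.union_disjoint) (auto simp: symdiff_def)
    ultimately show ?thesis by simp
  qed
  ultimately show ?thesis by (simp only: mult_ac)
qed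

text \<open>The diagonal terms: the argument is \<open>j * j\<close> with
  \<open>j = \<Prod>(A \<union> B) * l\<close>, and \<open>j\<close> has at most
  \<open>card A + card B + 1\<close> prime factors, all at least \<open>y\<close>.\<close>

lemma disc_sum_pair_ge:
  assumes X: "X \<ge> 1" and fin: "finite A" "finite B"
    and pr: "\<And>p. p \<in> A \<union> B \<Longrightarrow> prime p" "\<And>p. p \<in> A \<union> B \<Longrightarrow> real p \<ge> y"
    and l: "prime l" "real l \<ge> y" and y: "y > 0"
  shows "real_of_int (disc_sum X (\<Prod>A * \<Prod>B * (\<Prod>(symdiff A B) * l * l))) \<ge>
    card (discs X) - real (card A + card B + 1) * (2 * X / y)"
proof -
  define j where "j = \<Prod>(A \<union> B) * l"
  have "\<Prod>(A \<union> B) > 0" using pr(1) by (intro prod_pos) (auto intro: prime_gt_0_nat)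
  then have j0: "j > 0" using l(1) by (simp add: j_def prime_gt_0_nat)
  have "\<Prod>A * \<Prod>B * (\<Prod>(symdiff A B) * l * l) = (\<Prod>A * \<Prod>B * \<Prod>(symdiff A B)) * (l * l)"
    by (simp only: mult_ac)
  also have "\<dots> = j * j" unfolding prod_mult_symdiff[OF fin] j_def by (simp only: mult_ac)
  finally have eq: "\<Prod>A * \<Prod>B * (\<Prod>(symdiff A B) * l * l) = j * j" .
  have "prime_factors (\<Prod>(A \<union> B)) = (\<Union>p\<in>A \<union> B. {p})"
  proof -
    have "0 \<notin> (\<lambda>p. p) ` (A \<union> B)" using pr(1)[of 0] by auto
    then have "prime_factors (\<Prod>(A \<union> B)) = \<Union>((prime_factors \<circ> (\<lambda>p. p)) ` (A \<union> B))"
      using fin by (intro prime_factors_prod) auto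
    then show ?thesis
      unfolding comp_def using pr(1) by (simp only:) (intro SUP_cong refl prime_prime_factors, blast)
  qed
  then have pf: "prime_factors j = A \<union> B \<union> {l}"
    unfolding j_def using \<open>\<Prod>(A \<union> B) > 0\<close> l(1)
    by (subst prime_factors_product) (auto simp: prime_prime_factors)
  have "card (prime_factors j) \<le> card (A \<union> B) + card {l}" unfolding pf by (rule card_Un_le)
  also have "\<dots> \<le> card A + card B + 1" using card_Un_le[of A B] by simp
  finally have "real (card (prime_factors j)) * (2 * X / y) \<le> real (card A + card B + 1) * (2 * X / y)"
    using X y by (intro mult_right_mono of_nat_mono) auto
  moreover have "real_of_int (disc_sum X (j * j)) \<ge> card (discs X) - card (prime_factors j) * (2 * X / y)"
    using pr(2) l(2) by (intro disc_sum_square_ge X j0 y) (auto simp: pf)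
  ultimately show ?thesis unfolding eq by linarith
qed

text \<open>Compares the sum of \<open>(R d)^2\<close> with the same sum weighted by the character
  sums. An argument is either a square times a power of 2 and contributes nonnegatively, or it
  contributes at least \<open>- Err\<close>. Hence all \<open>n\<close> except
  \<open>n = \<Prod>(symdiff A B) * l * l\<close> may be dropped at a cost of \<open>x * Err\<close>
  per pair. \<open>\<kappa>\<close> measures the supply of primes \<open>l\<close>, and
  \<open>card\<close> ensures that coprimality costs at most half of the discriminants.\<close>

lemma resonance_inequality:
  fixes f :: "nat \<Rightarrow> real" and r :: "nat set \<Rightarrow> real" and P :: "nat set" and X N x y Y \<kappa> Err M c :: real
  defines "S \<equiv> {A \<in> Pow P. real (\<Prod>A) \<le> N}"
  defines "r \<equiv> \<lambda>A. \<Prod>p\<in>A. f p"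
  assumes X: "X \<ge> 1" and P: "finite P" "\<And>p. p \<in> P \<Longrightarrow> prime p" "\<And>p. p \<in> P \<Longrightarrow> p \<noteq> 2"
    "\<And>p. p \<in> P \<Longrightarrow> real p \<ge> y" and f: "\<And>p. p \<in> P \<Longrightarrow> f p \<ge> 0"
    and N: "N > 0" and x: "x \<ge> 1" and y: "y > 0" and \<kappa>: "\<kappa> \<ge> 0"
    and M: "M \<ge> 0" "\<And>d. d \<in> discs X \<Longrightarrow> (\<Sum>n\<in>{1..nat \<lfloor>x\<rfloor>}. real_of_int (kronecker d n)) \<le> M"
    and Err: "Err \<ge> 0" "\<And>k p. k > 0 \<Longrightarrow> real k \<le> N\<^sup>2 * x \<Longrightarrow> prime p \<Longrightarrow> p \<noteq> 2 \<Longrightarrow>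
        odd (multiplicity p k) \<Longrightarrow> \<bar>real_of_int (disc_sum X k)\<bar> \<le> Err"
    and card: "\<And>A. A \<in> S \<Longrightarrow> real (card A) \<le> c" "(2 * c + 1) * (2 * X / y) \<le> card (discs X) / 2"
    and L: "\<And>A B. A \<in> S \<Longrightarrow> B \<in> S \<Longrightarrow> real (\<Prod>(symdiff A B)) \<le> Y \<Longrightarrow>
        \<kappa> * sqrt x / sqrt (real (\<Prod>(symdiff A B))) \<le>
        card {l. prime l \<and> y \<le> real l \<and> real (\<Prod>(symdiff A B)) * (real l)\<^sup>2 \<le> x}"
  shows "\<kappa> * sqrt x * (card (discs X) / 2) *
      (\<Sum>A\<in>S. \<Sum>B\<in>S. if real (\<Prod>(symdiff A B)) \<le> Y then pair_weight f A B else 0)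
      - x * Err * (\<Sum>A\<in>S. r A)\<^sup>2
    \<le> M * (card (discs X) * (\<Sum>A\<in>S. (r A)\<^sup>2) + Err * (\<Sum>A\<in>S. r A)\<^sup>2)"
proof -
  define D where "D = real (card (discs X))"
  define R where "R = (\<lambda>d. \<Sum>A\<in>S. r A * real_of_int (kronecker d (\<Prod>A)))"
  define Sx where "Sx = (\<lambda>d. \<Sum>n\<in>{1..nat \<lfloor>x\<rfloor>}. real_of_int (kronecker d n))"
  define T where "T = (\<lambda>k. real_of_int (disc_sum X k))"
  have finS: "finite S" using P(1) by (simp add: S_def)
  have SP: "A \<subseteq> P" "finite A" "real (\<Prod>A) \<le> N" if "A \<in> S" for A
    using that P(1) finite_subset by (auto simp: S_def)
  have r0: "r A \<ge> 0" if "A \<in> S" for A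
    unfolding r_def using SP(1)[OF that] f by (intro prod_nonneg) auto
  have pos: "\<Prod>A > 0" if "A \<in> S" for A
    using SP(1)[OF that] P(2) by (intro prod_pos) (meson prime_gt_0_nat subsetD)
  have posd: "\<Prod>(symdiff A B) > 0" if "A \<in> S" "B \<in> S" for A B
    using symdiff_subset[OF SP(1)[OF that(1)] SP(1)[OF that(2)]] P(2)
    by (intro prod_pos) (meson prime_gt_0_nat subsetD)
  have T_ge: "T k \<ge> - Err" if "k > 0" "real k \<le> N\<^sup>2 * x" for k
  proof (cases "\<exists>p. prime p \<and> p \<noteq> 2 \<and> odd (multiplicity p k)")
    case True
    then obtain p where "prime p" "p \<noteq> 2" "odd (multiplicity p k)" by blast
    from Err(2)[OF that this] show ?thesis by (simp add: T_def abs_le_iff)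
  next
    case False
    then have "disc_sum X k \<ge> 0" by (intro disc_sum_nonneg) auto
    then show ?thesis using Err(1) by (simp add: T_def)
  qed
  have size2: "real (\<Prod>A * \<Prod>B) \<le> N\<^sup>2" if "A \<in> S" "B \<in> S" for A B
  proof -
    have "real (\<Prod>A) * real (\<Prod>B) \<le> N * N"
      using SP(3)[OF that(1)] SP(3)[OF that(2)] N by (intro mult_mono of_nat_0_le_iff) auto
    then show ?thesis by (simp only: of_nat_mult power2_eq_square)
  qed
  have kron: "(R d)\<^sup>2 * z = (\<Sum>A\<in>S. \<Sum>B\<in>S. r A * r B * (real_of_int (kronecker d (\<Prod>A * \<Prod>B)) * z))" for d z
  proof -
    have "(R d)\<^sup>2 * z = (\<Sum>A\<in>S. \<Sum>B\<in>S. (r A * real_of_int (kronecker d (\<Prod>A))) * (r B * real_of_int (kronecker d (\<Prod>B))) * z)"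
      unfolding R_def power2_eq_square sum_product unfolding sum_distrib_right ..
    also have "\<dots> = (\<Sum>A\<in>S. \<Sum>B\<in>S. r A * r B * (real_of_int (kronecker d (\<Prod>A * \<Prod>B)) * z))"
      by (intro sum.cong refl) (simp only: kronecker_mult[OF pos pos] of_int_mult mult_ac)
    finally show ?thesis .
  qed
  have swap: "(\<Sum>d\<in>discs X. (R d)\<^sup>2 * z d) =
     (\<Sum>A\<in>S. \<Sum>B\<in>S. r A * r B * (\<Sum>d\<in>discs X. real_of_int (kronecker d (\<Prod>A * \<Prod>B)) * z d))" for z
  proof -
    have "(\<Sum>d\<in>discs X. (R d)\<^sup>2 * z d) =
      (\<Sum>A\<in>S. \<Sum>d\<in>discs X. \<Sum>B\<in>S. r A * r B * (real_of_int (kronecker d (\<Prod>A * \<Prod>B)) * z d))"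
      unfolding kron by (rule sum.swap)
    also have "\<dots> = (\<Sum>A\<in>S. \<Sum>B\<in>S. \<Sum>d\<in>discs X. r A * r B * (real_of_int (kronecker d (\<Prod>A * \<Prod>B)) * z d))"
      by (intro sum.cong refl sum.swap)
    finally show ?thesis unfolding sum_distrib_left .
  qed
  have "(\<Sum>d\<in>discs X. (R d)\<^sup>2 * 1) \<le> (\<Sum>A\<in>S. \<Sum>B\<in>S. r A * r B * ((if A = B then D else 0) + Err))"
    unfolding swap
  proof (intro sum_mono mult_left_mono)
    fix A B assume AB: "A \<in> S" "B \<in> S"
    have eq: "(\<Sum>d\<in>discs X. real_of_int (kronecker d (\<Prod>A * \<Prod>B)) * 1) = T (\<Prod>A * \<Prod>B)"
      by (simp only: T_def disc_sum_def of_int_sum mult_1_right)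
    show "(\<Sum>d\<in>discs X. real_of_int (kronecker d (\<Prod>A * \<Prod>B)) * 1) \<le> (if A = B then D else 0) + Err"
    proof (cases "A = B")
      case True
      have "T (\<Prod>A * \<Prod>B) \<le> D"
        unfolding T_def D_def using disc_sum_le_card[of X "\<Prod>A * \<Prod>B"] by linarith
      then show ?thesis unfolding eq using True Err(1) by simp
    next
      case False
      \<comment> \<open>A prime in exactly one of the sets divides the product exactly once, and it
        is odd because it lies in \<open>P\<close>; so the pair is off-diagonal.\<close>
      then obtain p where p: "p \<in> symdiff A B" by (auto simp: symdiff_def)
      then have pP: "p \<in> P" using symdiff_subset[OF SP(1)[OF AB(1)] SP(1)[OF AB(2)]] by blast
      have prA: "prime q" if "q \<in> A \<or> q \<in> B" for q using that SP(1)[OF AB(1)] SP(1)[OF AB(2)] P(2) by blast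
      have "multiplicity p (\<Prod>A * \<Prod>B) = multiplicity p (\<Prod>A) + multiplicity p (\<Prod>B)"
        using pos[OF AB(1)] pos[OF AB(2)] P(2)[OF pP] by (intro prime_elem_multiplicity_mult_distrib) auto
      also have "\<dots> = 1"
        using p prA P(2)[OF pP] SP(2)[OF AB(1)] SP(2)[OF AB(2)]
        by (auto simp: multiplicity_prod_primes symdiff_def)
      finally have "odd (multiplicity p (\<Prod>A * \<Prod>B))" by simp
      moreover have "\<Prod>A * \<Prod>B > 0" using pos[OF AB(1)] pos[OF AB(2)] by simp
      moreover have "real (\<Prod>A * \<Prod>B) \<le> N\<^sup>2 * x"
        using size2[OF AB] x mult_left_mono[of 1 x "N\<^sup>2"] by simp
      ultimately have "\<bar>T (\<Prod>A * \<Prod>B)\<bar> \<le> Err"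
        unfolding T_def using P(2,3)[OF pP] by (intro Err(2))
      then show ?thesis unfolding eq using False by simp
    qed
  qed (use r0 in auto)
  also have "\<dots> = (\<Sum>A\<in>S. \<Sum>B\<in>S. if A = B then D * (r A)\<^sup>2 else 0) + (\<Sum>A\<in>S. \<Sum>B\<in>S. Err * (r A * r B))"
    unfolding sum.distrib [symmetric]
    by (intro sum.cong refl) (auto simp: power2_eq_square algebra_simps)
  also have "(\<Sum>A\<in>S. \<Sum>B\<in>S. if A = B then D * (r A)\<^sup>2 else 0) = D * (\<Sum>A\<in>S. (r A)\<^sup>2)"
    using finS by (simp add: sum_distrib_left)
  also have "(\<Sum>A\<in>S. \<Sum>B\<in>S. Err * (r A * r B)) = Err * (\<Sum>A\<in>S. r A)\<^sup>2"
    unfolding power2_eq_square sum_product unfolding sum_distrib_left ..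
  finally have upper: "(\<Sum>d\<in>discs X. (R d)\<^sup>2) \<le> D * (\<Sum>A\<in>S. (r A)\<^sup>2) + Err * (\<Sum>A\<in>S. r A)\<^sup>2"
    by (simp only: mult_1_right)

  have inner: "(if real (\<Prod>(symdiff A B)) \<le> Y then \<kappa> * sqrt x / sqrt (real (\<Prod>(symdiff A B))) * (D / 2) else 0) - x * Err
      \<le> (\<Sum>n\<in>{1..nat \<lfloor>x\<rfloor>}. T (\<Prod>A * \<Prod>B * n))" if AB: "A \<in> S" "B \<in> S" for A B
  proof -
    define m where "m = \<Prod>(symdiff A B)"
    have m: "m > 0" using posd[OF AB] by (simp add: m_def)
    \<comment> \<open>For \<open>m > Y\<close> no \<open>l\<close> is used, and the pair only incurs
      the loss \<open>x * Err\<close>; this produces the truncation at \<open>Y\<close> in the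
      conclusion.\<close>
    define Ls where "Ls = (if real m \<le> Y then {l. prime l \<and> y \<le> real l \<and> real m * (real l)\<^sup>2 \<le> x} else {})"
    define J where "J = (\<lambda>l. m * l * l) ` Ls"
    have J: "J \<subseteq> {1..nat \<lfloor>x\<rfloor>}"
    proof
      fix n assume "n \<in> J"
      then obtain l where l: "prime l" "real m * (real l)\<^sup>2 \<le> x" "n = m * l * l"
        by (auto simp: J_def Ls_def split: if_splits)
      have "real n \<le> x" using l by (simp add: power2_eq_square mult.assoc)
      moreover have "n > 0" using l m by (simp add: prime_gt_0_nat)
      ultimately show "n \<in> {1..nat \<lfloor>x\<rfloor>}" by (simp add: le_nat_floor Suc_le_eq)
    qed
    then have finJ: "finite J" using finite_subset by blast
    have inj: "inj_on (\<lambda>l. m * l * l) Ls"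
    proof (rule inj_onI)
      fix l l' assume "m * l * l = m * l' * l'"
      then have "l ^ 2 = l' ^ 2" using m by (simp add: power2_eq_square mult.assoc)
      then show "l = l'" by (rule power_eq_imp_eq_base) auto
    qed
    have nx: "real (nat \<lfloor>x\<rfloor>) \<le> x" using x by simp
    have rest: "- (x * Err) \<le> (\<Sum>n\<in>{1..nat \<lfloor>x\<rfloor>} - J. T (\<Prod>A * \<Prod>B * n))"
    proof -
      have "- (x * Err) \<le> - (real (nat \<lfloor>x\<rfloor>) * Err)"
        using nx Err(1) by (simp add: mult_right_mono)
      also have "\<dots> \<le> - (real (card ({1..nat \<lfloor>x\<rfloor>} - J)) * Err)"
      proof -
        have "card ({1..nat \<lfloor>x\<rfloor>} - J) \<le> card {1..nat \<lfloor>x\<rfloor>}" by (intro card_mono) auto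
        then show ?thesis using Err(1) by (simp add: mult_right_mono)
      qed
      also have "\<dots> = (\<Sum>n\<in>{1..nat \<lfloor>x\<rfloor>} - J. - Err)" by simp
      also have "\<dots> \<le> (\<Sum>n\<in>{1..nat \<lfloor>x\<rfloor>} - J. T (\<Prod>A * \<Prod>B * n))"
      proof (intro sum_mono T_ge)
        fix n assume n: "n \<in> {1..nat \<lfloor>x\<rfloor>} - J"
        then show "\<Prod>A * \<Prod>B * n > 0" using pos[OF AB(1)] pos[OF AB(2)] by simp
        have "real n \<le> x" using n nx by simp
        then have "real (\<Prod>A * \<Prod>B) * real n \<le> N\<^sup>2 * x"
          using size2[OF AB] by (intro mult_mono) auto
        then show "real (\<Prod>A * \<Prod>B * n) \<le> N\<^sup>2 * x" by (simp only: of_nat_mult)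
      qed
      finally show ?thesis .
    qed
    have main: "real (card Ls) * (D / 2) \<le> (\<Sum>n\<in>J. T (\<Prod>A * \<Prod>B * n))"
    proof -
      have "real (card Ls) * (D / 2) = (\<Sum>l\<in>Ls. D / 2)" by simp
      also have "\<dots> \<le> (\<Sum>l\<in>Ls. T (\<Prod>A * \<Prod>B * (m * l * l)))"
      proof (rule sum_mono)
        fix l assume "l \<in> Ls"
        then have l: "prime l" "y \<le> real l" by (auto simp: Ls_def split: if_splits)
        have PAB: "p \<in> P" if "p \<in> A \<union> B" for p using that SP(1)[OF AB(1)] SP(1)[OF AB(2)] by blast
        have "T (\<Prod>A * \<Prod>B * (m * l * l)) \<ge> D - real (card A + card B + 1) * (2 * X / y)"
          unfolding T_def D_def m_def
          using PAB P(2,4) by (intro disc_sum_pair_ge X SP(2) AB l y) blast+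
        moreover have "real (card A + card B + 1) * (2 * X / y) \<le> (2 * c + 1) * (2 * X / y)"
          using card(1)[OF AB(1)] card(1)[OF AB(2)] X y by (intro mult_right_mono) auto
        ultimately show "D / 2 \<le> T (\<Prod>A * \<Prod>B * (m * l * l))"
          using card(2) unfolding D_def by linarith
      qed
      also have "\<dots> = (\<Sum>n\<in>J. T (\<Prod>A * \<Prod>B * n))"
        unfolding J_def by (subst sum.reindex[OF inj]) (simp only: comp_def)
      finally show ?thesis .
    qed
    have "(if real m \<le> Y then \<kappa> * sqrt x / sqrt (real m) * (D / 2) else 0) \<le> real (card Ls) * (D / 2)"
    proof (cases "real m \<le> Y")
      case True
      then have "\<kappa> * sqrt x / sqrt (real m) \<le> real (card Ls)"
        using L[OF AB] unfolding m_def [symmetric] by (simp add: Ls_def)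
      then have "\<kappa> * sqrt x / sqrt (real m) * (D / 2) \<le> real (card Ls) * (D / 2)"
        by (rule mult_right_mono) (simp add: D_def)
      then show ?thesis using True by simp
    qed (simp add: D_def)
    moreover have "(\<Sum>n\<in>{1..nat \<lfloor>x\<rfloor>}. T (\<Prod>A * \<Prod>B * n)) =
        (\<Sum>n\<in>{1..nat \<lfloor>x\<rfloor>} - J. T (\<Prod>A * \<Prod>B * n)) + (\<Sum>n\<in>J. T (\<Prod>A * \<Prod>B * n))"
      by (rule sum.subset_diff[OF J]) simp
    ultimately show ?thesis using main rest unfolding m_def by linarith
  qed
  have "\<kappa> * sqrt x * (D / 2) *
      (\<Sum>A\<in>S. \<Sum>B\<in>S. if real (\<Prod>(symdiff A B)) \<le> Y then pair_weight f A B else 0)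
      - x * Err * (\<Sum>A\<in>S. r A)\<^sup>2 =
    (\<Sum>A\<in>S. \<Sum>B\<in>S. r A * r B * ((if real (\<Prod>(symdiff A B)) \<le> Y then \<kappa> * sqrt x / sqrt (real (\<Prod>(symdiff A B))) * (D / 2) else 0) - x * Err))"
    unfolding power2_eq_square sum_product unfolding sum_distrib_left sum_subtractf [symmetric]
    by (intro sum.cong refl) (simp add: pair_weight_def r_def algebra_simps)
  also have "\<dots> \<le> (\<Sum>A\<in>S. \<Sum>B\<in>S. r A * r B * (\<Sum>n\<in>{1..nat \<lfloor>x\<rfloor>}. T (\<Prod>A * \<Prod>B * n)))"
    using r0 by (intro sum_mono mult_left_mono inner mult_nonneg_nonneg)
  also have "\<dots> = (\<Sum>d\<in>discs X. (R d)\<^sup>2 * Sx d)"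
    unfolding swap
  proof (intro sum.cong refl arg_cong2[where f = "(*)"])
    fix A B assume AB: "A \<in> S" "B \<in> S"
    have "(\<Sum>n\<in>{1..nat \<lfloor>x\<rfloor>}. T (\<Prod>A * \<Prod>B * n)) =
      (\<Sum>n\<in>{1..nat \<lfloor>x\<rfloor>}. \<Sum>d\<in>discs X. real_of_int (kronecker d (\<Prod>A * \<Prod>B)) * real_of_int (kronecker d n))"
    proof (intro sum.cong refl)
      fix n assume "n \<in> {1..nat \<lfloor>x\<rfloor>}"
      then have n: "n > 0" by simp
      have AB0: "\<Prod>A * \<Prod>B > 0" using pos[OF AB(1)] pos[OF AB(2)] by simp
      show "T (\<Prod>A * \<Prod>B * n) = (\<Sum>d\<in>discs X. real_of_int (kronecker d (\<Prod>A * \<Prod>B)) * real_of_int (kronecker d n))"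
        by (simp only: T_def disc_sum_def of_int_sum kronecker_mult[OF AB0 n] of_int_mult)
    qed
    also have "\<dots> = (\<Sum>d\<in>discs X. real_of_int (kronecker d (\<Prod>A * \<Prod>B)) * Sx d)"
      unfolding Sx_def by (subst sum.swap) (simp only: sum_distrib_left)
    finally show "(\<Sum>n\<in>{1..nat \<lfloor>x\<rfloor>}. T (\<Prod>A * \<Prod>B * n)) =
       (\<Sum>d\<in>discs X. real_of_int (kronecker d (\<Prod>A * \<Prod>B)) * Sx d)" .
  qed
  also have "\<dots> \<le> (\<Sum>d\<in>discs X. (R d)\<^sup>2 * M)"
    using M(2) by (intro sum_mono mult_left_mono) (auto simp: Sx_def)
  also have "\<dots> = M * (\<Sum>d\<in>discs X. (R d)\<^sup>2)" by (simp add: sum_distrib_left mult.commute)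
  also have "\<dots> \<le> M * (D * (\<Sum>A\<in>S. (r A)\<^sup>2) + Err * (\<Sum>A\<in>S. r A)\<^sup>2)"
    using upper M(1) by (intro mult_left_mono)
  finally show ?thesis unfolding D_def .
qed

section \<open>Choice of the resonator\<close>

lemma exp_minus_one_le: "exp t - 1 \<le> t * exp (t::real)"
proof -
  have "(1 - t) * exp t \<le> exp (- t) * exp t"
    using exp_ge_add_one_self[of "- t"] by (intro mult_right_mono) auto
  also have "\<dots> = 1" by (simp add: exp_minus)
  finally show ?thesis by (simp add: algebra_simps)
qed

text \<open>Rankin's exponent is \<open>\<delta> / ln L\<close>, so \<open>p powr \<alpha> \<le> exp
  (2 * K * \<delta>) \<le> 1 + \<eta>\<close> on all of \<open>P\<close>, and each tail product is a
  mild perturbation of the full Euler product. By \<open>t1\<close> and \<open>t2\<close> each tail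
  is at most 1/8 of it; there are three, for \<open>A\<close>, \<open>B\<close> and
  \<open>symdiff A B\<close>, so more than half survives.\<close>

lemma truncated_euler_product_ge:
  fixes L N Y \<eta> \<delta> :: real and K :: nat
  defines "P \<equiv> primes_between (nat \<lfloor>L ^ 2\<rfloor>) (nat \<lfloor>L ^ (2 * K)\<rfloor>)"
  defines "f \<equiv> \<lambda>p::nat. L / (sqrt p * ln p)"
  assumes \<eta>: "0 < \<eta>" "\<eta> \<le> 1" and \<delta>: "\<delta> > 0" "exp (2 * real K * \<delta>) \<le> 1 + \<eta>"
    and L: "L \<ge> 1" "ln L \<ge> 1" "1 / ln L \<le> \<eta>" and N: "N > 0" and Y: "Y > 0"
    and V1: "(\<Sum>p\<in>P. 1 / (real p * ln (real p))) \<le> (1 + \<eta>) / (2 * ln L)"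
      "(\<Sum>p\<in>P. 1 / (real p * ln (real p))) \<ge> (1 - \<eta>) / (2 * ln L)"
    and V0: "(\<Sum>p\<in>P. 1 / real p) \<le> real K + 1"
    and t1: "ln 8 \<le> \<delta> / ln L * (ln N - (1 + \<eta>) * ((1 + \<eta>) * L ^ 2 / (2 * ln L) + L * (real K + 1)))"
    and t2: "ln 8 \<le> \<delta> / ln L * (ln Y - (1 + \<eta>) * (2 * L * (real K + 1)))"
  shows "(\<Sum>A\<in>{A\<in>Pow P. real (\<Prod>A) \<le> N}. \<Sum>B\<in>{A\<in>Pow P. real (\<Prod>A) \<le> N}.
            if real (\<Prod>(symdiff A B)) \<le> Y then pair_weight f A B else 0) \<ge>
         (\<Prod>p\<in>P. 1 + (f p)\<^sup>2) * exp ((1 - \<eta>) ^ 3 * (L / ln L)) / 2"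
proof -
  define \<alpha> where "\<alpha> = \<delta> / ln L"
  have \<alpha>: "\<alpha> > 0" unfolding \<alpha>_def using \<delta>(1) L(2) by (intro divide_pos_pos) linarith+
  have L': "L > 1" using L(1,2) by (cases "L = 1") auto
  have P: "finite P" "\<And>p. p \<in> P \<Longrightarrow> prime p"
    by (auto simp: P_def primes_between_def)
  have pL: "L ^ 2 \<le> real p" "real p \<le> L ^ (2 * K)" if "p \<in> P" for p
  proof -
    have "L ^ 2 < real_of_int (\<lfloor>L ^ 2\<rfloor> + 1)" by linarith
    moreover have "\<lfloor>L ^ 2\<rfloor> < int p" using that by (auto simp: P_def primes_between_def nat_less_iff)
    ultimately show "L ^ 2 \<le> real p" by linarith
    have "int p \<le> \<lfloor>L ^ (2 * K)\<rfloor>" using that L(1) by (auto simp: P_def primes_between_def le_nat_iff)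
    then show "real p \<le> L ^ (2 * K)" by (simp add: le_floor_iff)
  qed
  have L2: "L ^ 2 \<ge> 1" using L(1) by simp
  have p1: "real p \<ge> 1" "real p > 0" if "p \<in> P" for p using pL(1)[OF that] L2 by linarith+
  have lnp: "2 * ln L \<le> ln (real p)" "ln (real p) \<le> 2 * real K * ln L" "ln (real p) > 0" if p: "p \<in> P" for p
  proof -
    have "ln (L ^ 2) \<le> ln (real p)" using pL(1)[OF p] p1[OF p] L by (subst ln_le_cancel_iff) auto
    then show 1: "2 * ln L \<le> ln (real p)" using L by (simp add: ln_realpow)
    have "ln (real p) \<le> ln (L ^ (2 * K))" using pL(2)[OF p] p1[OF p] L by (subst ln_le_cancel_iff) auto
    then show "ln (real p) \<le> 2 * real K * ln L" using L by (simp add: ln_realpow)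
    show "ln (real p) > 0" using 1 L by linarith
  qed
  have f0: "f p \<ge> 0" if "p \<in> P" for p
    unfolding f_def using lnp(3)[OF that] L by simp
  have fs: "f p / sqrt p = L * (1 / (real p * ln p))" if "p \<in> P" for p
  proof -
    have "f p / sqrt p = L / (sqrt p * sqrt p * ln p)" by (simp add: f_def mult_ac)
    then show ?thesis by simp
  qed
  have f2: "(f p)\<^sup>2 = L ^ 2 / (real p * (ln p)\<^sup>2)" for p
    by (simp add: f_def power_divide power_mult_distrib)
  have f2le: "(f p)\<^sup>2 \<le> \<eta>" if p: "p \<in> P" for p
  proof -
    have "(f p)\<^sup>2 = (L ^ 2 / real p) / (ln p)\<^sup>2" by (simp add: f2)
    also have "\<dots> \<le> 1 / (ln p)\<^sup>2"
      using pL(1)[OF p] p1[OF p] by (intro divide_right_mono) auto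
    also have "\<dots> \<le> 1 / (ln L)"
    proof (intro divide_left_mono)
      have "ln L * 1 \<le> ln p * ln p" using lnp(1)[OF p] L L' by (intro mult_mono) auto
      then show "ln L \<le> (ln p)\<^sup>2" by (simp add: power2_eq_square)
      show "0 < (ln p)\<^sup>2 * ln L" using lnp(3)[OF p] L' by (intro mult_pos_pos zero_less_power) auto
    qed simp
    finally show ?thesis using L by linarith
  qed
  have fsle: "2 * f p / sqrt p \<le> \<eta>" if p: "p \<in> P" for p
  proof -
    have "2 * f p / sqrt p = 2 * L / (real p * ln p)" using fs[OF p] by simp
    also have "\<dots> \<le> 2 * L / (L ^ 2 * (2 * ln L))"
      using pL(1)[OF p] p1[OF p] lnp(1,3)[OF p] L L' by (intro divide_left_mono mult_mono mult_pos_pos) auto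
    also have "\<dots> = 1 / (L * ln L)" using L' by (simp add: power2_eq_square)
    also have "\<dots> \<le> 1 / (1 * ln L)" using L' by (intro divide_left_mono mult_right_mono) auto
    finally show ?thesis using L by simp
  qed
  define Q where "Q = (\<Prod>p\<in>P. 1 + (f p)\<^sup>2 + 2 * f p / sqrt p)"
  have Q0: "Q \<ge> 0" unfolding Q_def using f0 by (intro prod_nonneg) (auto intro!: add_nonneg_nonneg)
  have pw: "0 \<le> p powr \<alpha> - 1" "p powr \<alpha> - 1 \<le> (1 + \<eta>) * \<alpha> * ln p" if p: "p \<in> P" for p :: nat
  proof -
    have e: "p powr \<alpha> = exp (\<alpha> * ln p)" using p1[OF p] by (simp add: powr_def)
    have t: "0 \<le> \<alpha> * ln p" using \<alpha> lnp(3)[OF p] by simp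
    then show "0 \<le> p powr \<alpha> - 1" unfolding e by simp
    have "\<alpha> * ln p \<le> \<alpha> * (2 * real K * ln L)" using \<alpha> lnp(2)[OF p] by (intro mult_left_mono) auto
    also have "\<dots> = 2 * real K * \<delta>" using L' by (simp add: \<alpha>_def)
    finally have "exp (\<alpha> * ln p) \<le> 1 + \<eta>" using \<delta>(2) by (meson exp_le_cancel_iff order_trans)
    then have "\<alpha> * ln p * exp (\<alpha> * ln p) \<le> \<alpha> * ln p * (1 + \<eta>)" using t by (intro mult_left_mono)
    then show "p powr \<alpha> - 1 \<le> (1 + \<eta>) * \<alpha> * ln p"
      unfolding e using exp_minus_one_le[of "\<alpha> * ln p"] by (simp add: mult_ac)
  qed
  have a1: "1 \<le> 1 + (f p)\<^sup>2 + 2 * f p / sqrt p" if "p \<in> P" for p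
  proof -
    have "0 \<le> 2 * f p / sqrt p" using f0[OF that] by simp
    then show ?thesis by (simp add: add_nonneg_nonneg)
  qed

  have "(\<Prod>p\<in>P. 1 + (f p)\<^sup>2 * p powr \<alpha> + f p * p powr \<alpha> / sqrt p + f p / sqrt p) =
    (\<Prod>p\<in>P. (1 + (f p)\<^sup>2 + 2 * f p / sqrt p) + (p powr \<alpha> - 1) * ((f p)\<^sup>2 + f p / sqrt p))"
    by (intro prod.cong refl) (simp add: algebra_simps diff_divide_distrib add_divide_distrib)
  also have "\<dots> \<le> Q * exp (\<Sum>p\<in>P. (p powr \<alpha> - 1) * ((f p)\<^sup>2 + f p / sqrt p))"
    unfolding Q_def using a1 pw(1) f0
    by (intro prod_perturb_le mult_nonneg_nonneg add_nonneg_nonneg divide_nonneg_nonneg) auto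
  also have "\<dots> \<le> Q * exp (\<alpha> * ln N - ln 8)"
  proof (intro mult_left_mono Q0)
    \<comment> \<open>Since \<open>p powr \<alpha> - 1\<close> is about
      \<open>\<alpha> * ln p\<close>, the two parts become \<open>L^2 / (p * ln p)\<close> and
      \<open>L / p\<close>: the first sums to about \<open>L^2 / (2 * ln L)\<close>, the expected
      logarithm of a resonator index, the second to at most \<open>L * (K + 1)\<close>.\<close>
    have "(\<Sum>p\<in>P. (p powr \<alpha> - 1) * ((f p)\<^sup>2 + f p / sqrt p)) \<le>
      (\<Sum>p\<in>P. (1 + \<eta>) * \<alpha> * (L ^ 2 * (1 / (real p * ln p)) + L * (1 / real p)))"
    proof (rule sum_mono)
      fix p assume p: "p \<in> P"
      have "(p powr \<alpha> - 1) * ((f p)\<^sup>2 + f p / sqrt p) \<le> ((1 + \<eta>) * \<alpha> * ln p) * ((f p)\<^sup>2 + f p / sqrt p)"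
        using f0[OF p] by (intro mult_right_mono pw p add_nonneg_nonneg) auto
      also have "\<dots> = (1 + \<eta>) * \<alpha> * (ln p * (f p)\<^sup>2 + ln p * (f p / sqrt p))" by (simp only: distrib_left mult.assoc)
      also have "ln p * (f p)\<^sup>2 = L ^ 2 * (1 / (real p * ln p))"
        unfolding f2 using lnp(3)[OF p] by (simp add: power2_eq_square)
      also have "ln p * (f p / sqrt p) = L * (1 / real p)"
        unfolding fs[OF p] using lnp(3)[OF p] by simp
      finally show "(p powr \<alpha> - 1) * ((f p)\<^sup>2 + f p / sqrt p) \<le>
        (1 + \<eta>) * \<alpha> * (L ^ 2 * (1 / (real p * ln p)) + L * (1 / real p))" .
    qed
    also have "\<dots> = (1 + \<eta>) * \<alpha> * (L ^ 2 * (\<Sum>p\<in>P. 1 / (real p * ln p)) + L * (\<Sum>p\<in>P. 1 / real p))"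
      by (simp only: sum_distrib_left sum.distrib distrib_left mult.assoc)
    also have "\<dots> \<le> (1 + \<eta>) * \<alpha> * (L ^ 2 * ((1 + \<eta>) / (2 * ln L)) + L * (real K + 1))"
      using \<eta> \<alpha> V1(1) V0 L by (intro mult_left_mono add_mono) auto
    also have "\<dots> = \<alpha> * ((1 + \<eta>) * ((1 + \<eta>) * L ^ 2 / (2 * ln L) + L * (real K + 1)))"
      by (simp add: mult_ac)
    also have "\<dots> \<le> \<alpha> * ln N - ln 8"
      using t1 unfolding \<alpha>_def [symmetric] right_diff_distrib by linarith
    finally show "exp (\<Sum>p\<in>P. (p powr \<alpha> - 1) * ((f p)\<^sup>2 + f p / sqrt p)) \<le> exp (\<alpha> * ln N - ln 8)"
      by simp
  qed
  finally have "N powr - \<alpha> * (\<Prod>p\<in>P. 1 + (f p)\<^sup>2 * p powr \<alpha> + f p * p powr \<alpha> / sqrt p + f p / sqrt p)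
    \<le> N powr - \<alpha> * (Q * exp (\<alpha> * ln N - ln 8))" by (intro mult_left_mono) auto
  also have "\<dots> = Q / 8" using N by (simp add: powr_def exp_minus exp_diff)
  finally have tail1: "N powr - \<alpha> * (\<Prod>p\<in>P. 1 + (f p)\<^sup>2 * p powr \<alpha> + f p * p powr \<alpha> / sqrt p + f p / sqrt p) \<le> Q / 8" .

  have "(\<Prod>p\<in>P. 1 + (f p)\<^sup>2 + 2 * f p * p powr \<alpha> / sqrt p) =
    (\<Prod>p\<in>P. (1 + (f p)\<^sup>2 + 2 * f p / sqrt p) + (p powr \<alpha> - 1) * (2 * f p / sqrt p))"
    by (intro prod.cong refl) (simp add: algebra_simps diff_divide_distrib)
  also have "\<dots> \<le> Q * exp (\<Sum>p\<in>P. (p powr \<alpha> - 1) * (2 * f p / sqrt p))"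
    unfolding Q_def using a1 pw(1) f0
    by (intro prod_perturb_le mult_nonneg_nonneg divide_nonneg_nonneg) auto
  also have "\<dots> \<le> Q * exp (\<alpha> * ln Y - ln 8)"
  proof (intro mult_left_mono Q0)
    have "(\<Sum>p\<in>P. (p powr \<alpha> - 1) * (2 * f p / sqrt p)) \<le> (\<Sum>p\<in>P. (1 + \<eta>) * \<alpha> * (2 * L * (1 / real p)))"
    proof (rule sum_mono)
      fix p assume p: "p \<in> P"
      have "(p powr \<alpha> - 1) * (2 * f p / sqrt p) \<le> ((1 + \<eta>) * \<alpha> * ln p) * (2 * f p / sqrt p)"
        using f0[OF p] by (intro mult_right_mono pw p) auto
      also have "\<dots> = (1 + \<eta>) * \<alpha> * (2 * (ln p * (f p / sqrt p)))" by simp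
      also have "ln p * (f p / sqrt p) = L * (1 / real p)"
        unfolding fs[OF p] using lnp(3)[OF p] by simp
      finally show "(p powr \<alpha> - 1) * (2 * f p / sqrt p) \<le> (1 + \<eta>) * \<alpha> * (2 * L * (1 / real p))"
        by (simp only: mult.assoc)
    qed
    also have "\<dots> = (1 + \<eta>) * \<alpha> * (2 * L * (\<Sum>p\<in>P. 1 / real p))"
      by (simp only: sum_distrib_left mult.assoc)
    also have "\<dots> \<le> (1 + \<eta>) * \<alpha> * (2 * L * (real K + 1))"
      using \<eta> \<alpha> V0 L by (intro mult_left_mono) auto
    also have "\<dots> = \<alpha> * ((1 + \<eta>) * (2 * L * (real K + 1)))" by (simp add: mult_ac)
    also have "\<dots> \<le> \<alpha> * ln Y - ln 8"
      using t2 unfolding \<alpha>_def [symmetric] right_diff_distrib by linarith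
    finally show "exp (\<Sum>p\<in>P. (p powr \<alpha> - 1) * (2 * f p / sqrt p)) \<le> exp (\<alpha> * ln Y - ln 8)" by simp
  qed
  finally have "Y powr - \<alpha> * (\<Prod>p\<in>P. 1 + (f p)\<^sup>2 + 2 * f p * p powr \<alpha> / sqrt p)
    \<le> Y powr - \<alpha> * (Q * exp (\<alpha> * ln Y - ln 8))" by (intro mult_left_mono) auto
  also have "\<dots> = Q / 8" using Y by (simp add: powr_def exp_minus exp_diff)
  finally have tail2: "Y powr - \<alpha> * (\<Prod>p\<in>P. 1 + (f p)\<^sup>2 + 2 * f p * p powr \<alpha> / sqrt p) \<le> Q / 8" .

  \<comment> \<open>Two factors \<open>1 - \<eta>\<close> come from the comparison of Euler
    products, the third from the prime sum, whose main term is
    \<open>1 / (2 * ln L)\<close>.\<close>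
  have "(1 - \<eta>) ^ 3 * (L / ln L) = (1 - \<eta>)\<^sup>2 * (2 * L * ((1 - \<eta>) / (2 * ln L)))"
    by (simp add: power3_eq_cube power2_eq_square)
  also have "\<dots> \<le> (1 - \<eta>)\<^sup>2 * (2 * L * (\<Sum>p\<in>P. 1 / (real p * ln (real p))))"
    using V1(2) L by (intro mult_left_mono) auto
  also have "2 * L * (\<Sum>p\<in>P. 1 / (real p * ln (real p))) = (\<Sum>p\<in>P. 2 * f p / sqrt p)"
    unfolding sum_distrib_left
  proof (intro sum.cong refl)
    fix p assume "p \<in> P"
    then show "2 * L * (1 / (real p * ln (real p))) = 2 * f p / sqrt p"
      using fs[of p] by (metis mult.assoc times_divide_eq_right)
  qed
  finally have "exp ((1 - \<eta>) ^ 3 * (L / ln L)) \<le> exp ((1 - \<eta>)\<^sup>2 * (\<Sum>p\<in>P. 2 * f p / sqrt p))" by simp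
  then have "(\<Prod>p\<in>P. 1 + (f p)\<^sup>2) * exp ((1 - \<eta>) ^ 3 * (L / ln L)) \<le>
     (\<Prod>p\<in>P. 1 + (f p)\<^sup>2) * exp ((1 - \<eta>)\<^sup>2 * (\<Sum>p\<in>P. 2 * f p / sqrt p))"
    by (intro mult_left_mono prod_nonneg) auto
  also have "\<dots> \<le> Q"
    unfolding Q_def using \<eta> f0 f2le fsle by (intro euler_product_ratio_ge) auto
  finally have "(\<Prod>p\<in>P. 1 + (f p)\<^sup>2) * exp ((1 - \<eta>) ^ 3 * (L / ln L)) / 2 \<le> Q - 2 * (Q / 8) - Q / 8"
    using Q0 by linarith
  also have "\<dots> \<le> Q - 2 * N powr - \<alpha> * (\<Prod>p\<in>P. 1 + (f p)\<^sup>2 * p powr \<alpha> + f p * p powr \<alpha> / sqrt p + f p / sqrt p)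
      - Y powr - \<alpha> * (\<Prod>p\<in>P. 1 + (f p)\<^sup>2 + 2 * f p * p powr \<alpha> / sqrt p)"
    using tail1 tail2 by linarith
  also have "\<dots> \<le> (\<Sum>A\<in>{A\<in>Pow P. real (\<Prod>A) \<le> N}. \<Sum>B\<in>{A\<in>Pow P. real (\<Prod>A) \<le> N}.
            if real (\<Prod>(symdiff A B)) \<le> Y then pair_weight f A B else 0)"
    unfolding Q_def by (rule truncated_pair_sum_ge[OF P f0 N Y \<alpha>])
  finally show ?thesis .
qed

text \<open>The resonance inequality with \<open>y = L^2\<close>, \<open>Y = sqrt x\<close> and
  \<open>\<kappa> = 1 / (C * ln x)\<close>, reduced to conditions that hold for large
  \<open>X\<close>. \<open>h_card\<close> limits the loss from coprimality, \<open>h_err\<close>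
  subordinates the off-diagonal terms, \<open>h_cnt\<close> makes room for the primes
  \<open>l\<close>, and \<open>h_fin\<close> turns the gain into \<open>exp s\<close>.\<close>

lemma char_sum_lower_bound:
  fixes X L N x \<eta> \<delta> C s M :: real and K :: nat
  defines "P \<equiv> primes_between (nat \<lfloor>L ^ 2\<rfloor>) (nat \<lfloor>L ^ (2 * K)\<rfloor>)"
  assumes X: "X \<ge> 1" and \<eta>: "0 < \<eta>" "\<eta> \<le> 1" and \<delta>: "\<delta> > 0" "exp (2 * real K * \<delta>) \<le> 1 + \<eta>"
    and L: "L \<ge> 2" "ln L \<ge> 1" "1 / ln L \<le> \<eta>" and N: "N \<ge> 1" and x: "x \<ge> 1"
    and V1: "(\<Sum>p\<in>P. 1 / (real p * ln (real p))) \<le> (1 + \<eta>) / (2 * ln L)"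
      "(\<Sum>p\<in>P. 1 / (real p * ln (real p))) \<ge> (1 - \<eta>) / (2 * ln L)"
    and V0: "(\<Sum>p\<in>P. 1 / real p) \<le> real K + 1"
    and t1: "ln 8 \<le> \<delta> / ln L * (ln N - (1 + \<eta>) * ((1 + \<eta>) * L ^ 2 / (2 * ln L) + L * (real K + 1)))"
    and t2: "ln 8 \<le> \<delta> / ln L * (ln (sqrt x) - (1 + \<eta>) * (2 * L * (real K + 1)))"
    and C: "C > 1" "\<And>y. y \<ge> C \<Longrightarrow> card {p::nat. prime p \<and> y / C < real p \<and> real p \<le> y} \<ge> y / (C * ln y)"
    and D: "real (card (discs X)) \<ge> X / 16"
    and h_card: "(2 * (ln N / (2 * ln L)) + 1) * (2 * X / L ^ 2) \<le> X / 32"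
    and h_err: "x * (16 * (N\<^sup>2 * x) * X powr (1/4) + 2 * X / X powr (1/4)) * N \<le> X / 16"
    and h_cnt: "C * L ^ 2 \<le> sqrt (sqrt x)"
    and h_fin: "8 * C * ln x * (exp s + 1) \<le> exp ((1 - \<eta>) ^ 3 * (L / ln L))"
    and M: "M \<ge> 0" "\<And>d. d \<in> discs X \<Longrightarrow> (\<Sum>n\<in>{1..nat \<lfloor>x\<rfloor>}. real_of_int (kronecker d n)) \<le> M"
  shows "sqrt x * exp s \<le> M"
proof -
  define f where "f = (\<lambda>p::nat. L / (sqrt p * ln p))"
  define S where "S = {A \<in> Pow P. real (\<Prod>A) \<le> N}"
  define Err where "Err = 16 * (N\<^sup>2 * x) * X powr (1/4) + 2 * X / X powr (1/4)"
  define W where "W = (\<Sum>A\<in>S. (\<Prod>p\<in>A. f p)\<^sup>2)"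
  define Wf where "Wf = (\<Prod>p\<in>P. 1 + (f p)\<^sup>2)"
  define R1 where "R1 = (\<Sum>A\<in>S. \<Prod>p\<in>A. f p)\<^sup>2"
  define Qt where "Qt = (\<Sum>A\<in>S. \<Sum>B\<in>S. if real (\<Prod>(symdiff A B)) \<le> sqrt x then pair_weight f A B else 0)"
  define Dc where "Dc = real (card (discs X))"
  define G where "G = exp ((1 - \<eta>) ^ 3 * (L / ln L))"
  have P: "finite P" "\<And>p. p \<in> P \<Longrightarrow> prime p"
    by (auto simp: P_def primes_between_def)
  have L2: "L ^ 2 \<ge> 4"
  proof -
    have "2 * 2 \<le> L * L" using L(1) by (intro mult_mono) auto
    then show ?thesis by (simp add: power2_eq_square)
  qed
  have pL: "L ^ 2 \<le> real p" if "p \<in> P" for p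
  proof -
    have "L ^ 2 < real_of_int (\<lfloor>L ^ 2\<rfloor> + 1)" by linarith
    moreover have "\<lfloor>L ^ 2\<rfloor> < int p" using that by (auto simp: P_def primes_between_def nat_less_iff)
    ultimately show "L ^ 2 \<le> real p" by linarith
  qed
  have p2: "p \<noteq> 2" if "p \<in> P" for p using pL[OF that] L2 by auto
  have lnp: "2 * ln L \<le> ln (real p)" if p: "p \<in> P" for p
  proof -
    have "ln (L ^ 2) \<le> ln (real p)" using pL[OF p] L2 L by (subst ln_le_cancel_iff) auto
    then show ?thesis using L by (simp add: ln_realpow)
  qed
  have f0: "f p \<ge> 0" if "p \<in> P" for p
    unfolding f_def using lnp[OF that] L by simp
  have SP: "A \<subseteq> P" "finite A" "real (\<Prod>A) \<le> N" if "A \<in> S" for A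
    using that P(1) finite_subset by (auto simp: S_def)
  have ge1: "\<Prod>A \<ge> 1" if "A \<subseteq> P" for A
  proof -
    have "\<Prod>A > 0" using that P(2) by (intro prod_pos) (meson prime_gt_0_nat subsetD)
    then show ?thesis by simp
  qed
  have lnx: "ln x > 0"
  proof -
    have "1 * L ^ 2 \<le> C * L ^ 2" using C(1) L2 by (intro mult_right_mono) auto
    then have "sqrt (sqrt x) > 1" using h_cnt L2 by linarith
    then have "x > 1" by simp
    then show ?thesis by simp
  qed
  have Err0: "Err \<ge> 0" unfolding Err_def using X x by simp
  have Q: "Qt \<ge> Wf * G / 2"
    unfolding Qt_def S_def Wf_def G_def f_def P_def
  proof (rule truncated_euler_product_ge[OF \<eta> \<delta>])
    show "ln 8 \<le> \<delta> / ln L * (ln (sqrt x) - (1 + \<eta>) * (2 * L * (real K + 1)))" by (rule t2)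
    show "ln 8 \<le> \<delta> / ln L * (ln N - (1 + \<eta>) * ((1 + \<eta>) * L ^ 2 / (2 * ln L) + L * (real K + 1)))" by (rule t1)
  qed (use L N x V1 V0 in \<open>auto simp: P_def\<close>)
  have res: "1 / (C * ln x) * sqrt x * (Dc / 2) * Qt - x * Err * R1 \<le> M * (Dc * W + Err * R1)"
    unfolding Dc_def Qt_def R1_def W_def S_def
  proof (rule resonance_inequality[OF X P p2 pL f0])
    show "\<bar>real_of_int (disc_sum X k)\<bar> \<le> Err"
      if k: "k > 0" "real k \<le> N\<^sup>2 * x" and p: "prime p" "p \<noteq> 2" "odd (multiplicity p k)" for k p
    proof -
      \<comment> \<open>The cut between small and large square divisors; rounding up at most doubles
        \<open>X powr (1/4)\<close>, whence the 16 in \<open>Err\<close>.\<close>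
      define A0 where "A0 = nat \<lceil>X powr (1/4)\<rceil>"
      have X4: "X powr (1/4) \<ge> 1" using X by (simp add: ge_one_powr_ge_zero)
      have A0: "A0 \<ge> 1" "X powr (1/4) \<le> real A0" "real A0 \<le> 2 * X powr (1/4)"
        using X4 unfolding A0_def by linarith+
      have "\<bar>real_of_int (disc_sum X k)\<bar> \<le> 8 * real k * real A0 + 2 * X / real A0"
        by (rule disc_sum_bound[OF X k(1) p A0(1)])
      also have "\<dots> \<le> 8 * (N\<^sup>2 * x) * (2 * X powr (1/4)) + 2 * X / X powr (1/4)"
      proof (rule add_mono)
        have "8 * real k * real A0 \<le> (8 * real k) * (2 * X powr (1/4))"
          using A0(3) by (intro mult_left_mono) auto
        also have "\<dots> \<le> (8 * (N\<^sup>2 * x)) * (2 * X powr (1/4))"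
          using k(2) by (intro mult_right_mono) auto
        finally show "8 * real k * real A0 \<le> 8 * (N\<^sup>2 * x) * (2 * X powr (1/4))" .
        show "2 * X / real A0 \<le> 2 * X / X powr (1/4)"
          using A0 X X4 by (intro frac_le) linarith+
      qed
      finally show ?thesis by (simp add: Err_def)
    qed
    show "real (card A) \<le> ln N / (2 * ln L)" if "A \<in> {A \<in> Pow P. real (\<Prod>A) \<le> N}" for A
    proof -
      have A: "A \<subseteq> P" "finite A" "real (\<Prod>A) \<le> N" using SP[of A] that by (auto simp: S_def)
      have "real (card A) * (2 * ln L) = (\<Sum>p\<in>A. 2 * ln L)" by simp
      also have "\<dots> \<le> (\<Sum>p\<in>A. ln (real p))" using A(1) lnp by (intro sum_mono) auto
      also have "\<dots> = ln (\<Prod>p\<in>A. real p)"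
      proof (intro ln_prod [symmetric])
        fix p assume "p \<in> A"
        then have "p > 0" using A(1) P(2) prime_gt_0_nat by blast
        then show "real p \<noteq> 0" by simp
      qed (use A(2) in auto)
      also have "(\<Prod>p\<in>A. real p) = real (\<Prod>A)" by simp
      also have "ln (real (\<Prod>A)) \<le> ln N"
        using A(3) ge1[OF A(1)] N by (subst ln_le_cancel_iff) linarith+
      finally show ?thesis using L by (simp add: field_simps)
    qed
    show "(2 * (ln N / (2 * ln L)) + 1) * (2 * X / L ^ 2) \<le> real (card (discs X)) / 2"
      using h_card D by linarith
    show "1 / (C * ln x) * sqrt x / sqrt (real (\<Prod>(symdiff A B))) \<le>
        card {l. prime l \<and> L ^ 2 \<le> real l \<and> real (\<Prod>(symdiff A B)) * (real l)\<^sup>2 \<le> x}"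
      if "A \<in> {A \<in> Pow P. real (\<Prod>A) \<le> N}" "B \<in> {A \<in> Pow P. real (\<Prod>A) \<le> N}"
        "real (\<Prod>(symdiff A B)) \<le> sqrt x" for A B
    proof -
      define m where "m = real (\<Prod>(symdiff A B))"
      have "symdiff A B \<subseteq> P" using that by (intro symdiff_subset) auto
      from ge1[OF this] have m1: "m \<ge> 1" unfolding m_def by linarith
      \<comment> \<open>The largest size allowed for \<open>l\<close>. As
        \<open>m \<le> sqrt x\<close>, it is at least the fourth root of \<open>x\<close>, hence at
        least \<open>C * L^2\<close> by \<open>h_cnt\<close>, and the window from \<open>v/C\<close>
        to \<open>v\<close> lies above \<open>L^2\<close>.\<close>
      define v where "v = sqrt x / sqrt m"
      have v2: "m * v\<^sup>2 = x" using m1 x by (simp add: v_def power_divide)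
      have "sqrt (sqrt x) * sqrt m \<le> sqrt (sqrt x) * sqrt (sqrt x)"
        using that(3) x unfolding m_def by (intro mult_left_mono) auto
      also have "\<dots> = sqrt x" using x by simp
      finally have "sqrt (sqrt x) \<le> v" unfolding v_def using m1 by (simp add: field_simps)
      then have vC: "C * L ^ 2 \<le> v" using h_cnt by linarith
      have "C * 1 \<le> C * L ^ 2" using C(1) L2 by (intro mult_left_mono) auto
      then have "v \<ge> C" using vC by linarith
      have vx: "v \<le> x"
      proof -
        have "v \<le> sqrt x / 1" unfolding v_def using m1 x by (intro divide_left_mono) auto
        also have "sqrt x * 1 \<le> sqrt x * sqrt x" using x by (intro mult_left_mono) auto
        then have "sqrt x / 1 \<le> x" using x by simp
        finally show ?thesis .
      qed
      define Ls where "Ls = {l. prime l \<and> L ^ 2 \<le> real l \<and> m * (real l)\<^sup>2 \<le> x}"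
      have "finite Ls"
      proof (rule finite_subset)
        show "Ls \<subseteq> {..nat \<lfloor>x\<rfloor>}"
        proof
          fix l assume l: "l \<in> Ls"
          then have "real l \<ge> 1" using L2 by (auto simp: Ls_def)
          then have "1 * real l \<le> m * (real l)\<^sup>2"
            using m1 by (intro mult_mono) (auto simp: power2_eq_square)
          then have "real l \<le> x" using l by (simp add: Ls_def)
          then show "l \<in> {..nat \<lfloor>x\<rfloor>}" by (simp add: le_nat_floor)
        qed
      qed simp
      moreover have "{p::nat. prime p \<and> v / C < real p \<and> real p \<le> v} \<subseteq> Ls"
      proof
        fix l assume "l \<in> {p::nat. prime p \<and> v / C < real p \<and> real p \<le> v}"
        then have l: "prime l" "v / C < real l" "real l \<le> v" by auto
        have "L ^ 2 \<le> v / C" using vC C(1) by (simp add: field_simps)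
        moreover have "m * (real l)\<^sup>2 \<le> m * v\<^sup>2" using l(3) m1 by (intro mult_left_mono power_mono) auto
        ultimately show "l \<in> Ls" using l v2 by (simp add: Ls_def)
      qed
      ultimately have "card {p::nat. prime p \<and> v / C < real p \<and> real p \<le> v} \<le> card Ls"
        by (rule card_mono)
      then have "v / (C * ln v) \<le> real (card Ls)" using C(2)[OF \<open>v \<ge> C\<close>] by linarith
      moreover have "v / (C * ln x) \<le> v / (C * ln v)"
      proof -
        have "ln v > 0" using \<open>v \<ge> C\<close> C(1) by simp
        moreover have "ln v \<le> ln x" using vx \<open>v \<ge> C\<close> C(1) by (subst ln_le_cancel_iff) auto
        ultimately show ?thesis
          using C(1) \<open>v \<ge> C\<close> lnx by (intro divide_left_mono mult_left_mono mult_pos_pos) auto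
      qed
      ultimately show ?thesis unfolding m_def [symmetric] Ls_def [symmetric] by (simp add: v_def mult_ac)
    qed
  qed (use N x L2 C lnx M Err0 in auto)
  have W1: "W \<ge> 1"
  proof -
    have "{} \<in> S" using N by (simp add: S_def)
    then have "(\<Prod>p\<in>{}. f p)\<^sup>2 \<le> W"
      unfolding W_def using P(1) by (intro member_le_sum) (auto simp: S_def)
    then show ?thesis by simp
  qed
  have WWf: "W \<le> Wf" unfolding W_def Wf_def S_def by (rule resonator_norm_le[OF P(1)])
  have R1: "R1 \<le> N * W" unfolding R1_def W_def S_def using P N by (intro resonator_sum_squared_le) auto
  have R10: "R1 \<ge> 0" unfolding R1_def by simp
  have Dc: "Dc \<ge> X / 16" "Dc > 0" using D X by (auto simp: Dc_def)
  have xER: "x * Err * R1 \<le> Dc * W"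
  proof -
    have "x * Err * R1 \<le> x * Err * (N * W)" using R1 x Err0 by (intro mult_left_mono) auto
    also have "\<dots> = (x * Err * N) * W" by simp
    also have "\<dots> \<le> X / 16 * W" using h_err W1 unfolding Err_def by (intro mult_right_mono) auto
    also have "\<dots> \<le> Dc * W" using Dc W1 by (intro mult_right_mono) auto
    finally show ?thesis .
  qed
  have "1 * (Err * R1) \<le> x * (Err * R1)" using x Err0 R10 by (intro mult_right_mono) auto
  then have ER: "Err * R1 \<le> Dc * W" using xER by (simp add: mult.assoc)
  \<comment> \<open>Both off-diagonal contributions are absorbed by the diagonal
    \<open>Dc * W\<close>, at the price of \<open>1 + 2 * M\<close> in place of
    \<open>M\<close>.\<close>
  have "1 / (C * ln x) * sqrt x * (Dc / 2) * Qt \<le> Dc * W + M * (Dc * W + Dc * W)"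
  proof -
    have "M * (Dc * W + Err * R1) \<le> M * (Dc * W + Dc * W)" using ER M(1) by (intro mult_left_mono) auto
    then show ?thesis using res xER by linarith
  qed
  also have "\<dots> = Dc * ((1 + 2 * M) * W)" by (simp add: algebra_simps)
  finally have "Dc * (1 / (C * ln x) * sqrt x / 2 * Qt) \<le> Dc * ((1 + 2 * M) * W)" by (simp add: mult_ac)
  then have 1: "1 / (C * ln x) * sqrt x / 2 * Qt \<le> (1 + 2 * M) * W"
    using Dc(2) by (rule mult_left_le_imp_le)
  have "1 / (C * ln x) * sqrt x / 2 * (Wf * G / 2) \<le> 1 / (C * ln x) * sqrt x / 2 * Qt"
    using Q C lnx x by (intro mult_left_mono) auto
  also note 1
  also have "(1 + 2 * M) * W \<le> (1 + 2 * M) * Wf" using WWf M(1) by (intro mult_left_mono) auto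
  finally have "Wf * (1 / (C * ln x) * sqrt x / 4 * G) \<le> Wf * (1 + 2 * M)" by (simp add: mult_ac)
  then have "1 / (C * ln x) * sqrt x / 4 * G \<le> 1 + 2 * M"
    by (rule mult_left_le_imp_le) (use WWf W1 in simp)
  \<comment> \<open>The 8 in \<open>h_fin\<close> cancels the 1/4 up to a factor 2, matching
    \<open>2 * M\<close>; the summand 1 beside \<open>exp s\<close> yields
    \<open>2 * sqrt x\<close>, which outweighs the stray 1 on the right.\<close>
  moreover have "2 * sqrt x * (exp s + 1) = 1 / (C * ln x) * sqrt x / 4 * (8 * C * ln x * (exp s + 1))"
    using C(1) lnx by simp
  moreover have "\<dots> \<le> 1 / (C * ln x) * sqrt x / 4 * G"
    unfolding G_def using h_fin C(1) lnx x by (intro mult_left_mono) auto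
  ultimately have "2 * sqrt x * (exp s + 1) \<le> 1 + 2 * M" by linarith
  moreover have "2 * sqrt x * (exp s + 1) = 2 * (sqrt x * exp s) + 2 * sqrt x" by (simp add: algebra_simps)
  moreover have "sqrt x \<ge> 1" using x by simp
  ultimately show ?thesis by linarith
qed

section \<open>Asymptotics\<close>

text \<open>As \<open>ln L\<close> is about \<open>ln (ln X) / 2\<close>,
  \<open>L^2 / (2 * ln L)\<close> is about \<open>(c/2)^2 * ln X\<close>, and the term linear in
  \<open>L\<close> disappears. The limit is to be compared with
  \<open>ln N / ln X = c/4\<close>.\<close>

lemma resonator_size_asymp:
  fixes c a k :: real
  assumes "c > 0" "a > 0" "k > 0"
  shows "((\<lambda>X. a * (a * (c / 2 * sqrt (ln X * ln (ln X))) ^ 2 / (2 * ln (c / 2 * sqrt (ln X * ln (ln X))))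
     + c / 2 * sqrt (ln X * ln (ln X)) * k) / ln X) \<longlongrightarrow> a * (a * (c / 2)\<^sup>2)) at_top"
  using assms by real_asymp

text \<open>\<open>L / ln L\<close> is about \<open>c * sqrt (ln X / ln (ln X))\<close>, while the
  logarithm of \<open>8 * C * ln x\<close> has only the order of \<open>ln (ln X)\<close>.\<close>

lemma resonator_gain_asymp:
  fixes c b C :: real
  assumes "c > 0" "b > 0" "C > 0"
  shows "((\<lambda>X. (b * ((c / 2 * sqrt (ln X * ln (ln X))) / ln (c / 2 * sqrt (ln X * ln (ln X))))
     - ln (8 * C * (4 * sqrt (ln X * ln (ln X)) * ln (ln (ln X)))) - 1) / sqrt (ln X / ln (ln X))) \<longlongrightarrow> b * c) at_top"
  using assms by real_asymp

text \<open>The first inequality keeps the expected resonator index below \<open>N\<close> and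
  reserves a share \<open>\<eta>\<close> of \<open>ln N\<close> to beat \<open>ln 8\<close>; the
  second keeps the gain above \<open>c0\<close>. For any \<open>c\<close> strictly between
  \<open>c0\<close> and 1 both hold once \<open>\<eta>\<close> is small; the midpoint is
  taken.\<close>

lemma resonance_parameters:
  fixes c0 :: real
  assumes "0 < c0" "c0 < 1"
  obtains c \<eta> :: real where "0 < c" "c < 1" "0 < \<eta>" "\<eta> < 1" "(1 + \<eta>)\<^sup>2 * c < 1 - \<eta>" "(1 - \<eta>) ^ 3 * c > c0"
proof -
  define c where "c = (1 + c0) / 2"
  have c: "0 < c" "c < 1" "c > c0" using assms by (auto simp: c_def)
  have "((\<lambda>\<eta>::real. (1 + \<eta>)\<^sup>2 * c - (1 - \<eta>)) \<longlongrightarrow> (1 + 0)\<^sup>2 * c - (1 - 0)) (at_right 0)"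
    by (intro tendsto_intros)
  then have 1: "\<forall>\<^sub>F \<eta> in at_right 0. (1 + \<eta>)\<^sup>2 * c - (1 - \<eta>) < 0"
    using c by (intro order_tendstoD) auto
  have "((\<lambda>\<eta>::real. (1 - \<eta>) ^ 3 * c) \<longlongrightarrow> (1 - 0) ^ 3 * c) (at_right 0)"
    by (intro tendsto_intros)
  then have 2: "\<forall>\<^sub>F \<eta> in at_right 0. (1 - \<eta>) ^ 3 * c > c0"
    using c by (intro order_tendstoD) auto
  have 3: "\<forall>\<^sub>F \<eta> in at_right 0. \<eta> \<in> {0<..<1::real}" by (rule eventually_at_right_real) simp
  have "\<forall>\<^sub>F \<eta> in at_right 0. (1 + \<eta>)\<^sup>2 * c < 1 - \<eta> \<and> (1 - \<eta>) ^ 3 * c > c0 \<and> \<eta> \<in> {0<..<1}"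
    using 1 2 3 by eventually_elim auto
  then obtain \<eta> where "(1 + \<eta>)\<^sup>2 * c < 1 - \<eta> \<and> (1 - \<eta>) ^ 3 * c > c0 \<and> \<eta> \<in> {0<..<1}"
    using eventually_happens trivial_limit_at_right_real by blast
  then show ?thesis using that c by auto
qed

text \<open>The two parts of the error carry the exponents \<open>(3*c + 1)/4\<close> and
  \<open>(3 + c)/4\<close> of \<open>X\<close>, both below 1 exactly when \<open>c < 1\<close>. The
  number 288 is 16 times the combined coefficient 16 + 2, and \<open>2 * ln x\<close> stands for the
  factor \<open>x^2\<close>.\<close>

lemma error_term_small:
  fixes X x c :: real
  assumes X: "X \<ge> 1" and x: "x \<ge> 1" and c: "c \<le> 1"
    and h: "ln 288 + 2 * ln x \<le> (1 - c) / 4 * ln X"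
  shows "x * (16 * ((X powr (c/4))\<^sup>2 * x) * X powr (1/4) + 2 * X / X powr (1/4)) * X powr (c/4) \<le> X / 16"
proof -
  define u where "u = X powr ((3 + c) / 4)"
  have a: "(X powr (c/4))\<^sup>2 * X powr (1/4) * X powr (c/4) = X powr ((3 * c + 1) / 4)"
    by (simp add: power2_eq_square powr_add [symmetric] field_simps)
  have "X powr ((3 * c + 1) / 4) \<le> u" unfolding u_def using X c by (intro powr_mono) auto
  with a have a': "(X powr (c/4))\<^sup>2 * X powr (1/4) * X powr (c/4) \<le> u" by simp
  have b: "X / X powr (1/4) * X powr (c/4) = u"
  proof -
    have "X / X powr (1/4) * X powr (c/4) = X powr 1 / X powr (1/4) * X powr (c/4)" using X by simp
    also have "\<dots> = X powr (1 - 1/4 + c/4)" by (simp only: powr_diff powr_add)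
    also have "1 - 1/4 + c/4 = (3 + c) / 4" by simp
    finally show ?thesis by (simp add: u_def)
  qed
  have "x * (16 * ((X powr (c/4))\<^sup>2 * x) * X powr (1/4) + 2 * X / X powr (1/4)) * X powr (c/4) =
     16 * x\<^sup>2 * ((X powr (c/4))\<^sup>2 * X powr (1/4) * X powr (c/4)) + 2 * x * (X / X powr (1/4) * X powr (c/4))"
    by (simp add: power2_eq_square algebra_simps)
  also have "\<dots> \<le> 16 * x\<^sup>2 * u + 2 * x\<^sup>2 * u"
  proof (intro add_mono mult_left_mono a')
    have "2 * x \<le> 2 * x\<^sup>2" using x by (simp add: power2_eq_square)
    then show "2 * x * (X / X powr (1/4) * X powr (c/4)) \<le> 2 * x\<^sup>2 * u"
      unfolding b by (intro mult_right_mono) (auto simp: u_def)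
  qed simp
  also have "\<dots> = 288 * x\<^sup>2 * u / 16" by simp
  also have "\<dots> \<le> X / 16"
  proof (intro divide_right_mono)
    have "288 * x\<^sup>2 * u = exp (ln 288 + 2 * ln x + (3 + c) / 4 * ln X)"
    proof -
      have "exp (2 * ln x) = x\<^sup>2" using x by (simp add: exp_double)
      then show ?thesis using X by (simp add: exp_add u_def powr_def)
    qed
    also have "\<dots> \<le> exp (ln X)" unfolding exp_le_cancel_iff using h by (simp add: field_simps)
    also have "\<dots> = X" using X by simp
    finally show "288 * x\<^sup>2 * u \<le> X" .
  qed simp
  finally show ?thesis .
qed

section \<open>All fundamental discriminants, and the bound for a fixed constant below 1\<close>

definition fund_discs :: "real \<Rightarrow> int set" where
  "fund_discs X = {d. X < real_of_int d \<and> real_of_int d \<le> 2 * X \<and> fundamental_discriminant d}"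

lemma finite_fund_discs: "finite (fund_discs X)"
  by (rule finite_subset[of _ "{\<lfloor>X\<rfloor>..\<lfloor>2 * X\<rfloor>}"])
    (auto simp: fund_discs_def le_floor_iff floor_le_iff)

lemma discs_subset_fund_discs: "X \<ge> 1 \<Longrightarrow> discs X \<subseteq> fund_discs X"
proof
  fix d assume "X \<ge> 1" "d \<in> discs X"
  then have d: "X < real_of_int d" "real_of_int d \<le> 2 * X" "d mod 8 = 1" "squarefree d" "d \<noteq> 1"
    by (auto simp: discs_def)
  have "d mod 4 = 1" using d(3) by presburger
  then show "d \<in> fund_discs X" using d by (simp add: fund_discs_def fundamental_discriminant_def)
qed

lemma max_char_sum_eventually_ge:
  fixes c0 :: real
  assumes "0 < c0" "c0 < 1"
  shows "\<forall>\<^sub>F X in at_top.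
       sqrt (exp (4 * sqrt (ln X * ln (ln X)) * ln (ln (ln X)))) * exp (c0 * sqrt (ln X / ln (ln X))) \<le>
       Max ((\<lambda>d. \<Sum>n\<in>{1..nat \<lfloor>exp (4 * sqrt (ln X * ln (ln X)) * ln (ln (ln X)))\<rfloor>}. real_of_int (kronecker d n)) `
              fund_discs X)"
proof -
  obtain c \<eta> where c: "0 < c" "c < 1" and \<eta>: "0 < \<eta>" "\<eta> < 1" and
    ce: "(1 + \<eta>)\<^sup>2 * c < 1 - \<eta>" "(1 - \<eta>) ^ 3 * c > c0"
    using resonance_parameters[OF assms] by blast
  obtain K where K: "K \<ge> 1" and evP: "\<forall>\<^sub>F L :: real in at_top.
    (let P = primes_between (nat \<lfloor>L ^ 2\<rfloor>) (nat \<lfloor>L ^ (2 * K)\<rfloor>) in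
      (\<Sum>p\<in>P. 1 / (real p * ln (real p))) \<le> (1 + \<eta>) / (2 * ln L) \<and>
      (\<Sum>p\<in>P. 1 / (real p * ln (real p))) \<ge> (1 - \<eta>) / (2 * ln L) \<and>
      (\<Sum>p\<in>P. 1 / real p) \<le> real K + 1)"
    using prime_sums_range[OF \<eta>(1)] by blast
  obtain C where C: "C > 1" "\<And>y. y \<ge> C \<Longrightarrow> card {p::nat. prime p \<and> y / C < real p \<and> real p \<le> y} \<ge> y / (C * ln y)"
    using prime_count_lower by blast
  \<comment> \<open>Chosen so that \<open>exp (2 * K * \<delta>) = 1 + \<eta>\<close>, which is the
    value of \<open>p powr \<alpha>\<close> at the upper end \<open>L^(2*K)\<close> of the
    primes.\<close>
  define \<delta> where "\<delta> = ln (1 + \<eta>) / (2 * real K)"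
  have \<delta>: "\<delta> > 0" "exp (2 * real K * \<delta>) \<le> 1 + \<eta>"
    using \<eta> K by (auto simp: \<delta>_def)
  define L where "L = (\<lambda>X. c / 2 * sqrt (ln X * ln (ln X)))"
  define x where "x = (\<lambda>X. exp (4 * sqrt (ln X * ln (ln X)) * ln (ln (ln X))))"
  have Llim: "filterlim L at_top at_top" unfolding L_def using c(1) by real_asymp
  have eP: "\<forall>\<^sub>F X in at_top. (let P = primes_between (nat \<lfloor>L X ^ 2\<rfloor>) (nat \<lfloor>L X ^ (2 * K)\<rfloor>) in
      (\<Sum>p\<in>P. 1 / (real p * ln (real p))) \<le> (1 + \<eta>) / (2 * ln (L X)) \<and>
      (\<Sum>p\<in>P. 1 / (real p * ln (real p))) \<ge> (1 - \<eta>) / (2 * ln (L X)) \<and>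
      (\<Sum>p\<in>P. 1 / real p) \<le> real K + 1)"
    by (rule eventually_compose_filterlim[OF evP Llim])
  have eL: "\<forall>\<^sub>F X in at_top. L X \<ge> exp (max 1 (1 / \<eta>))"
    using Llim by (simp add: filterlim_at_top)
  have eX: "\<forall>\<^sub>F X :: real in at_top. X \<ge> 1" by (rule eventually_ge_at_top)
  have ex: "\<forall>\<^sub>F X :: real in at_top. 4 * sqrt (ln X * ln (ln X)) * ln (ln (ln X)) \<ge> 1"
    by real_asymp
  have es: "\<forall>\<^sub>F X :: real in at_top. sqrt (ln X / ln (ln X)) > 0" by real_asymp
  have et1a: "\<forall>\<^sub>F X in at_top. (1 + \<eta>) * ((1 + \<eta>) * L X ^ 2 / (2 * ln (L X)) + L X * (real K + 1)) / ln X < (1 - \<eta>) * c / 4"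
  proof (rule order_tendstoD(2))
    show "((\<lambda>X. (1 + \<eta>) * ((1 + \<eta>) * L X ^ 2 / (2 * ln (L X)) + L X * (real K + 1)) / ln X) \<longlongrightarrow> (1 + \<eta>) * ((1 + \<eta>) * (c / 2)\<^sup>2)) at_top"
      unfolding L_def using c \<eta> by (intro resonator_size_asymp) auto
    have "(1 + \<eta>)\<^sup>2 * c * c < (1 - \<eta>) * c" using ce(1) c by (intro mult_strict_right_mono) auto
    then show "(1 + \<eta>) * ((1 + \<eta>) * (c / 2)\<^sup>2) < (1 - \<eta>) * c / 4"
      by (simp add: power2_eq_square mult.assoc)
  qed
  have et1b: "\<forall>\<^sub>F X in at_top. \<delta> * (\<eta> * c / 4 * ln X) / ln (L X) \<ge> ln 8"
  proof -
    have "filterlim (\<lambda>X. \<delta> * (b * ln X) / ln (c / 2 * sqrt (ln X * ln (ln X)))) at_top at_top"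
      if "b > 0" for b :: real using that c(1) \<delta>(1) by real_asymp
    then have "filterlim (\<lambda>X. \<delta> * (\<eta> * c / 4 * ln X) / ln (L X)) at_top at_top"
      unfolding L_def using \<eta>(1) c(1) by (meson divide_pos_pos mult_pos_pos zero_less_numeral)
    then show ?thesis by (rule filterlim_at_top[THEN iffD1, rule_format])
  qed
  \<comment> \<open>The factor \<open>ln (ln (ln X))\<close> decides here: \<open>L\<close> has the
    order of \<open>sqrt (ln X * ln (ln X))\<close> and \<open>K\<close> grows as
    \<open>\<eta>\<close> shrinks, so an unbounded factor in \<open>ln x\<close> wins for every
    choice of \<open>\<eta>\<close>.\<close>
  have et2: "\<forall>\<^sub>F X in at_top. ln 8 \<le> \<delta> / ln (L X) * (2 * sqrt (ln X * ln (ln X)) * ln (ln (ln X)) - (1 + \<eta>) * (2 * L X * (real K + 1)))"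
  proof -
    have "filterlim (\<lambda>X. \<delta> / ln (c / 2 * sqrt (ln X * ln (ln X))) *
       (2 * sqrt (ln X * ln (ln X)) * ln (ln (ln X)) - a * (2 * (c / 2 * sqrt (ln X * ln (ln X))) * k))) at_top at_top"
      if "a > 0" "k > 0" for a k :: real using that c(1) \<delta>(1) by real_asymp
    from this[of "1 + \<eta>" "real K + 1"] show ?thesis
      unfolding L_def using \<eta> by (simp add: filterlim_at_top)
  qed
  have eD: "\<forall>\<^sub>F X :: real in at_top. X / 16 \<le> 3 / 32 * X - 2 * sqrt (2 * X) - 2"
    by real_asymp
  have eC: "\<forall>\<^sub>F X in at_top. (2 * (c / 4 * ln X / (2 * ln (L X))) + 1) * (2 / L X ^ 2) < 1 / 32"
  proof (rule order_tendstoD(2))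
    show "((\<lambda>X. (2 * (c / 4 * ln X / (2 * ln (L X))) + 1) * (2 / L X ^ 2)) \<longlongrightarrow> 0) at_top"
      unfolding L_def using c(1) by real_asymp
  qed simp
  have eE: "\<forall>\<^sub>F X in at_top. ln 288 + 2 * (4 * sqrt (ln X * ln (ln X)) * ln (ln (ln X))) \<le> (1 - c) / 4 * ln X"
  proof -
    have "\<forall>\<^sub>F X in at_top. ln 288 + 2 * (4 * sqrt (ln X * ln (ln X)) * ln (ln (ln X))) \<le> e * ln X"
      if "e > 0" for e :: real using that by real_asymp
    from this[of "(1 - c) / 4"] show ?thesis using c(2) by (simp only: diff_gt_0_iff_gt zero_less_divide_iff zero_less_numeral simp_thms)
  qed
  have eN: "\<forall>\<^sub>F X in at_top. C * L X ^ 2 \<le> exp (sqrt (ln X * ln (ln X)) * ln (ln (ln X)))"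
    unfolding L_def using c(1) C(1) by real_asymp
  have eF: "\<forall>\<^sub>F X in at_top. ((1 - \<eta>) ^ 3 * (L X / ln (L X)) - ln (8 * C * (4 * sqrt (ln X * ln (ln X)) * ln (ln (ln X)))) - 1)
      / sqrt (ln X / ln (ln X)) > c0"
  proof (rule order_tendstoD(1))
    show "((\<lambda>X. ((1 - \<eta>) ^ 3 * (L X / ln (L X)) - ln (8 * C * (4 * sqrt (ln X * ln (ln X)) * ln (ln (ln X)))) - 1)
      / sqrt (ln X / ln (ln X))) \<longlongrightarrow> (1 - \<eta>) ^ 3 * c) at_top"
      unfolding L_def using c \<eta> C by (intro resonator_gain_asymp) auto
  qed (rule ce(2))
  show ?thesis
    using eP eL eX ex es et1a et1b et2 eD eC eE eN eF
  proof eventually_elim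
    case (elim X)
    define s where "s = c0 * sqrt (ln X / ln (ln X))"
    have lx: "ln (x X) = 4 * sqrt (ln X * ln (ln X)) * ln (ln (ln X))" by (simp add: x_def)
    have x1: "x X \<ge> 1" unfolding x_def one_le_exp_iff using elim(4) by linarith
    have sx: "sqrt (x X) = exp (2 * sqrt (ln X * ln (ln X)) * ln (ln (ln X)))"
    proof (rule real_sqrt_unique)
      show "(exp (2 * sqrt (ln X * ln (ln X)) * ln (ln (ln X))))\<^sup>2 = x X"
        unfolding x_def by (simp add: exp_double [symmetric])
    qed simp
    have ssx: "sqrt (sqrt (x X)) = exp (sqrt (ln X * ln (ln X)) * ln (ln (ln X)))"
    proof (rule real_sqrt_unique)
      show "(exp (sqrt (ln X * ln (ln X)) * ln (ln (ln X))))\<^sup>2 = sqrt (x X)"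
        unfolding sx by (simp add: exp_double [symmetric] mult.assoc)
    qed simp
    have "ln (L X) \<ge> ln (exp (max 1 (1 / \<eta>)))"
      using elim(2) by (subst ln_le_cancel_iff) (auto intro: less_le_trans[OF exp_gt_zero])
    then have lnL: "ln (L X) \<ge> 1" "ln (L X) \<ge> 1 / \<eta>" by auto
    have "exp (max 1 (1 / \<eta>)) \<ge> 1 + max 1 (1 / \<eta>)" by (rule exp_ge_add_one_self)
    then have L2: "L X \<ge> 2" using elim(2) by linarith
    have Leta: "1 / ln (L X) \<le> \<eta>" using lnL \<eta> by (simp add: field_simps)
    have X1: "X \<ge> 1" by (rule elim(3))
    have lnX: "ln X > 0"
    proof (rule ccontr)
      assume "\<not> ln X > 0"
      then have "ln X = 0" using X1 by (simp add: not_less)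
      then show False using elim(5) by simp
    qed
    have s0: "s \<ge> 0" using elim(5) assms by (simp add: s_def)
    define M0 where "M0 = Max ((\<lambda>d. \<Sum>n\<in>{1..nat \<lfloor>x X\<rfloor>}. real_of_int (kronecker d n)) ` fund_discs X)"
    \<comment> \<open>The resonance argument takes a nonnegative bound; as the resulting lower bound
      is positive, the maximum is \<open>M0\<close> in the end.\<close>
    define M where "M = max M0 0"
    have "sqrt (x X) * exp s \<le> M"
    proof (rule char_sum_lower_bound[OF X1 \<eta>(1) _ \<delta> L2 lnL(1) Leta _ x1 _ _ _ _ _ C])
      show "\<eta> \<le> 1" using \<eta> by simp
      show "X powr (c / 4) \<ge> 1" using X1 c by (simp add: ge_one_powr_ge_zero)
      show "(\<Sum>p\<in>primes_between (nat \<lfloor>L X ^ 2\<rfloor>) (nat \<lfloor>L X ^ (2 * K)\<rfloor>). 1 / (real p * ln (real p))) \<le> (1 + \<eta>) / (2 * ln (L X))"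
        "(1 - \<eta>) / (2 * ln (L X)) \<le> (\<Sum>p\<in>primes_between (nat \<lfloor>L X ^ 2\<rfloor>) (nat \<lfloor>L X ^ (2 * K)\<rfloor>). 1 / (real p * ln (real p)))"
        "(\<Sum>p\<in>primes_between (nat \<lfloor>L X ^ 2\<rfloor>) (nat \<lfloor>L X ^ (2 * K)\<rfloor>). 1 / real p) \<le> real K + 1"
        using elim(1) by (simp_all add: Let_def)
      have lnN: "ln (X powr (c / 4)) = c / 4 * ln X" using X1 by (simp add: ln_powr)
      show "ln 8 \<le> \<delta> / ln (L X) * (ln (X powr (c / 4)) - (1 + \<eta>) * ((1 + \<eta>) * L X ^ 2 / (2 * ln (L X)) + L X * (real K + 1)))"
      proof -
        have "(1 + \<eta>) * ((1 + \<eta>) * L X ^ 2 / (2 * ln (L X)) + L X * (real K + 1)) \<le> (1 - \<eta>) * c / 4 * ln X"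
          using elim(6) lnX by (simp only: pos_divide_less_eq)
        then have "\<eta> * c / 4 * ln X \<le> c / 4 * ln X - (1 + \<eta>) * ((1 + \<eta>) * L X ^ 2 / (2 * ln (L X)) + L X * (real K + 1))"
          by (simp add: algebra_simps diff_divide_distrib)
        then have "\<delta> / ln (L X) * (\<eta> * c / 4 * ln X) \<le> \<delta> / ln (L X) * (c / 4 * ln X - (1 + \<eta>) * ((1 + \<eta>) * L X ^ 2 / (2 * ln (L X)) + L X * (real K + 1)))"
          using \<delta> lnL by (intro mult_left_mono) auto
        then show ?thesis using elim(7) unfolding lnN by simp
      qed
      show "ln 8 \<le> \<delta> / ln (L X) * (ln (sqrt (x X)) - (1 + \<eta>) * (2 * L X * (real K + 1)))"
        using elim(8) unfolding sx ln_exp .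
      show "X / 16 \<le> real (card (discs X))" using elim(9) card_discs_ge[OF X1] by linarith
      show "(2 * (ln (X powr (c / 4)) / (2 * ln (L X))) + 1) * (2 * X / L X ^ 2) \<le> X / 32"
      proof -
        have "(2 * (c / 4 * ln X / (2 * ln (L X))) + 1) * (2 / L X ^ 2) * X \<le> 1 / 32 * X"
          using elim(10) X1 by (intro mult_right_mono) auto
        then show ?thesis unfolding lnN by (simp add: mult_ac)
      qed
      show "x X * (16 * ((X powr (c / 4))\<^sup>2 * x X) * X powr (1 / 4) + 2 * X / X powr (1 / 4)) * X powr (c / 4) \<le> X / 16"
        using c elim(11) by (intro error_term_small X1 x1) (auto simp: lx)
      show "C * L X ^ 2 \<le> sqrt (sqrt (x X))" using elim(12) unfolding ssx .
      show "8 * C * ln (x X) * (exp s + 1) \<le> exp ((1 - \<eta>) ^ 3 * (L X / ln (L X)))"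
      proof -
        have pos: "8 * C * ln (x X) > 0" using C(1) elim(4) by (simp add: lx)
        have "s \<le> (1 - \<eta>) ^ 3 * (L X / ln (L X)) - ln (8 * C * ln (x X)) - 1"
          using elim(13) elim(5) unfolding lx s_def by (simp only: pos_less_divide_eq)
        then have le: "ln (8 * C * ln (x X)) + (s + 1) \<le> (1 - \<eta>) ^ 3 * (L X / ln (L X))" by linarith
        have "exp s + 1 \<le> exp s + exp s" using s0 by simp
        also have "\<dots> \<le> exp s * exp 1"
          using exp_ge_add_one_self[of 1] mult_left_mono[of 2 "exp 1" "exp s"] by simp
        also have "\<dots> = exp (s + 1)" by (simp add: exp_add)
        finally have "8 * C * ln (x X) * (exp s + 1) \<le> 8 * C * ln (x X) * exp (s + 1)"
          using pos by (intro mult_left_mono) auto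
        also have "\<dots> = exp (ln (8 * C * ln (x X)) + (s + 1))" using pos by (simp only: exp_add exp_ln)
        also have "\<dots> \<le> exp ((1 - \<eta>) ^ 3 * (L X / ln (L X)))" using le by simp
        finally show ?thesis .
      qed
      show "M \<ge> 0" by (simp add: M_def)
      show "(\<Sum>n\<in>{1..nat \<lfloor>x X\<rfloor>}. real_of_int (kronecker d n)) \<le> M" if "d \<in> discs X" for d
      proof -
        have "d \<in> fund_discs X" using that discs_subset_fund_discs[OF X1] by blast
        then have "(\<Sum>n\<in>{1..nat \<lfloor>x X\<rfloor>}. real_of_int (kronecker d n)) \<le> M0"
          unfolding M0_def using finite_fund_discs by (intro Max_ge) auto
        then show ?thesis by (simp add: M_def)
      qed
    qed
    moreover have "sqrt (x X) * exp s > 0" using x1 by simp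
    ultimately have "sqrt (x X) * exp s \<le> M0" by (simp add: M_def max_def split: if_splits)
    then show ?case unfolding M0_def s_def x_def .
  qed
qed

section \<open>Extraction of the o(1) from the bounds with fixed constants\<close>

theorem theorem1p2:
  assumes "GRH"
  shows "\<exists>\<epsilon> :: real \<Rightarrow> real. (\<epsilon> \<longlongrightarrow> 0) at_top \<and>
    (\<forall>\<^sub>F X in at_top.
       let x = exp (4 * sqrt (ln X * ln (ln X)) * ln (ln (ln X))) in
       Max ((\<lambda>d. \<Sum>n\<in>{1..nat \<lfloor>x\<rfloor>}. real_of_int (kronecker d n)) `
              {d :: int. X < real_of_int d \<and> real_of_int d \<le> 2 * X \<and> fundamental_discriminant d})
       \<ge> sqrt x * exp ((1 + \<epsilon> X) * sqrt (ln X / ln (ln X))))"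
proof -
  define x :: "real \<Rightarrow> real" where "x = (\<lambda>X. exp (4 * sqrt (ln X * ln (ln X)) * ln (ln (ln X))))"
  define s :: "real \<Rightarrow> real" where "s = (\<lambda>X. sqrt (ln X / ln (ln X)))"
  define M where "M = (\<lambda>X. Max ((\<lambda>d. \<Sum>n\<in>{1..nat \<lfloor>x X\<rfloor>}. real_of_int (kronecker d n)) ` fund_discs X))"
  \<comment> \<open>The exact relative deviation of the exponent, capped at 0: the cap makes the
    upper half of the convergence trivial, and lowering the exponent only weakens the claimed
    inequality.\<close>
  define \<epsilon> where "\<epsilon> = (\<lambda>X. min 0 (ln (M X / sqrt (x X)) / s X - 1))"
  have M: "\<forall>\<^sub>F X in at_top. sqrt (x X) * exp (c * s X) \<le> M X" if "0 < c" "c < 1" for c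
    unfolding M_def x_def s_def by (rule max_char_sum_eventually_ge[OF that])
  have s: "\<forall>\<^sub>F X in at_top. s X > 0" unfolding s_def by real_asymp
  have x: "sqrt (x X) > 0" for X by (simp add: x_def)
  have "(\<epsilon> \<longlongrightarrow> 0) at_top"
  proof (rule order_tendstoI)
    fix a :: real assume "a < 0"
    define c where "c = max (1 + a / 2) (1 / 2)"
    have c: "0 < c" "c < 1" "c - 1 > a" using \<open>a < 0\<close> by (auto simp: c_def max_def)
    show "\<forall>\<^sub>F X in at_top. a < \<epsilon> X"
      using M[OF c(1,2)] s
    proof eventually_elim
      case (elim X)
      have "exp (c * s X) \<le> M X / sqrt (x X)" using elim(1) x[of X] by (simp add: pos_le_divide_eq mult.commute)
      then have "c * s X \<le> ln (M X / sqrt (x X))"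
        by (subst ln_ge_iff) (auto intro: less_le_trans[OF exp_gt_zero])
      then have "c \<le> ln (M X / sqrt (x X)) / s X" using elim(2) by (simp add: pos_le_divide_eq)
      then show ?case using c(3) \<open>a < 0\<close> by (simp add: \<epsilon>_def)
    qed
  next
    fix a :: real assume "0 < a"
    then show "\<forall>\<^sub>F X in at_top. \<epsilon> X < a" by (intro always_eventually) (simp add: \<epsilon>_def min_def)
  qed
  moreover have "\<forall>\<^sub>F X in at_top. sqrt (x X) * exp ((1 + \<epsilon> X) * s X) \<le> M X"
    \<comment> \<open>The constant 1/2 serves to make \<open>M X\<close> positive, so that its
      logarithm can be undone by \<open>exp\<close>.\<close>
    using M[of "1 / 2", simplified] s
  proof eventually_elim
    case (elim X)
    have "0 < sqrt (x X) * exp (s X / 2)" using x[of X] by simp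
    then have M0: "M X > 0" using elim(1) by linarith
    have "(1 + \<epsilon> X) * s X \<le> ln (M X / sqrt (x X)) / s X * s X"
      using elim(2) by (intro mult_right_mono) (auto simp: \<epsilon>_def)
    also have "\<dots> = ln (M X / sqrt (x X))" using elim(2) by simp
    finally have "exp ((1 + \<epsilon> X) * s X) \<le> exp (ln (M X / sqrt (x X)))" by simp
    also have "\<dots> = M X / sqrt (x X)" using M0 x[of X] by (intro exp_ln divide_pos_pos)
    finally show ?case using x[of X] by (simp add: pos_le_divide_eq mult.commute)
  qed
  ultimately show ?thesis
    unfolding M_def x_def s_def fund_discs_def Let_def by blast
qed

end
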